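(* Let $\theta\in(0,1)$ be irrational with $w(\theta)>1$ (possibly $w(\theta)=\infty$). Then: (a) $\mathcal U_\tau[\theta]=\mathbb T$ if $0<\tau<1/w(\theta)$; (b) $\mathcal U_\tau[\theta]=\{i\theta\in\mathbb T: i\ge 1\}$ if $\tau>w(\theta)$; (c) if $1/w(\theta)<\tau<1$, then $$\dim_H\mathcal U_\tau[\theta]=\liminf_{k\to\infty}\frac{\log\Big(n_k^{1/\tau+1}\prod_{j=1}^{k-1}n_j^{1/\tau}\|n_j\theta\|\Big)}{\log\big(n_k\|n_k\theta\|^{-1}\big)},$$ where $(n_k)_{k\ge1}$ is the increasing enumeration of the set of convergent denominators $q_m$ of $\theta$ satisfying $q_m\|q_m\theta\|^\tau<1$; (d) if $1<\tau<w(\theta)$, then $$\dim_H\mathcal U_\tau[\theta]=\liminf_{k\to\infty}\frac{-\log\Big(\prod_{j=1}^{k-1}n_j\|n_j\theta\|^{1/\tau}\Big)}{\log\big(n_k\|n_k\theta\|^{-1}\big)},$$ where $(n_k)_{k\ge1}$ is the increasing enumeration of the set of convergent denominators $q_m$ of $\theta$ satisfying $q_m^\tau\|q_m\theta\|<2$.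
   Context: $\mathbb T=\mathbb R/\mathbb Z$; points of $\mathbb T$ are identified with their fractional parts. $\|t\|$ denotes the distance from a real $t$ to the nearest integer. For an irrational $\theta\in(0,1)$ with continued fraction expansion $\theta=[0;a_1,a_2,\dots]$, $p_k/q_k$ are the convergents, with $q_0=1,p_0=0$, $q_1=a_1$, $q_{k+1}=a_{k+1}q_k+q_{k-1}$. The irrationality exponent is $w(\theta)=\sup\{s>0:\liminf_{j\to\infty}j^s\|j\theta\|=0\}$ (equivalently $w(\theta)=\limsup_{k}\log q_{k+1}/\log q_k$); always $w(\theta)\ge1$. For $\tau>0$, $\mathcal U_\tau[\theta]$ is the set of $y\in\mathbb T$ such that there exists $Q_0$ with the property that for every real $Q\ge Q_0$ there is an integer $1\le n\le Q$ with $\|n\theta-y\|<Q^{-\tau}$. $\dim_H$ is Hausdorff dimension. *)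

theory Defs
  imports "HOL-Analysis.Analysis" "HOL-Library.Infinite_Set"
begin

definition dint :: "real \<Rightarrow> real" where
  "dint t = \<bar>t - of_int (round t)\<bar>"

text \<open>Continued fraction expansion via the Gauss map: remainders, partial quotients
  a_k (k >= 1) and convergent denominators q_k (q_0 = 1, q_1 = a_1,
  q_(k+1) = a_(k+1) q_k + q_(k-1)).\<close>
fun cf_rem :: "real \<Rightarrow> nat \<Rightarrow> real" where
  "cf_rem x 0 = x"
| "cf_rem x (Suc k) = frac (1 / cf_rem x k)"

definition cf_a :: "real \<Rightarrow> nat \<Rightarrow> nat" where
  "cf_a x k = nat \<lfloor>1 / cf_rem x (k - 1)\<rfloor>"

fun cf_q :: "real \<Rightarrow> nat \<Rightarrow> nat" where
  "cf_q x 0 = 1"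
| "cf_q x (Suc 0) = cf_a x 1"
| "cf_q x (Suc (Suc k)) = cf_a x (Suc (Suc k)) * cf_q x (Suc k) + cf_q x k"

definition irr_exp :: "real \<Rightarrow> ereal" where
  "irr_exp \<theta> = Sup {ereal s | s. s > 0 \<and>
     Liminf sequentially (\<lambda>j. ereal (real j powr s * dint (real j * \<theta>))) = 0}"

text \<open>The set U_tau[theta]; points of the torus are represented by reals in [0,1).\<close>
definition U_set :: "real \<Rightarrow> real \<Rightarrow> real set" where
  "U_set \<tau> \<theta> = {y \<in> {0..<1}. \<exists>Q0::real. \<forall>Q\<ge>Q0. \<exists>n::nat. 1 \<le> n \<and> real n \<le> Q \<and>
       dint (real n * \<theta> - y) < Q powr (-\<tau>)}"

definition hausdorff_pre :: "real \<Rightarrow> real \<Rightarrow> 'a::metric_space set \<Rightarrow> ennreal" where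
  "hausdorff_pre s \<delta> A =
     (INF U \<in> {U :: nat \<Rightarrow> 'a set. A \<subseteq> (\<Union>i. U i) \<and> (\<forall>i. bounded (U i) \<and> diameter (U i) \<le> \<delta>)}.
        (\<Sum>i. ennreal (diameter (U i) powr s)))"

definition hausdorff_measure :: "real \<Rightarrow> 'a::metric_space set \<Rightarrow> ennreal" where
  "hausdorff_measure s A = (SUP \<delta>\<in>{0<..}. hausdorff_pre s \<delta> A)"

definition hausdorff_dim :: "'a::metric_space set \<Rightarrow> ereal" where
  "hausdorff_dim A = Inf {ereal s | s. s > 0 \<and> hausdorff_measure s A = 0}"

end

theory Submission
  imports Defs
begin

text \<open>Let \<open>n\<close> be a convergent denominator, \<open>e\<close> the distance of \<open>n \<theta>\<close> to the integers. At the critical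
  time \<open>Q = (n / e) powr (1 / (1 + \<tau>))\<close> the balls of radius \<open>Q powr (- \<tau>)\<close> have the same length as the
  clusters \<open>a, a + n, a + 2 n, \<dots>\<close> of orbit points seen so far, namely
  \<open>r = (e / n) powr (\<tau> / (1 + \<tau>))\<close>. Hence a point of \<open>U_set \<tau> \<theta>\<close> lies within \<open>2 r\<close> of some \<open>a \<theta>\<close>
  with \<open>a \<le> n\<close>, and conversely points close to such \<open>a \<theta>\<close> (for \<open>\<tau> < 1\<close> on the side towards which
  the cluster grows) stay covered at all times at which \<open>n\<close> matters. Denominators outside the
  sequence \<open>n\<^sub>k\<close> impose no condition: for \<open>\<tau> < 1\<close> the balls cover the circle, for \<open>\<tau> > 1\<close> they are too
  short for the approximating index to change. So \<open>U_set \<tau> \<theta>\<close> is a countable union of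
  homogeneous Cantor sets with radii \<open>r\<^sub>k\<close> and spacing about \<open>1 / n\<^sub>k\<close> (if \<open>\<tau> < 1\<close>) or \<open>e\<^sub>k\<close> (if \<open>\<tau> > 1\<close>).
  As \<open>n\<^sub>k\<close> grows doubly exponentially, factors geometric in \<open>k\<close> do not affect the dimension.\<close>

section \<open>Hausdorff measure and Cantor sets\<close>

text \<open>Covers and Cantor subsets need different point families: \<open>P\<close> lists the
  points near which a member must lie, \<open>P'\<close> centres of balls certain to consist of
  members. For \<tau> < 1, \<open>P'\<close> is a shift of \<open>P\<close>, since a cluster fills
  an interval on one side of its first point only. For \<tau> > 1 it is eventually a part of
  \<open>P\<close> with smaller indices, since an index must be available before the time at which
  it is used. For \<tau> < 1 the radius r_k meets the spacing 1 / n_(k+1) of the next level, giving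
  factors r_k * n_(k+1). For \<tau> > 1 an index frozen after n_k belongs to an orbit with spacing
  e_k, while its ball shrinks to r_(k+1); so radius and spacing are shifted by one level and the
  factors are r_k / e_k. The thresholds have different origins. With 1, failing the test means 1 / q
  \<le> e powr \<tau>: the 1/q-dense orbit already covers the circle. With 2, two indices that
  approximate the same y within \<delta> have a difference d with dint (d * \<theta>) < 2 *
  \<delta>. Both tests read n powr \<alpha> * e < \<beta> with \<alpha> > 1, and n_(k+1) is at least
  of order 1 / e_k; this forces the doubly exponential growth.\<close>

lemma hausdorff_pre_mono:
  assumes "A \<subseteq> B"
  shows "hausdorff_pre s \<delta> A \<le> hausdorff_pre s \<delta> B"
  unfolding hausdorff_pre_def by (rule INF_superset_mono) (use assms in auto)

lemma hausdorff_measure_mono: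
  assumes "A \<subseteq> B"
  shows "hausdorff_measure s A \<le> hausdorff_measure s B"
  unfolding hausdorff_measure_def by (rule SUP_mono) (use hausdorff_pre_mono[OF assms] in blast)

lemma hausdorff_measure_eq_0_iff:
  "hausdorff_measure s A = 0 \<longleftrightarrow> (\<forall>\<delta>>0. hausdorff_pre s \<delta> A = 0)"
  unfolding hausdorff_measure_def by (auto simp: SUP_eq_iff bot_ennreal[symmetric] SUP_bot_conv)

lemma hausdorff_pre_less_iff:
  "hausdorff_pre s \<delta> A < x \<longleftrightarrow> (\<exists>U :: nat \<Rightarrow> 'a::metric_space set. A \<subseteq> (\<Union>i. U i) \<and>
     (\<forall>i. bounded (U i) \<and> diameter (U i) \<le> \<delta>) \<and> (\<Sum>i. ennreal (diameter (U i) powr s)) < x)"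
  unfolding hausdorff_pre_def INF_less_iff by auto

lemma hausdorff_pre_eq_0I:
  assumes "\<And>\<eta>. \<eta> > 0 \<Longrightarrow> hausdorff_pre s \<delta> A \<le> ennreal \<eta>"
  shows "hausdorff_pre s \<delta> A = 0"
proof -
  have "hausdorff_pre s \<delta> A \<le> 0"
    by (rule ennreal_le_epsilon) (use assms in simp)
  thus ?thesis by simp
qed

text \<open>The K-th cover receives the share \<eta> / 2 ^ (K + 1) of the error, and
  \<open>prod_decode\<close> lists all covers as one sequence.\<close>

lemma hausdorff_pre_UN_null:
  fixes E :: "nat \<Rightarrow> 'a::metric_space set"
  assumes null: "\<And>K. hausdorff_pre s \<delta> (E K) = 0"
  shows "hausdorff_pre s \<delta> (\<Union>K. E K) = 0"
proof (rule hausdorff_pre_eq_0I)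
  fix \<eta> :: real assume \<eta>: "\<eta> > 0"
  have "\<exists>U :: nat \<Rightarrow> 'a set. E K \<subseteq> (\<Union>i. U i) \<and> (\<forall>i. bounded (U i) \<and> diameter (U i) \<le> \<delta>) \<and>
      (\<Sum>i. ennreal (diameter (U i) powr s)) < ennreal (\<eta> * (1/2) ^ Suc K)" for K
    using \<eta> null[of K] by (subst hausdorff_pre_less_iff[symmetric]) auto
  then obtain U :: "nat \<Rightarrow> nat \<Rightarrow> 'a set" where U: "\<And>K. E K \<subseteq> (\<Union>i. U K i)"
    "\<And>K i. bounded (U K i) \<and> diameter (U K i) \<le> \<delta>"
    "\<And>K. (\<Sum>i. ennreal (diameter (U K i) powr s)) < ennreal (\<eta> * (1/2) ^ Suc K)"
    by metis
  define f where "f = (\<lambda>(m, n). ennreal (diameter (U m n) powr s))"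
  define V where "V i = (case prod_decode i of (m, n) \<Rightarrow> U m n)" for i
  have cover: "(\<Union>K. E K) \<subseteq> (\<Union>i. V i)"
  proof
    fix x assume "x \<in> (\<Union>K. E K)"
    then obtain K where "x \<in> E K" by blast
    then obtain i where "x \<in> U K i" using U(1) by blast
    hence "x \<in> V (prod_encode (K, i))" by (simp add: V_def)
    thus "x \<in> (\<Union>i. V i)" by blast
  qed
  have "hausdorff_pre s \<delta> (\<Union>K. E K) \<le> (\<Sum>i. ennreal (diameter (V i) powr s))"
    unfolding hausdorff_pre_def
    by (rule INF_lower) (use cover U(2) in \<open>auto simp: V_def split: prod.splits\<close>)
  also have "\<dots> = (\<Sum>i. f (prod_decode i))"
    by (rule suminf_cong) (auto simp: V_def f_def split: prod.splits)
  also have "\<dots> = (\<Sum>m. \<Sum>n. f (m, n))"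
    by (rule suminf_ennreal_2dimen) simp
  also have "\<dots> \<le> (\<Sum>m. ennreal (\<eta> * (1/2) ^ Suc m))"
    by (rule suminf_le) (use U(3) in \<open>auto simp: f_def less_imp_le\<close>)
  also have "\<dots> = ennreal (\<eta> * 1)"
    by (rule suminf_ennreal_eq) (use \<eta> power_half_series sums_mult[of "\<lambda>n. (1/2)^Suc n" 1 \<eta>] in auto)
  finally show "hausdorff_pre s \<delta> (\<Union>K. E K) \<le> ennreal \<eta>" by simp
qed

lemma hausdorff_measure_UN_null:
  fixes E :: "nat \<Rightarrow> 'a::metric_space set"
  assumes "\<And>K. hausdorff_measure s (E K) = 0"
  shows "hausdorff_measure s (\<Union>K. E K) = 0"
  using assms hausdorff_pre_UN_null[of s _ E] by (auto simp: hausdorff_measure_eq_0_iff)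

lemma hausdorff_pre_finite_cover:
  fixes A F :: "real set"
  assumes F: "finite F" and cover: "A \<subseteq> (\<Union>c\<in>F. cball c R)" and R: "0 \<le> R" "2 * R \<le> \<delta>"
  shows "hausdorff_pre s \<delta> A \<le> ennreal (real (card F) * (2 * R) powr s)"
proof -
  obtain h where h: "bij_betw h {..<card F} F"
    using ex_bij_betw_nat_finite[OF F] by (auto simp: atLeast0LessThan)
  \<comment> \<open>Covers are indexed by all naturals; padding by empty sets is free, as their
    diameter is 0 and \<open>0 powr s = 0\<close>.\<close>
  define U where "U i = (if i < card F then cball (h i) R else {})" for i
  have "A \<subseteq> (\<Union>i. U i)"
  proof
    fix x assume "x \<in> A"
    then obtain c where c: "c \<in> F" "x \<in> cball c R" using cover by blast
    then obtain i where "i < card F" "h i = c"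
      using h unfolding bij_betw_def by (metis imageE lessThan_iff)
    thus "x \<in> (\<Union>i. U i)" using c by (auto simp: U_def)
  qed
  hence "hausdorff_pre s \<delta> A \<le> (\<Sum>i. ennreal (diameter (U i) powr s))"
    unfolding hausdorff_pre_def by (intro INF_lower) (use R in \<open>auto simp: U_def\<close>)
  also have "\<dots> = (\<Sum>i<card F. ennreal (diameter (U i) powr s))"
    by (rule suminf_finite) (auto simp: U_def)
  also have "\<dots> = (\<Sum>i<card F. ennreal ((2 * R) powr s))"
    using R by (intro sum.cong) (auto simp: U_def)
  also have "\<dots> = ennreal (real (card F) * (2 * R) powr s)"
    by (simp add: ennreal_mult ennreal_of_nat_eq_real_of_nat)
  finally show ?thesis .
qed

text \<open>Cells of length g contain at most one point of S each, so the cell number is injective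
  on S.\<close>

lemma separated_card_le:
  fixes S :: "real set"
  assumes sub: "S \<subseteq> {a..b}" and g: "g > 0" and ab: "a \<le> b"
    and sep: "\<And>x y. x \<in> S \<Longrightarrow> y \<in> S \<Longrightarrow> x \<noteq> y \<Longrightarrow> \<bar>x - y\<bar> \<ge> g"
  shows "finite S \<and> real (card S) \<le> (b - a) / g + 1"
proof -
  define f where "f x = \<lfloor>(x - a) / g\<rfloor>" for x
  have inj: "inj_on f S"
  proof (rule inj_onI)
    fix x y assume xy: "x \<in> S" "y \<in> S" "f x = f y"
    show "x = y"
    proof (rule ccontr)
      assume "x \<noteq> y"
      hence "\<bar>x - y\<bar> \<ge> g" using sep xy by blast
      moreover have "\<bar>(x - a) / g - (y - a) / g\<bar> < 1" using xy(3) unfolding f_def by linarith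
      hence "\<bar>x - y\<bar> / g < 1" using g by (simp add: diff_divide_distrib[symmetric])
      ultimately show False using g by (simp add: field_simps)
    qed
  qed
  have sub': "f ` S \<subseteq> {0..\<lfloor>(b - a) / g\<rfloor>}"
  proof (intro image_subsetI)
    fix x assume "x \<in> S"
    hence "a \<le> x" "x \<le> b" using sub by auto
    hence "0 \<le> (x - a) / g" "(x - a) / g \<le> (b - a) / g"
      using g by (auto intro: divide_right_mono)
    thus "f x \<in> {0..\<lfloor>(b - a) / g\<rfloor>}" by (auto simp: f_def intro: floor_mono)
  qed
  have fin: "finite S" using inj sub' finite_subset finite_imageD by blast
  have "card S \<le> card {0..\<lfloor>(b - a) / g\<rfloor>}"
    using card_image[OF inj] card_mono[OF _ sub'] by simp
  hence "real (card S) \<le> real (nat (\<lfloor>(b - a) / g\<rfloor> + 1))" by simp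
  also have "\<dots> \<le> (b - a) / g + 1"
    using ab g by (subst of_nat_nat) (auto simp: add_nonneg_nonneg)
  finally show ?thesis using fin by simp
qed

text \<open>The discrete measures giving each point of \<open>C m\<close> the same weight replace the limit mass
  distribution; compactness of \<open>E\<close> reduces a cover to finitely many sets, all of which are
  seen correctly by one such measure.\<close>
lemma hausdorff_measure_nonzero_if_counting:
  fixes E :: "real set" and C :: "nat \<Rightarrow> real set"
  assumes E: "compact E" and s: "s > 0"
    and C: "\<And>m. finite (C m)" "\<And>m. C m \<noteq> {}"
    and meet: "\<And>m c. c \<in> C m \<Longrightarrow> cball c (\<rho> m) \<inter> E \<noteq> {}"
    and B: "B > 0" and d0: "d0 > 0"
    and count: "\<And>d U. \<lbrakk>0 < d; d < d0; \<And>x y. x \<in> U \<Longrightarrow> y \<in> U \<Longrightarrow> \<bar>x - y\<bar> \<le> d\<rbrakk> \<Longrightarrow>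
      \<exists>k. \<forall>m\<ge>k. real (card {c \<in> C m. cball c (\<rho> m) \<inter> U \<noteq> {}}) \<le> B * d powr s * real (card (C m))"
  shows "hausdorff_measure s E \<noteq> 0"
proof
  assume "hausdorff_measure s E = 0"
  hence pre: "hausdorff_pre s (d0 / 2) E = 0"
    using d0 by (auto simp: hausdorff_measure_eq_0_iff)
  \<comment> \<open>The contradiction will be 1 \<le> B * sum < 2 * B * \<eta> = 1/2; the factor 2
    pays for enlarging the sets to open ones.\<close>
  define \<eta> where "\<eta> = 1 / (4 * B)"
  have \<eta>: "\<eta> > 0" using B by (simp add: \<eta>_def)
  have "hausdorff_pre s (d0 / 2) E < ennreal \<eta>" using pre \<eta> by simp
  then obtain U :: "nat \<Rightarrow> real set" where U: "E \<subseteq> (\<Union>i. U i)"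
      "\<And>i. bounded (U i)" "\<And>i. diameter (U i) \<le> d0 / 2"
      "(\<Sum>i. ennreal (diameter (U i) powr s)) < ennreal \<eta>"
    unfolding hausdorff_pre_less_iff by blast
  have diam0: "diameter (U i) \<ge> 0" for i using U(2) by (rule diameter_ge_0)
  \<comment> \<open>Strictly larger diameters leave room for open neighbourhoods, also around sets
    of diameter 0; right continuity of \<open>powr\<close> keeps the added weight summable.\<close>
  have "\<exists>d. diameter (U i) < d \<and> d < d0 \<and> d powr s < diameter (U i) powr s + \<eta> * (1/2) ^ Suc i" for i
  proof -
    let ?D = "diameter (U i)"
    have "((\<lambda>x. x powr s) \<longlongrightarrow> ?D powr s) (at_right ?D)"
    proof (rule tendsto_powr')
      show "((\<lambda>x. x) \<longlongrightarrow> ?D) (at_right ?D)" by (rule tendsto_ident_at)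
      have "eventually (\<lambda>x. x > ?D) (at_right ?D)" by (simp add: eventually_at_right_less)
      hence "eventually (\<lambda>x. x \<ge> 0) (at_right ?D)"
        by eventually_elim (use diam0[of i] in linarith)
      thus "?D \<noteq> 0 \<or> s > 0 \<and> eventually (\<lambda>x. x \<ge> 0) (at_right ?D)" using s by simp
    qed auto
    hence "eventually (\<lambda>x. x powr s < ?D powr s + \<eta> * (1/2) ^ Suc i) (at_right ?D)"
      by (rule order_tendstoD) (use \<eta> in simp)
    moreover have "eventually (\<lambda>x. x \<in> {?D<..<d0}) (at_right ?D)"
      by (rule eventually_at_right_real) (use U(3)[of i] d0 in linarith)
    ultimately have "eventually (\<lambda>x. ?D < x \<and> x < d0 \<and> x powr s < ?D powr s + \<eta> * (1/2) ^ Suc i) (at_right ?D)"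
      by eventually_elim auto
    from eventually_happens'[OF trivial_limit_at_right_real this] show ?thesis by blast
  qed
  then obtain d where d: "\<And>i. diameter (U i) < d i" "\<And>i. d i < d0"
      "\<And>i. d i powr s < diameter (U i) powr s + \<eta> * (1/2) ^ Suc i"
    by metis
  define V where "V i = (\<Union>u\<in>U i. ball u ((d i - diameter (U i)) / 2))" for i
  have "\<exists>k. \<forall>m\<ge>k. real (card {c \<in> C m. cball c (\<rho> m) \<inter> V i \<noteq> {}}) \<le> B * d i powr s * real (card (C m))" for i
  proof (rule count)
    show "0 < d i" using d(1)[of i] diam0[of i] by linarith
    show "d i < d0" by (rule d)
    fix x y assume "x \<in> V i" "y \<in> V i"
    then obtain u v where uv: "u \<in> U i" "v \<in> U i" "dist u x < (d i - diameter (U i)) / 2"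
      "dist v y < (d i - diameter (U i)) / 2" by (auto simp: V_def)
    moreover have "dist u v \<le> diameter (U i)"
      by (rule diameter_bounded_bound) (use U uv in auto)
    moreover have "\<bar>x - y\<bar> \<le> dist u x + dist u v + dist v y" unfolding dist_real_def by linarith
    ultimately show "\<bar>x - y\<bar> \<le> d i" by argo
  qed
  then obtain k where k: "\<And>i m. m \<ge> k i \<Longrightarrow>
      real (card {c \<in> C m. cball c (\<rho> m) \<inter> V i \<noteq> {}}) \<le> B * d i powr s * real (card (C m))"
    by metis
  have Vcov: "E \<subseteq> (\<Union>i\<in>UNIV. V i)"
  proof
    fix x assume "x \<in> E"
    then obtain i where "x \<in> U i" using U(1) by blast
    hence "x \<in> V i" using d(1)[of i] by (auto simp: V_def intro!: bexI[of _ x])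
    thus "x \<in> (\<Union>i\<in>UNIV. V i)" by blast
  qed
  have Vopen: "\<And>i. i \<in> UNIV \<Longrightarrow> open (V i)"
    unfolding V_def by (intro open_UN ballI open_ball)
  obtain I where I: "I \<subseteq> UNIV" "finite I" "E \<subseteq> (\<Union>i\<in>I. V i)"
    using compactE_image[OF E Vopen Vcov] .
  \<comment> \<open>One common level at which every set of the finite subcover is counted correctly;
    the inserted 0 keeps \<open>Max\<close> meaningful for empty I.\<close>
  define m where "m = Max (insert 0 (k ` I))"
  have m: "m \<ge> k i" if "i \<in> I" for i unfolding m_def using I(2) that by (intro Max_ge) auto
  have cardpos: "card (C m) > 0" using C by (simp add: card_gt_0_iff)
  have "C m \<subseteq> (\<Union>i\<in>I. {c \<in> C m. cball c (\<rho> m) \<inter> V i \<noteq> {}})"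
  proof
    fix c assume c: "c \<in> C m"
    then obtain z where z: "z \<in> cball c (\<rho> m)" "z \<in> E" using meet by blast
    then obtain i where "i \<in> I" "z \<in> V i" using I(3) by blast
    thus "c \<in> (\<Union>i\<in>I. {c \<in> C m. cball c (\<rho> m) \<inter> V i \<noteq> {}})" using c z by blast
  qed
  hence "card (C m) \<le> card (\<Union>i\<in>I. {c \<in> C m. cball c (\<rho> m) \<inter> V i \<noteq> {}})"
    using C(1) I(2) by (intro card_mono) auto
  also have "\<dots> \<le> (\<Sum>i\<in>I. card {c \<in> C m. cball c (\<rho> m) \<inter> V i \<noteq> {}})"
    by (rule card_UN_le[OF I(2)])
  finally have "real (card (C m)) \<le> real (\<Sum>i\<in>I. card {c \<in> C m. cball c (\<rho> m) \<inter> V i \<noteq> {}})"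
    by (rule of_nat_mono)
  also have "\<dots> = (\<Sum>i\<in>I. real (card {c \<in> C m. cball c (\<rho> m) \<inter> V i \<noteq> {}}))"
    by (rule of_nat_sum)
  also have "\<dots> \<le> (\<Sum>i\<in>I. B * d i powr s * real (card (C m)))"
    by (rule sum_mono) (use k m in blast)
  also have "\<dots> = (B * (\<Sum>i\<in>I. d i powr s)) * real (card (C m))"
    by (simp add: sum_distrib_left sum_distrib_right)
  finally have one: "1 \<le> B * (\<Sum>i\<in>I. d i powr s)" using cardpos by simp
  have "(\<Sum>i\<in>I. ennreal (diameter (U i) powr s)) \<le> (\<Sum>i. ennreal (diameter (U i) powr s))"
    by (rule sum_le_suminf) (use I in auto)
  also have "\<dots> < ennreal \<eta>" by (rule U)
  finally have "ennreal (\<Sum>i\<in>I. diameter (U i) powr s) < ennreal \<eta>" by (simp add: sum_ennreal)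
  hence S1: "(\<Sum>i\<in>I. diameter (U i) powr s) < \<eta>" using \<eta> by (subst (asm) ennreal_less_iff) (auto intro: sum_nonneg)
  have sums: "(\<lambda>i. \<eta> * (1/2) ^ Suc i) sums (\<eta> * 1)"
    by (rule sums_mult) (rule power_half_series)
  have S2: "(\<Sum>i\<in>I. \<eta> * (1/2) ^ Suc i) \<le> \<eta>"
    using sum_le_suminf[OF sums_summable[OF sums] I(2)] \<eta> sums_unique[OF sums] by auto
  have "(\<Sum>i\<in>I. d i powr s) \<le> (\<Sum>i\<in>I. diameter (U i) powr s + \<eta> * (1/2) ^ Suc i)"
    by (rule sum_mono) (use d(3) less_imp_le in blast)
  also have "\<dots> < 2 * \<eta>" using S1 S2 by (simp add: sum.distrib)
  finally have "B * (\<Sum>i\<in>I. d i powr s) < B * (2 * \<eta>)" using B by simp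
  thus False using one B by (simp add: \<eta>_def)
qed

text \<open>Mass distribution on a homogeneous Cantor set. A set of diameter d with \<rho> (k+1)
  \<le> d < \<rho> k is counted at level k+1, where separation leaves at most 4 * d / g (k+1) + 1
  balls. \<open>mass\<close> says that a ball of level k carries at most a constant times
  \<open>\<rho> k powr s\<close>, and \<open>many\<close> that children fill their parent up to a
  constant.\<close>

lemma cantor_measure_nonzero:
  fixes \<rho> g :: "nat \<Rightarrow> real" and M :: "nat \<Rightarrow> nat" and P :: "nat \<Rightarrow> real set"
  assumes \<rho>_pos: "\<And>k. \<rho> k > 0" and \<rho>_dec: "\<And>k. \<rho> (Suc k) \<le> \<rho> k" and \<rho>_lim: "\<rho> \<longlonglongrightarrow> 0"
    and gap: "\<And>k. 2 * \<rho> k < g k"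
    and sep: "\<And>k x y. x \<in> P k \<Longrightarrow> y \<in> P k \<Longrightarrow> x \<noteq> y \<Longrightarrow> \<bar>x - y\<bar> \<ge> g k"
    and M: "\<And>k. M k \<ge> 1"
    and child: "\<And>k c. c \<in> P k \<Longrightarrow> \<exists>F. F \<subseteq> P (Suc k) \<and> finite F \<and> card F = M k \<and>
      (\<forall>c'\<in>F. \<bar>c' - c\<bar> \<le> \<rho> k - \<rho> (Suc k))"
    and c0: "c0 \<in> P 0" and s: "0 < s" "s \<le> 1"
    and B: "B > 0" and mass: "\<And>k. B \<le> (\<Prod>i<k. real (M i)) * \<rho> k powr s"
    and b: "b > 0" and many: "\<And>k. b * \<rho> k \<le> real (M k) * g (Suc k)"
  shows "\<exists>E. (\<forall>y\<in>E. \<bar>y - c0\<bar> \<le> \<rho> 0 \<and> (\<forall>k. \<exists>c\<in>P k. \<bar>y - c\<bar> \<le> \<rho> k)) \<and> hausdorff_measure s E \<noteq> 0"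
proof -
  have g: "g k > 0" for k using gap[of k] \<rho>_pos[of k] by linarith
  obtain F where F: "\<And>k c. c \<in> P k \<Longrightarrow> F k c \<subseteq> P (Suc k)" "\<And>k c. c \<in> P k \<Longrightarrow> finite (F k c)"
      "\<And>k c. c \<in> P k \<Longrightarrow> card (F k c) = M k"
      "\<And>k c c'. c \<in> P k \<Longrightarrow> c' \<in> F k c \<Longrightarrow> \<bar>c' - c\<bar> \<le> \<rho> k - \<rho> (Suc k)"
  proof -
    define F where "F k c = (SOME F. F \<subseteq> P (Suc k) \<and> finite F \<and> card F = M k \<and>
      (\<forall>c'\<in>F. \<bar>c' - c\<bar> \<le> \<rho> k - \<rho> (Suc k)))" for k c
    have "F k c \<subseteq> P (Suc k) \<and> finite (F k c) \<and> card (F k c) = M k \<and>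
      (\<forall>c'\<in>F k c. \<bar>c' - c\<bar> \<le> \<rho> k - \<rho> (Suc k))" if "c \<in> P k" for k c
      unfolding F_def by (rule someI_ex) (rule child[OF that])
    thus ?thesis using that by blast
  qed
  define C where "C = rec_nat {c0} (\<lambda>k A. \<Union>c\<in>A. F k c)"
  have C0: "C 0 = {c0}" and CS: "C (Suc k) = (\<Union>c\<in>C k. F k c)" for k by (simp_all add: C_def)
  have CP: "C k \<subseteq> P k" for k by (induction k) (use c0 F(1) in \<open>auto simp: C0 CS\<close>)
  have Cfin: "finite (C k)" for k by (induction k) (use F(2) CP in \<open>auto simp: C0 CS\<close>)
  \<comment> \<open>A common child would bring two centres closer than 2 * \<rho> k, hence closer
    than the gap.\<close>
  have disj: "F k c \<inter> F k c' = {}" if "c \<in> C k" "c' \<in> C k" "c \<noteq> c'" for k c c'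
  proof (rule ccontr)
    assume "F k c \<inter> F k c' \<noteq> {}"
    then obtain z where z: "z \<in> F k c" "z \<in> F k c'" by blast
    have "\<bar>z - c\<bar> \<le> \<rho> k - \<rho> (Suc k)" "\<bar>z - c'\<bar> \<le> \<rho> k - \<rho> (Suc k)"
      using F(4)[OF _ z(1)] F(4)[OF _ z(2)] that CP by blast+
    moreover have "\<bar>c - c'\<bar> \<ge> g k" using sep[of c k c'] that CP by blast
    ultimately show False using gap[of k] \<rho>_pos[of "Suc k"] by linarith
  qed
  have cardU: "card (\<Union>c\<in>A. F k c) = card A * M k" if "A \<subseteq> C k" for A k
  proof -
    have "card (\<Union>c\<in>A. F k c) = (\<Sum>c\<in>A. card (F k c))"
    proof (rule card_UN_disjoint)
      show "finite A" using that Cfin finite_subset by blast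
      show "\<forall>c\<in>A. finite (F k c)" using that F(2) CP by blast
      show "\<forall>c\<in>A. \<forall>c'\<in>A. c \<noteq> c' \<longrightarrow> F k c \<inter> F k c' = {}" using that disj by blast
    qed
    also have "\<dots> = (\<Sum>c\<in>A. M k)" by (rule sum.cong) (use that F(3) CP[of k] in blast)+
    finally show ?thesis by simp
  qed
  have cardC: "card (C k) = (\<Prod>i<k. M i)" for k
    by (induction k) (auto simp: C0 CS cardU)
  have cardC_pos: "card (C k) > 0" for k unfolding cardC using M by (auto intro!: prod_pos simp: Suc_le_eq)
  have Cne: "C k \<noteq> {}" for k using cardC_pos[of k] by auto
  have sub: "cball c' (\<rho> (Suc k)) \<subseteq> cball c (\<rho> k)" if "c \<in> C k" "c' \<in> F k c" for k c c'
  proof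
    fix z assume "z \<in> cball c' (\<rho> (Suc k))"
    moreover have "\<bar>c' - c\<bar> \<le> \<rho> k - \<rho> (Suc k)" using F(4) that CP by blast
    ultimately show "z \<in> cball c (\<rho> k)" by (auto simp: dist_real_def)
  qed
  define X where "X k = (\<Union>c\<in>C k. cball c (\<rho> k))" for k
  have XS: "X (Suc k) \<subseteq> X k" for k
  proof
    fix z assume "z \<in> X (Suc k)"
    then obtain c c' where c: "c \<in> C k" "c' \<in> F k c" "z \<in> cball c' (\<rho> (Suc k))"
      unfolding X_def CS by blast
    hence "z \<in> cball c (\<rho> k)" using sub[of c k c'] by blast
    thus "z \<in> X k" unfolding X_def using c by blast
  qed
  have Xanti: "X j \<subseteq> X i" if "i \<le> j" for i j
    using that by (induction rule: dec_induct) (use XS in auto)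
  have Xcompact: "compact (X k)" for k unfolding X_def using Cfin by (intro compact_UN) auto
  define E where "E = (\<Inter>k. X k)"
  have Ecompact: "compact E" unfolding E_def by (rule compact_Inter) (use Xcompact in auto)
  have meet: "cball c (\<rho> m) \<inter> E \<noteq> {}" if c: "c \<in> C m" for m c
  proof -
    have Fne: "F k x \<noteq> {}" if "x \<in> C k" for k x
      using F(3)[of x k] that CP[of k] M[of k] by auto
    \<comment> \<open>Choosing children forever gives nested balls; their common point lies in every
      \<open>X k\<close>, for k < m because \<open>X\<close> decreases.\<close>
    define e where "e = rec_nat c (\<lambda>j x. SOME x'. x' \<in> F (m + j) x)"
    have e0: "e 0 = c" and eS: "e (Suc j) = (SOME x'. x' \<in> F (m + j) (e j))" for j
      by (simp_all add: e_def)
    have eF: "e (Suc j) \<in> F (m + j) (e j)" if "e j \<in> C (m + j)" for j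
      unfolding eS using Fne[OF that] some_in_eq by blast
    have eC: "e j \<in> C (m + j)" for j
    proof (induction j)
      case (Suc j)
      then show ?case using eF[OF Suc] by (auto simp: CS)
    qed (simp add: e0 c)
    define Y where "Y j = cball (e j) (\<rho> (m + j))" for j
    have "Y (Suc j) \<subseteq> Y j" for j unfolding Y_def using sub[OF eC eF[OF eC]] by simp
    hence Yanti: "Y j \<subseteq> Y i" if "i \<le> j" for i j using that by (rule lift_Suc_antimono_le)
    have "\<Inter>(range Y) \<noteq> {}"
    proof (rule compact_nest)
      show "Y j \<noteq> {}" for j using \<rho>_pos[of "m + j"] by (simp add: Y_def)
    qed (use Yanti in \<open>auto simp: Y_def\<close>)
    then obtain z where "z \<in> \<Inter>(range Y)" by (meson all_not_in_conv)
    hence z: "z \<in> Y j" for j by blast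
    have "z \<in> X (m + j)" for j using z[of j] eC[of j] by (auto simp: X_def Y_def)
    hence "z \<in> X k" for k using Xanti[of k "m + k"] by auto
    thus ?thesis using z[of 0] by (auto simp: E_def Y_def e0)
  qed
  \<comment> \<open>The summands answer for the two terms of 4 * d / G + 1 in
    \<open>cardT\<close>.\<close>
  define B' where "B' = 4 / (b * B) + 1 / B"
  have count: "\<exists>k. \<forall>m\<ge>k. real (card {c \<in> C m. cball c (\<rho> m) \<inter> U \<noteq> {}}) \<le> B' * d powr s * real (card (C m))"
    if d: "0 < d" "d < \<rho> 0" and U: "\<And>x y. x \<in> U \<Longrightarrow> y \<in> U \<Longrightarrow> \<bar>x - y\<bar> \<le> d" for d U
  proof -
    define T where "T k = {c \<in> C k. cball c (\<rho> k) \<inter> U \<noteq> {}}" for k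
    have Tfin: "finite (T k)" for k using Cfin by (simp add: T_def)
    have TS: "card (T (Suc k)) \<le> card (T k) * M k" for k
    proof -
      have "T (Suc k) \<subseteq> (\<Union>c\<in>T k. F k c)"
      proof
        fix c' assume c': "c' \<in> T (Suc k)"
        then obtain c where c: "c \<in> C k" "c' \<in> F k c" by (auto simp: T_def CS)
        have "cball c (\<rho> k) \<inter> U \<noteq> {}" using c' sub[OF c] by (auto simp: T_def)
        thus "c' \<in> (\<Union>c\<in>T k. F k c)" using c by (auto simp: T_def)
      qed
      moreover have "finite (\<Union>c\<in>T k. F k c)" using F(2) CP Tfin by (auto simp: T_def)
      ultimately have "card (T (Suc k)) \<le> card (\<Union>c\<in>T k. F k c)" by (rule card_mono[rotated])
      also have "\<dots> = card (T k) * M k" by (rule cardU) (auto simp: T_def)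
      finally show ?thesis .
    qed
    \<comment> \<open>The share of balls meeting \<open>U\<close> cannot grow from level to level:
      descendants of a ball that misses \<open>U\<close> miss it too.\<close>
    have prop_le: "real (card (T m)) \<le> A * real (card (C m))"
      if "real (card (T k)) \<le> A * real (card (C k))" "m \<ge> k" for k m A
      using that(2)
    proof (induction rule: dec_induct)
      case (step j)
      have "real (card (T (Suc j))) \<le> real (card (T j)) * real (M j)"
        using of_nat_mono[OF TS[of j], where 'a = real] by simp
      also have "\<dots> \<le> A * real (card (C j)) * real (M j)"
        by (rule mult_right_mono) (use step in auto)
      finally show ?case by (simp add: cardC mult_ac)
    qed (use that in simp)
    have "\<exists>j. \<rho> j \<le> d"
      using order_tendstoD(2)[OF \<rho>_lim d(1)] by (auto simp: eventually_sequentially intro: less_imp_le)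
    then obtain k where k: "\<rho> (Suc k) \<le> d" "d < \<rho> k"
    proof -
      define j where "j = (LEAST j. \<rho> j \<le> d)"
      have j: "\<rho> j \<le> d" unfolding j_def using \<open>\<exists>j. \<rho> j \<le> d\<close> by (rule LeastI_ex)
      then obtain i where i: "j = Suc i" using d(2) by (cases j) auto
      have "\<not> \<rho> i \<le> d" using not_less_Least[of i "\<lambda>j. \<rho> j \<le> d"] i unfolding j_def by simp
      thus ?thesis using that[of i] j i by auto
    qed
    define G N where "G = g (Suc k)" and "N = real (card (C (Suc k)))"
    have G: "G > 0" using g by (simp add: G_def)
    have Nk: "N = real (card (C k)) * real (M k)" by (simp add: N_def cardC)
    have cardT: "real (card (T (Suc k))) \<le> 4 * d / G + 1"
    proof (cases "U = {}")
      case True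
      then show ?thesis using d G by (simp add: T_def)
    next
      case False
      then obtain u where u: "u \<in> U" by blast
      have "T (Suc k) \<subseteq> {u - 2 * d..u + 2 * d}"
      proof
        fix c assume "c \<in> T (Suc k)"
        then obtain x where "x \<in> U" "\<bar>c - x\<bar> \<le> \<rho> (Suc k)" by (auto simp: T_def dist_real_def)
        thus "c \<in> {u - 2 * d..u + 2 * d}" using U[OF u, of x] k by auto
      qed
      hence "finite (T (Suc k)) \<and> real (card (T (Suc k))) \<le> ((u + 2 * d) - (u - 2 * d)) / G + 1"
        by (rule separated_card_le) (use G d sep CP in \<open>auto simp: T_def G_def subset_iff\<close>)
      thus ?thesis by simp
    qed
    \<comment> \<open>The term 1 is absorbed by the mass bound at level k+1, as \<rho> (k+1) \<le>
      d.\<close>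
    have "1 \<le> d powr s * N / B"
    proof -
      have "B \<le> N * \<rho> (Suc k) powr s" using mass[of "Suc k"] by (simp add: N_def cardC)
      also have "\<dots> \<le> N * d powr s"
        using k(1) \<rho>_pos s by (intro mult_left_mono powr_mono2) (auto simp: N_def less_imp_le)
      finally show ?thesis using B by (simp add: field_simps)
    qed
    \<comment> \<open>This term uses the mass bound of the parent level k; s \<le> 1 and d < \<rho>
      k give d * \<rho> k powr (s - 1) \<le> d powr s.\<close>
    moreover have "4 * d / G \<le> 4 / (b * B) * (d powr s * N)"
    proof -
      have \<rho>k: "\<rho> k > 0" by (rule \<rho>_pos)
      have "\<rho> k powr (s - 1) \<le> d powr (s - 1)"
        using k d s by (intro powr_mono2') auto
      hence pw: "d * \<rho> k powr (s - 1) \<le> d powr s"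
        using d by (simp add: powr_diff field_simps)
      have "B * (b * \<rho> k) \<le> (real (card (C k)) * \<rho> k powr s) * (real (M k) * G)"
        using mass[of k] many[of k] B b \<rho>k by (intro mult_mono[of B]) (auto simp: cardC G_def)
      hence "B * b \<le> N * G * \<rho> k powr (s - 1)"
        using \<rho>k by (simp add: Nk powr_diff field_simps)
      hence "B * b * d \<le> N * G * (d * \<rho> k powr (s - 1))"
        using d mult_right_mono[of "B * b" "N * G * \<rho> k powr (s - 1)" d] by (simp add: mult_ac)
      also have "\<dots> \<le> N * G * d powr s"
        using pw G by (intro mult_left_mono) (auto simp: N_def)
      finally show ?thesis using B b G by (simp add: field_simps)
    qed
    ultimately have "real (card (T (Suc k))) \<le> B' * d powr s * N"
      using cardT by (simp add: B'_def algebra_simps)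
    thus ?thesis using prop_le[of "Suc k" "B' * d powr s"] unfolding T_def N_def by blast
  qed
  have "B' > 0" using B b by (simp add: B'_def add_pos_pos)
  hence "hausdorff_measure s E \<noteq> 0"
    using hausdorff_measure_nonzero_if_counting[OF Ecompact s(1) Cfin Cne meet _ \<rho>_pos count] by blast
  moreover have "\<bar>y - c0\<bar> \<le> \<rho> 0 \<and> (\<forall>k. \<exists>c\<in>P k. \<bar>y - c\<bar> \<le> \<rho> k)" if "y \<in> E" for y
  proof -
    have "y \<in> X k" for k using that by (simp add: E_def)
    hence ex: "\<exists>c\<in>C k. \<bar>y - c\<bar> \<le> \<rho> k" for k by (auto simp: X_def dist_real_def abs_minus_commute)
    have "\<bar>y - c0\<bar> \<le> \<rho> 0" using ex[of 0] C0 by simp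
    moreover have "\<exists>c\<in>P k. \<bar>y - c\<bar> \<le> \<rho> k" for k using ex[of k] CP[of k] by blast
    ultimately show ?thesis by blast
  qed
  ultimately show ?thesis by blast
qed

section \<open>Geometric factors against powers of the radii\<close>

lemma eventually_le_geometric:
  fixes f :: "nat \<Rightarrow> real"
  assumes f: "\<And>k. f k > 0" and h: "h > 0" and ev: "eventually (\<lambda>k. f (Suc k) \<le> h * f k) sequentially"
  obtains B where "B > 0" "eventually (\<lambda>k. f k \<le> B * h ^ k) sequentially"
proof -
  obtain K where K: "\<And>k. k \<ge> K \<Longrightarrow> f (Suc k) \<le> h * f k"
    using ev by (auto simp: eventually_sequentially)
  have "f k \<le> f K / h ^ K * h ^ k" if "k \<ge> K" for k
    using that
  proof (induction rule: dec_induct)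
    case (step k)
    have "f (Suc k) \<le> h * f k" using K step by simp
    also have "\<dots> \<le> h * (f K / h ^ K * h ^ k)" using step h by (intro mult_left_mono) auto
    finally show ?case by (simp add: mult_ac)
  qed (use h in simp)
  thus ?thesis using that[of "f K / h ^ K"] f[of K] h by (auto simp: eventually_sequentially)
qed

lemma eventually_bounded_below_pos:
  fixes f :: "nat \<Rightarrow> real"
  assumes f: "\<And>k. f k > 0" and c: "c > 0" and ev: "eventually (\<lambda>k. c \<le> f k) sequentially"
  obtains B where "B > 0" "\<And>k. B \<le> f k"
proof -
  obtain K where K: "\<And>k. k \<ge> K \<Longrightarrow> c \<le> f k"
    using ev by (auto simp: eventually_sequentially)
  define B where "B = Min (insert c (f ` {..<K}))"
  have "B > 0" unfolding B_def using f c by (subst Min_gr_iff) auto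
  moreover have "B \<le> f k" for k
  proof (cases "k < K")
    case True
    then show ?thesis unfolding B_def by (intro Min_le) auto
  next
    case False
    have "B \<le> c" unfolding B_def by (intro Min_le) auto
    then show ?thesis using K[of k] False by simp
  qed
  ultimately show ?thesis using that by blast
qed

lemma ln_tendsto_at_top:
  fixes \<rho> :: "nat \<Rightarrow> real"
  assumes \<rho>_pos: "\<And>k. \<rho> k > 0" and \<rho>_lim: "\<rho> \<longlonglongrightarrow> 0"
  shows "filterlim (\<lambda>k. ln (1 / \<rho> k)) at_top sequentially"
proof -
  have "\<rho> k \<noteq> 0" for k using \<rho>_pos[of k] by simp
  hence "filterlim \<rho> (at_right 0) sequentially"
    using \<rho>_lim \<rho>_pos by (simp add: filterlim_at)
  hence "filterlim (\<lambda>k. inverse (\<rho> k)) at_top sequentially"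
    by (rule filterlim_compose[OF filterlim_inverse_at_top_right])
  hence "filterlim (\<lambda>k. ln (inverse (\<rho> k))) at_top sequentially"
    by (rule filterlim_compose[OF ln_at_top])
  thus ?thesis by (simp add: inverse_eq_divide)
qed

text \<open>In logarithms the claim is ln B + k * ln h \<le> \<eta> * ln (1 / \<rho> k), and
  \<open>slow\<close> makes the left side negligible against ln (1 / \<rho> k).\<close>

lemma geometric_subdominant:
  fixes \<rho> :: "nat \<Rightarrow> real"
  assumes \<rho>_pos: "\<And>k. \<rho> k > 0" and \<rho>_lim: "\<rho> \<longlonglongrightarrow> 0"
    and slow: "(\<lambda>k. real k / ln (1 / \<rho> k)) \<longlonglongrightarrow> 0"
    and B: "B > 0" and h: "h > 0" and \<eta>: "\<eta> > 0"
  shows "eventually (\<lambda>k. B * h ^ k * \<rho> k powr \<eta> \<le> 1) sequentially"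
proof -
  note top = ln_tendsto_at_top[where \<rho> = \<rho>, OF \<rho>_pos \<rho>_lim]
  have "(\<lambda>k. ln B / ln (1 / \<rho> k) + ln h * (real k / ln (1 / \<rho> k))) \<longlonglongrightarrow> 0 + ln h * 0"
    by (intro tendsto_add tendsto_mult tendsto_const slow real_tendsto_divide_at_top[OF tendsto_const top])
  hence "eventually (\<lambda>k. ln B / ln (1 / \<rho> k) + ln h * (real k / ln (1 / \<rho> k)) < \<eta>) sequentially"
    by (intro order_tendstoD(2)[of _ 0]) (use \<eta> in auto)
  moreover have "eventually (\<lambda>k. ln (1 / \<rho> k) > 0) sequentially"
    using top unfolding filterlim_at_top_dense by (rule spec)
  ultimately show ?thesis
  proof eventually_elim
    case (elim k)
    hence "(ln B + real k * ln h) / ln (1 / \<rho> k) < \<eta>" by (simp add: add_divide_distrib mult_ac)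
    hence "ln B + real k * ln h < \<eta> * ln (1 / \<rho> k)"
      unfolding pos_divide_less_eq[OF elim(2)] .
    hence "ln B + real k * ln h + \<eta> * ln (\<rho> k) < 0"
      using \<rho>_pos[of k] by (simp add: ln_div)
    hence "ln (B * h ^ k * \<rho> k powr \<eta>) < 0"
      using B h \<rho>_pos[of k] by (simp add: ln_mult ln_realpow ln_powr)
    thus ?case using B h \<rho>_pos[of k] by (subst (asm) ln_less_zero_iff) auto
  qed
qed

text \<open>The point sets \<open>P\<close> give covers, the sets \<open>P'\<close> the construction of a Cantor subset. Since
  geometric factors are negligible against powers of \<open>\<rho>\<close>, the constants in the hypotheses do
  not influence the dimension.\<close>
theorem hausdorff_dim_cantor:
  fixes \<rho> g :: "nat \<Rightarrow> real" and E :: "real set" and P P' :: "nat \<Rightarrow> real set"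
  assumes \<rho>_pos: "\<And>k. \<rho> k > 0" and g_pos: "\<And>k. g k > 0" and \<rho>_lim: "\<rho> \<longlonglongrightarrow> 0"
    and slow: "(\<lambda>k. real k / ln (1 / \<rho> k)) \<longlonglongrightarrow> 0"
    and halve: "eventually (\<lambda>k. 2 * \<rho> (Suc k) \<le> \<rho> k) sequentially"
    and const_pos: "c0 > 0" "c1 > 0" "C > 0" "\<kappa> > 0" "b > 0" "A > 0"
    and ratio: "eventually (\<lambda>k. c1 * g (Suc k) \<le> \<rho> k) sequentially"
    and gap: "eventually (\<lambda>k. 2 * \<kappa> * \<rho> k < c0 * g k) sequentially"
    and E: "E \<subseteq> {0..<1}"
    and sep: "eventually (\<lambda>k. \<forall>x\<in>P k. \<forall>y\<in>P k. x \<noteq> y \<longrightarrow> c0 * g k \<le> \<bar>x - y\<bar>) sequentially"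
    and near: "\<And>y. y \<in> E \<Longrightarrow> eventually (\<lambda>k. \<exists>x\<in>P k. \<bar>y - x\<bar> \<le> C * \<rho> k) sequentially"
    and sep': "eventually (\<lambda>k. \<forall>x\<in>P' k. \<forall>y\<in>P' k. x \<noteq> y \<longrightarrow> c0 * g k \<le> \<bar>x - y\<bar>) sequentially"
    and child: "eventually (\<lambda>k. \<forall>c\<in>P' k. \<exists>F\<subseteq>P' (Suc k). finite F \<and> b * \<rho> k / g (Suc k) \<le> real (card F) \<and>
      (\<forall>c'\<in>F. \<bar>c' - c\<bar> \<le> \<kappa> * (\<rho> k - \<rho> (Suc k)))) sequentially"
    and mem: "eventually (\<lambda>K. \<forall>y\<in>{0..<1}. (\<forall>k\<ge>K. \<exists>c\<in>P' k. \<bar>y - c\<bar> \<le> \<kappa> * \<rho> k) \<longrightarrow> y \<in> E) sequentially"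
    and start: "eventually (\<lambda>K. \<exists>c\<in>P' K. {c - \<kappa> * \<rho> K..c + \<kappa> * \<rho> K} \<subseteq> {0..<1}) sequentially"
  shows "hausdorff_dim E =
    Liminf sequentially (\<lambda>k. ereal (ln (A * (\<Prod>i<k. \<rho> i / g (Suc i))) / ln (1 / \<rho> k)))"
proof -
  define R where "R k = (\<Prod>i<k. \<rho> i / g (Suc i))" for k
  define a where "a k = ln (A * R k) / ln (1 / \<rho> k)" for k
  define L where "L = Liminf sequentially (\<lambda>k. ereal (a k))"
  have R_pos: "R k > 0" for k unfolding R_def using \<rho>_pos g_pos by (intro prod_pos) auto
  have R_Suc: "R (Suc k) = R k * (\<rho> k / g (Suc k))" for k by (simp add: R_def)
  have R_add: "(\<Prod>i<j. c * (\<rho> (K + i) / g (Suc (K + i)))) = c ^ j * R (K + j) / R K" for c K j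
  proof (induction j)
    case (Suc j)
    then show ?case by (simp add: R_Suc mult_ac)
  qed (use R_pos[of K] in simp)
  have lnpos: "eventually (\<lambda>k. ln (1 / \<rho> k) > 0) sequentially"
    using ln_tendsto_at_top[where \<rho> = \<rho>, OF \<rho>_pos \<rho>_lim] unfolding filterlim_at_top_dense by (rule spec)
  note subdom = geometric_subdominant[where \<rho> = \<rho>, OF \<rho>_pos \<rho>_lim slow]
  \<comment> \<open>\<open>a k\<close> is the exponent s with A * R k = \<rho> k powr (- s); up to
    geometric factors \<open>R k\<close> is the number of balls at level k.\<close>
  have a_iff: "a k > s \<longleftrightarrow> A * R k > \<rho> k powr (- s)" "a k < s \<longleftrightarrow> A * R k < \<rho> k powr (- s)"
    if "ln (1 / \<rho> k) > 0" for k s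
  proof -
    have "A * R k > 0" using R_pos const_pos by simp
    hence "ln (A * R k) > s * ln (1 / \<rho> k) \<longleftrightarrow> A * R k > \<rho> k powr (- s)"
      "ln (A * R k) < s * ln (1 / \<rho> k) \<longleftrightarrow> A * R k < \<rho> k powr (- s)"
      using \<rho>_pos[of k] ln_less_cancel_iff[of "\<rho> k powr (- s)" "A * R k"]
        ln_less_cancel_iff[of "A * R k" "\<rho> k powr (- s)"]
      by (simp_all add: ln_powr ln_div)
    thus "a k > s \<longleftrightarrow> A * R k > \<rho> k powr (- s)" "a k < s \<longleftrightarrow> A * R k < \<rho> k powr (- s)"
      using that by (simp_all add: a_def less_divide_eq divide_less_eq)
  qed
  \<comment> \<open>\<open>hausdorff_dim\<close> ranges over positive exponents only, so L must not
    be negative. By \<open>ratio\<close>, R decays at most geometrically.\<close>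
  have L_nonneg: "L \<ge> 0"
  proof (rule ccontr)
    assume "\<not> L \<ge> 0"
    then obtain x where x: "L < ereal x" "ereal x < 0" unfolding not_le using ereal_dense2 by blast
    have "eventually (\<lambda>k. 1 / R (Suc k) \<le> (1 / c1) * (1 / R k)) sequentially"
      using ratio
    proof eventually_elim
      case (elim k)
      have "c1 * R k * g (Suc k) \<le> R k * \<rho> k"
        using elim R_pos[of k] mult_left_mono[of "c1 * g (Suc k)" "\<rho> k" "R k"] by (simp add: mult_ac)
      thus ?case using R_pos[of k] g_pos[of "Suc k"] \<rho>_pos[of k] const_pos
        by (simp add: R_Suc field_simps)
    qed
    then obtain B where B: "B > 0" "eventually (\<lambda>k. 1 / R k \<le> B * (1 / c1) ^ k) sequentially"
      using eventually_le_geometric[of "\<lambda>k. 1 / R k" "1 / c1"] R_pos const_pos by auto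
    have "eventually (\<lambda>k. 2 * B / A * (1 / c1) ^ k * \<rho> k powr (- x) \<le> 1) sequentially"
      by (rule subdom) (use B const_pos x in auto)
    hence "eventually (\<lambda>k. ereal x \<le> ereal (a k)) sequentially"
      using B(2) lnpos
    proof eventually_elim
      case (elim k)
      have "2 / (A * R k) * \<rho> k powr (- x) \<le> 2 * B / A * (1 / c1) ^ k * \<rho> k powr (- x)"
        using elim(2) const_pos mult_left_mono[of "1 / R k" "B * (1 / c1) ^ k" "2 / A"]
        by (intro mult_right_mono) auto
      also have "\<dots> \<le> 1" by (rule elim)
      finally have "2 * \<rho> k powr (- x) \<le> A * R k" using R_pos[of k] const_pos by (simp add: field_simps)
      hence "\<rho> k powr (- x) < A * R k" using \<rho>_pos[of k] powr_gt_zero[of "\<rho> k" "- x"] by linarith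
      thus ?case using a_iff(1)[OF elim(3)] by (simp add: less_imp_le)
    qed
    hence "ereal x \<le> L" unfolding L_def by (rule Liminf_bounded)
    thus False using x by simp
  qed
  \<comment> \<open>The mass distribution argument assumes s \<le> 1. By \<open>gap\<close>, R k *
    \<rho> k grows at most geometrically.\<close>
  have L_le: "L \<le> 1"
  proof (rule ccontr)
    assume "\<not> L \<le> 1"
    then obtain x where x: "1 < ereal x" "ereal x < L" unfolding not_le using ereal_dense2 by blast
    define h where "h = c0 / (2 * \<kappa>)"
    have h: "h > 0" using const_pos by (simp add: h_def)
    have "eventually (\<lambda>k. 2 * \<kappa> * \<rho> (Suc k) < c0 * g (Suc k)) sequentially"
      using gap by (rule eventually_sequentially_Suc[THEN iffD2])
    hence "eventually (\<lambda>k. R (Suc k) * \<rho> (Suc k) \<le> h * (R k * \<rho> k)) sequentially"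
    proof eventually_elim
      case (elim k)
      have "\<rho> (Suc k) / g (Suc k) \<le> h"
        using elim const_pos g_pos[of "Suc k"] by (simp add: h_def field_simps)
      hence "R k * \<rho> k * (\<rho> (Suc k) / g (Suc k)) \<le> R k * \<rho> k * h"
        using R_pos[of k] \<rho>_pos[of k] by (intro mult_left_mono) auto
      thus ?case by (simp add: R_Suc mult_ac)
    qed
    then obtain B where B: "B > 0" "eventually (\<lambda>k. R k * \<rho> k \<le> B * h ^ k) sequentially"
      using eventually_le_geometric[of "\<lambda>k. R k * \<rho> k" h] R_pos \<rho>_pos h by auto
    have "eventually (\<lambda>k. A * B * h ^ k * \<rho> k powr (x - 1) \<le> 1) sequentially"
      by (rule subdom) (use B h const_pos x in auto)
    moreover have "eventually (\<lambda>k. ereal x < ereal (a k)) sequentially"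
      using x(2) unfolding L_def by (rule less_LiminfD)
    ultimately have "eventually (\<lambda>k. False) sequentially"
      using B(2) lnpos
    proof eventually_elim
      case (elim k)
      have "\<rho> k powr (- x) < A * R k" using elim(2) a_iff(1)[OF elim(4)] by simp
      hence "\<rho> k powr (- x) * \<rho> k powr x < A * R k * \<rho> k powr x"
        using \<rho>_pos[of k] by (intro mult_strict_right_mono) auto
      hence "1 < A * R k * \<rho> k powr x" using \<rho>_pos[of k] by (simp flip: powr_add)
      also have "\<dots> = A * (R k * \<rho> k) * \<rho> k powr (x - 1)"
        using \<rho>_pos[of k] by (simp add: powr_diff)
      also have "\<dots> \<le> A * (B * h ^ k) * \<rho> k powr (x - 1)"
        using elim(3) const_pos by (intro mult_right_mono mult_left_mono) auto
      also have "\<dots> \<le> 1" using elim(1) by (simp add: mult_ac)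
      finally show False by simp
    qed
    thus False by simp
  qed
  \<comment> \<open>For s < t < L the surplus t - s in the exponent absorbs the factor
    \<open>b ^ k\<close> lost in counting children up to the constant b.\<close>
  have lower: "L \<le> ereal s" if s: "s > 0" "hausdorff_measure s E = 0" for s
  proof (rule ccontr)
    assume "\<not> L \<le> ereal s"
    then obtain t where t: "ereal s < ereal t" "ereal t < L" unfolding not_le using ereal_dense2 by blast
    have s1: "s \<le> 1" using \<open>\<not> L \<le> ereal s\<close> L_le by (cases L) auto
    obtain K where K: "\<And>k. k \<ge> K \<Longrightarrow> 2 * \<rho> (Suc k) \<le> \<rho> k" "\<And>k. k \<ge> K \<Longrightarrow> 2 * \<kappa> * \<rho> k < c0 * g k"
      "\<And>k x y. k \<ge> K \<Longrightarrow> x \<in> P' k \<Longrightarrow> y \<in> P' k \<Longrightarrow> x \<noteq> y \<Longrightarrow> c0 * g k \<le> \<bar>x - y\<bar>"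
      "\<And>k c. k \<ge> K \<Longrightarrow> c \<in> P' k \<Longrightarrow> \<exists>F\<subseteq>P' (Suc k). finite F \<and> b * \<rho> k / g (Suc k) \<le> real (card F) \<and>
        (\<forall>c'\<in>F. \<bar>c' - c\<bar> \<le> \<kappa> * (\<rho> k - \<rho> (Suc k)))"
      "\<And>y. y \<in> {0..<1} \<Longrightarrow> \<forall>k\<ge>K. \<exists>c\<in>P' k. \<bar>y - c\<bar> \<le> \<kappa> * \<rho> k \<Longrightarrow> y \<in> E"
      "\<exists>c\<in>P' K. {c - \<kappa> * \<rho> K..c + \<kappa> * \<rho> K} \<subseteq> {0..<1}"
    proof -
      have "eventually (\<lambda>k. 2 * \<rho> (Suc k) \<le> \<rho> k \<and> 2 * \<kappa> * \<rho> k < c0 * g k \<and>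
        (\<forall>x\<in>P' k. \<forall>y\<in>P' k. x \<noteq> y \<longrightarrow> c0 * g k \<le> \<bar>x - y\<bar>) \<and>
        (\<forall>c\<in>P' k. \<exists>F\<subseteq>P' (Suc k). finite F \<and> b * \<rho> k / g (Suc k) \<le> real (card F) \<and>
          (\<forall>c'\<in>F. \<bar>c' - c\<bar> \<le> \<kappa> * (\<rho> k - \<rho> (Suc k)))) \<and>
        (\<forall>y\<in>{0..<1}. (\<forall>j\<ge>k. \<exists>c\<in>P' j. \<bar>y - c\<bar> \<le> \<kappa> * \<rho> j) \<longrightarrow> y \<in> E) \<and>
        (\<exists>c\<in>P' k. {c - \<kappa> * \<rho> k..c + \<kappa> * \<rho> k} \<subseteq> {0..<1})) sequentially"
        using halve gap sep' child mem start by eventually_elim simp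
      then obtain K where K: "\<And>k. k \<ge> K \<Longrightarrow> 2 * \<rho> (Suc k) \<le> \<rho> k \<and> 2 * \<kappa> * \<rho> k < c0 * g k \<and>
        (\<forall>x\<in>P' k. \<forall>y\<in>P' k. x \<noteq> y \<longrightarrow> c0 * g k \<le> \<bar>x - y\<bar>) \<and>
        (\<forall>c\<in>P' k. \<exists>F\<subseteq>P' (Suc k). finite F \<and> b * \<rho> k / g (Suc k) \<le> real (card F) \<and>
          (\<forall>c'\<in>F. \<bar>c' - c\<bar> \<le> \<kappa> * (\<rho> k - \<rho> (Suc k)))) \<and>
        (\<forall>y\<in>{0..<1}. (\<forall>j\<ge>k. \<exists>c\<in>P' j. \<bar>y - c\<bar> \<le> \<kappa> * \<rho> j) \<longrightarrow> y \<in> E) \<and>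
        (\<exists>c\<in>P' k. {c - \<kappa> * \<rho> k..c + \<kappa> * \<rho> k} \<subseteq> {0..<1})"
        unfolding eventually_sequentially by auto
      show ?thesis
      proof (rule that)
        show "2 * \<rho> (Suc k) \<le> \<rho> k" if "k \<ge> K" for k using K[OF that] by simp
        show "2 * \<kappa> * \<rho> k < c0 * g k" if "k \<ge> K" for k using K[OF that] by simp
        show "c0 * g k \<le> \<bar>x - y\<bar>" if "k \<ge> K" "x \<in> P' k" "y \<in> P' k" "x \<noteq> y" for k x y
          using K[OF that(1)] that(2-) by simp
        show "\<exists>F\<subseteq>P' (Suc k). finite F \<and> b * \<rho> k / g (Suc k) \<le> real (card F) \<and>
          (\<forall>c'\<in>F. \<bar>c' - c\<bar> \<le> \<kappa> * (\<rho> k - \<rho> (Suc k)))" if "k \<ge> K" "c \<in> P' k" for k c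
          using K[OF that(1)] that(2) by simp
        show "y \<in> E" if "y \<in> {0..<1}" "\<forall>k\<ge>K. \<exists>c\<in>P' k. \<bar>y - c\<bar> \<le> \<kappa> * \<rho> k" for y
          using K[OF order_refl] that by simp
        show "\<exists>c\<in>P' K. {c - \<kappa> * \<rho> K..c + \<kappa> * \<rho> K} \<subseteq> {0..<1}" using K[OF order_refl] by simp
      qed
    qed
    obtain z where z: "z \<in> P' K" "{z - \<kappa> * \<rho> K..z + \<kappa> * \<rho> K} \<subseteq> {0..<1}" using K(6) by blast
    \<comment> \<open>Rounding up guarantees one child at least, and enough children exist because
      \<open>card F\<close> is an integer above the same bound.\<close>
    define M where "M j = nat \<lceil>b * \<rho> (K + j) / g (Suc (K + j))\<rceil>" for j
    have Mpos: "b * \<rho> (K + j) / g (Suc (K + j)) > 0" for j using const_pos \<rho>_pos g_pos by simp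
    have M_ge: "real (M j) \<ge> b * \<rho> (K + j) / g (Suc (K + j))" for j unfolding M_def by linarith
    have M_1: "M j \<ge> 1" for j using M_ge[of j] Mpos[of j] by (cases "M j") auto
    define f where "f j = (\<Prod>i<j. real (M i)) * (\<kappa> * \<rho> (K + j)) powr s" for j
    have f_pos: "f j > 0" for j
    proof -
      have "(\<Prod>i<j. real (M i)) > 0" using M_1 by (intro prod_pos) (auto simp: Suc_le_eq)
      thus ?thesis using const_pos \<rho>_pos[of "K + j"] by (simp add: f_def)
    qed
    define c where "c = \<kappa> powr s / (A * b ^ K * R K)"
    have c_pos: "c > 0" using const_pos R_pos by (simp add: c_def)
    have "eventually (\<lambda>k. 1 * (1 / b) ^ k * \<rho> k powr (t - s) \<le> 1) sequentially"
      by (rule subdom) (use const_pos t in auto)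
    moreover have "eventually (\<lambda>k. ereal t < ereal (a k)) sequentially"
      using t(2) unfolding L_def by (rule less_LiminfD)
    ultimately have "eventually (\<lambda>k. \<rho> k powr (- s) \<le> A * b ^ k * R k) sequentially"
      using lnpos
    proof eventually_elim
      case (elim k)
      have "\<rho> k powr (- s) = \<rho> k powr (t - s) * \<rho> k powr (- t)" by (simp flip: powr_add)
      also have "\<dots> \<le> b ^ k * (A * R k)"
        using elim(1,2) a_iff(1)[OF elim(3), of t] const_pos
        by (intro mult_mono) (auto simp: field_simps power_divide)
      finally show ?case by (simp add: mult_ac)
    qed
    hence "eventually (\<lambda>j. \<rho> (K + j) powr (- s) \<le> A * b ^ (K + j) * R (K + j)) sequentially"
      by (subst (asm) eventually_sequentially_seg[of _ K, symmetric]) (simp add: add.commute)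
    hence "eventually (\<lambda>j. c \<le> f j) sequentially"
    proof eventually_elim
      case (elim j)
      have "b ^ j * R (K + j) / R K \<le> (\<Prod>i<j. real (M i))"
        unfolding R_add[symmetric] using M_ge Mpos by (intro prod_mono) (auto intro: less_imp_le)
      hence "b ^ j * R (K + j) / R K * (\<kappa> * \<rho> (K + j)) powr s \<le> f j"
        unfolding f_def by (rule mult_right_mono) simp
      moreover have "1 \<le> A * b ^ (K + j) * R (K + j) * \<rho> (K + j) powr s"
        using elim \<rho>_pos[of "K + j"] by (simp add: powr_minus field_simps)
      hence "c * 1 \<le> c * (A * b ^ (K + j) * R (K + j) * \<rho> (K + j) powr s)"
        using c_pos by (intro mult_left_mono) auto
      hence "c \<le> b ^ j * R (K + j) / R K * (\<kappa> * \<rho> (K + j)) powr s"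
        using const_pos R_pos[of K] \<rho>_pos[of "K + j"]
        by (simp add: c_def powr_mult power_add field_simps)
      ultimately show ?case by linarith
    qed
    then obtain B where B: "B > 0" "\<And>j. B \<le> f j"
      using eventually_bounded_below_pos[of f c] f_pos c_pos by blast
    \<comment> \<open>The constant b * c0 / \<kappa> compensates for replacing \<rho> by \<kappa> *
      \<rho> and g by c0 * g.\<close>
    have "\<exists>E'. (\<forall>y\<in>E'. \<bar>y - z\<bar> \<le> \<kappa> * \<rho> (K + 0) \<and> (\<forall>k. \<exists>c\<in>P' (K + k). \<bar>y - c\<bar> \<le> \<kappa> * \<rho> (K + k))) \<and>
      hausdorff_measure s E' \<noteq> 0"
    proof (rule cantor_measure_nonzero[where \<rho> = "\<lambda>k. \<kappa> * \<rho> (K + k)" and g = "\<lambda>k. c0 * g (K + k)"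
          and P = "\<lambda>k. P' (K + k)" and M = M and b = "b * c0 / \<kappa>"])
      show "(\<lambda>k. \<kappa> * \<rho> (K + k)) \<longlonglongrightarrow> 0"
        using tendsto_mult[OF tendsto_const LIMSEQ_ignore_initial_segment[OF \<rho>_lim, of K], of \<kappa>]
        by (simp add: add.commute)
      show "\<exists>F. F \<subseteq> P' (K + Suc k) \<and> finite F \<and> card F = M k \<and>
        (\<forall>c'\<in>F. \<bar>c' - c\<bar> \<le> \<kappa> * \<rho> (K + k) - \<kappa> * \<rho> (K + Suc k))" if c: "c \<in> P' (K + k)" for k c
      proof -
        obtain F where F: "F \<subseteq> P' (Suc (K + k))" "finite F"
          "b * \<rho> (K + k) / g (Suc (K + k)) \<le> real (card F)"
          "\<forall>c'\<in>F. \<bar>c' - c\<bar> \<le> \<kappa> * (\<rho> (K + k) - \<rho> (Suc (K + k)))"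
          using K(4)[OF _ c] by auto
        have "M k \<le> card F" unfolding M_def using F(3) by linarith
        then obtain F' where "F' \<subseteq> F" "card F' = M k" "finite F'"
          using obtain_subset_with_card_n by metis
        thus ?thesis using F by (intro exI[of _ F']) (auto simp: right_diff_distrib)
      qed
      show "\<kappa> * \<rho> (K + Suc k) \<le> \<kappa> * \<rho> (K + k)" for k
        using K(1)[of "K + k"] \<rho>_pos[of "Suc (K + k)"] const_pos by (intro mult_left_mono) auto
      show "2 * (\<kappa> * \<rho> (K + k)) < c0 * g (K + k)" for k using K(2)[of "K + k"] by simp
      show "c0 * g (K + k) \<le> \<bar>x - y\<bar>" if "x \<in> P' (K + k)" "y \<in> P' (K + k)" "x \<noteq> y" for k x y
        using K(3)[of "K + k"] that by simp
      show "b * c0 / \<kappa> * (\<kappa> * \<rho> (K + k)) \<le> real (M k) * (c0 * g (K + Suc k))" for k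
        using M_ge[of k] const_pos g_pos[of "Suc (K + k)"] by (simp add: field_simps)
      show "B \<le> (\<Prod>i<k. real (M i)) * (\<kappa> * \<rho> (K + k)) powr s" for k using B(2) by (simp add: f_def)
    qed (use const_pos \<rho>_pos M_1 s s1 B z in auto)
    then obtain E' where E': "\<And>y. y \<in> E' \<Longrightarrow> \<bar>y - z\<bar> \<le> \<kappa> * \<rho> K"
      "\<And>y k. y \<in> E' \<Longrightarrow> \<exists>c\<in>P' (K + k). \<bar>y - c\<bar> \<le> \<kappa> * \<rho> (K + k)" "hausdorff_measure s E' \<noteq> 0"
      by auto
    have "E' \<subseteq> E"
    proof
      fix y assume y: "y \<in> E'"
      have "y \<in> {z - \<kappa> * \<rho> K..z + \<kappa> * \<rho> K}" using E'(1)[OF y] by (auto simp: abs_le_iff)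
      hence "y \<in> {0..<1}" using z by blast
      moreover have "\<exists>c\<in>P' k. \<bar>y - c\<bar> \<le> \<kappa> * \<rho> k" if "k \<ge> K" for k
        using E'(2)[OF y, of "k - K"] that by simp
      ultimately show "y \<in> E" using K(5) by blast
    qed
    thus False using hausdorff_measure_mono[of E' E s] E'(3) s(2) by simp
  qed
  have upper: "hausdorff_measure s E = 0" if s: "L < ereal s" for s
  proof -
    obtain t where t: "L < ereal t" "t < s" using ereal_dense2[OF s] by auto
    obtain K0 where K0: "\<And>k. k \<ge> K0 \<Longrightarrow> 2 * \<rho> (Suc k) \<le> \<rho> k" "\<And>k. k \<ge> K0 \<Longrightarrow> c1 * g (Suc k) \<le> \<rho> k"
      "\<And>k x y. k \<ge> K0 \<Longrightarrow> x \<in> P k \<Longrightarrow> y \<in> P k \<Longrightarrow> x \<noteq> y \<Longrightarrow> c0 * g k \<le> \<bar>x - y\<bar>"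
    proof -
      have "eventually (\<lambda>k. 2 * \<rho> (Suc k) \<le> \<rho> k \<and> c1 * g (Suc k) \<le> \<rho> k \<and>
        (\<forall>x\<in>P k. \<forall>y\<in>P k. x \<noteq> y \<longrightarrow> c0 * g k \<le> \<bar>x - y\<bar>)) sequentially"
        using halve ratio sep by eventually_elim simp
      thus ?thesis using that unfolding eventually_sequentially by metis
    qed
    \<comment> \<open>The level from which \<open>near\<close> holds depends on y; on each of these
      countably many parts it is uniform.\<close>
    define EK where "EK K = {y \<in> E. \<forall>k\<ge>K0 + K. \<exists>x\<in>P k. \<bar>y - x\<bar> \<le> C * \<rho> k}" for K
    have "hausdorff_measure s (EK K) = 0" for K
    proof -
      define K1 where "K1 = K0 + K"
      have packing: "finite {x \<in> P k. \<bar>x - c\<bar> \<le> r} \<and>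
        real (card {x \<in> P k. \<bar>x - c\<bar> \<le> r}) \<le> 2 * r / (c0 * g k) + 1" if "k \<ge> K0" "r \<ge> 0" for k c r
      proof -
        have "finite {x \<in> P k. \<bar>x - c\<bar> \<le> r} \<and>
          real (card {x \<in> P k. \<bar>x - c\<bar> \<le> r}) \<le> ((c + r) - (c - r)) / (c0 * g k) + 1"
          by (rule separated_card_le) (use that K0(3) g_pos[of k] const_pos in \<open>auto simp: abs_le_iff\<close>)
        thus ?thesis by simp
      qed
      \<comment> \<open>4 * C / c0 counts centres by separation; 1 / c1 converts the additional 1 of
        the packing bound into a multiple of \<rho> / g.\<close>
      define h where "h = 4 * C / c0 + 1 / c1"
      have h: "h > 0" using const_pos by (simp add: h_def add_pos_pos)
      \<comment> \<open>Since E lies between 0 and 1, the initial cover needs only centres within 1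
        + C * \<rho> K1 of 0.\<close>
      define B where "B = 2 * (1 + C * \<rho> K1) / (c0 * g K1) + 1"
      have B: "B > 0" using const_pos \<rho>_pos[of K1] g_pos[of K1] by (simp add: B_def add_nonneg_pos)
      have cover: "\<exists>F. finite F \<and> EK K \<subseteq> (\<Union>c\<in>F. cball c (C * \<rho> (K1 + j))) \<and>
        real (card F) \<le> B * (\<Prod>i<j. h * (\<rho> (K1 + i) / g (Suc (K1 + i))))" for j
      proof (induction j)
        case 0
        define F where "F = {x \<in> P K1. \<bar>x - 0\<bar> \<le> 1 + C * \<rho> K1}"
        have "EK K \<subseteq> (\<Union>c\<in>F. cball c (C * \<rho> K1))"
        proof
          fix y assume y: "y \<in> EK K"
          then obtain x where "x \<in> P K1" "\<bar>y - x\<bar> \<le> C * \<rho> K1" by (auto simp: EK_def K1_def)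
          moreover have "0 \<le> y" "y < 1" using y E by (auto simp: EK_def)
          ultimately show "y \<in> (\<Union>c\<in>F. cball c (C * \<rho> K1))"
            by (auto simp: F_def dist_real_def abs_minus_commute intro!: bexI[of _ x])
        qed
        moreover have "finite F \<and> real (card F) \<le> B"
          unfolding F_def B_def by (rule packing) (use const_pos \<rho>_pos[of K1] in \<open>auto simp: K1_def less_imp_le\<close>)
        ultimately show ?case by (intro exI[of _ F]) auto
      next
        case (Suc j)
        then obtain F where F: "finite F" "EK K \<subseteq> (\<Union>c\<in>F. cball c (C * \<rho> (K1 + j)))"
          "real (card F) \<le> B * (\<Prod>i<j. h * (\<rho> (K1 + i) / g (Suc (K1 + i))))" by blast
        define k where "k = K1 + j"
        have k: "k \<ge> K0" by (simp add: k_def K1_def)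
        define N where "N c = {x \<in> P (Suc k). \<bar>x - c\<bar> \<le> 2 * C * \<rho> k}" for c
        have N: "finite (N c)" "real (card (N c)) \<le> h * (\<rho> k / g (Suc k))" for c
        proof -
          have *: "finite (N c) \<and> real (card (N c)) \<le> 2 * (2 * C * \<rho> k) / (c0 * g (Suc k)) + 1"
            unfolding N_def by (rule packing) (use k const_pos \<rho>_pos[of k] in auto)
          thus "finite (N c)" by simp
          have "1 \<le> \<rho> k / (c1 * g (Suc k))" using K0(2)[OF k] const_pos g_pos[of "Suc k"] by simp
          moreover have "h * (\<rho> k / g (Suc k)) = 2 * (2 * C * \<rho> k) / (c0 * g (Suc k)) + \<rho> k / (c1 * g (Suc k))"
            using const_pos by (simp add: h_def distrib_right add_divide_distrib)
          ultimately have "2 * (2 * C * \<rho> k) / (c0 * g (Suc k)) + 1 \<le> h * (\<rho> k / g (Suc k))" by linarith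
          thus "real (card (N c)) \<le> h * (\<rho> k / g (Suc k))" using * by linarith
        qed
        define F' where "F' = (\<Union>c\<in>F. N c)"
        have "finite F'" using F(1) N by (simp add: F'_def)
        moreover have "EK K \<subseteq> (\<Union>c\<in>F'. cball c (C * \<rho> (Suc k)))"
        proof
          fix y assume y: "y \<in> EK K"
          then obtain c where c: "c \<in> F" "\<bar>c - y\<bar> \<le> C * \<rho> k"
            using F(2) by (auto simp: dist_real_def k_def)
          have "Suc k \<ge> K0 + K" by (simp add: k_def K1_def)
          then obtain x where x: "x \<in> P (Suc k)" "\<bar>y - x\<bar> \<le> C * \<rho> (Suc k)"
            using y by (auto simp: EK_def)
          have "C * \<rho> (Suc k) \<le> C * \<rho> k"
            using K0(1)[OF k] \<rho>_pos[of "Suc k"] const_pos by (intro mult_left_mono) auto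
          hence "\<bar>x - c\<bar> \<le> 2 * C * \<rho> k" using x c by linarith
          hence "x \<in> F'" using x c by (auto simp: F'_def N_def)
          thus "y \<in> (\<Union>c\<in>F'. cball c (C * \<rho> (Suc k)))" using x
            by (auto simp: dist_real_def abs_minus_commute intro!: bexI[of _ x])
        qed
        moreover have "real (card F') \<le> B * (\<Prod>i<Suc j. h * (\<rho> (K1 + i) / g (Suc (K1 + i))))"
        proof -
          have "card F' \<le> (\<Sum>c\<in>F. card (N c))" unfolding F'_def by (rule card_UN_le[OF F(1)])
          hence "real (card F') \<le> (\<Sum>c\<in>F. real (card (N c)))" by (simp flip: of_nat_sum)
          also have "\<dots> \<le> (\<Sum>c\<in>F. h * (\<rho> k / g (Suc k)))" by (rule sum_mono) (rule N)
          also have "\<dots> = real (card F) * (h * (\<rho> k / g (Suc k)))" by simp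
          also have "\<dots> \<le> B * (\<Prod>i<j. h * (\<rho> (K1 + i) / g (Suc (K1 + i)))) * (h * (\<rho> k / g (Suc k)))"
            using h \<rho>_pos[of k] g_pos[of "Suc k"] by (intro mult_right_mono F(3)) auto
          finally show ?thesis by (simp add: k_def mult_ac)
        qed
        ultimately show ?case by (intro exI[of _ F']) (simp add: k_def)
      qed
      have "hausdorff_pre s \<delta> (EK K) \<le> ennreal \<eta>" if \<delta>: "\<delta> > 0" and \<eta>: "\<eta> > 0" for \<delta> \<eta>
      proof -
        define B' where "B' = B * (2 * C) powr s / (A * h ^ K1 * R K1 * \<eta>)"
        have B': "B' > 0" using B const_pos h R_pos \<eta> by (simp add: B'_def)
        have ev1: "eventually (\<lambda>k. B' * h ^ k * \<rho> k powr (s - t) \<le> 1) sequentially"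
          by (rule subdom) (use B' h t in auto)
        have ev2: "eventually (\<lambda>k. \<rho> k < \<delta> / (2 * C)) sequentially"
          by (rule order_tendstoD(2)[OF \<rho>_lim]) (use \<delta> const_pos in simp)
        \<comment> \<open>A liminf below t yields good levels only infinitely often, but a single
          one beyond K1 suffices for given \<delta> and \<eta>.\<close>
        have "\<not> eventually (\<lambda>k. ereal t \<le> ereal (a k)) sequentially"
          using t(1) Liminf_bounded[of "ereal t" "\<lambda>k. ereal (a k)" sequentially] unfolding L_def by auto
        hence "frequently (\<lambda>k. a k < t) sequentially"
          by (simp add: frequently_def not_less)
        hence "frequently (\<lambda>k. a k < t \<and> B' * h ^ k * \<rho> k powr (s - t) \<le> 1 \<and> \<rho> k < \<delta> / (2 * C) \<and>
            ln (1 / \<rho> k) > 0 \<and> k \<ge> K1) sequentially"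
        proof (rule frequently_rev_mp)
          show "eventually (\<lambda>k. a k < t \<longrightarrow> a k < t \<and> B' * h ^ k * \<rho> k powr (s - t) \<le> 1 \<and>
              \<rho> k < \<delta> / (2 * C) \<and> ln (1 / \<rho> k) > 0 \<and> k \<ge> K1) sequentially"
            using ev1 ev2 lnpos eventually_ge_at_top[of K1] by eventually_elim simp
        qed
        then obtain k where k: "a k < t" "B' * h ^ k * \<rho> k powr (s - t) \<le> 1" "\<rho> k < \<delta> / (2 * C)"
            "ln (1 / \<rho> k) > 0" "k \<ge> K1"
          by (auto dest: frequently_ex)
        have AR: "A * R k \<le> \<rho> k powr (- t)" using a_iff(2)[OF k(4), of t] k(1) by simp
        define j where "j = k - K1"
        have kj: "k = K1 + j" using k(5) by (simp add: j_def)
        obtain F where F: "finite F" "EK K \<subseteq> (\<Union>c\<in>F. cball c (C * \<rho> k))"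
            "real (card F) \<le> B * (h ^ j * R k / R K1)"
          using cover[of j] unfolding R_add by (auto simp: kj)
        have "hausdorff_pre s \<delta> (EK K) \<le> ennreal (real (card F) * (2 * (C * \<rho> k)) powr s)"
          by (rule hausdorff_pre_finite_cover)
            (use F const_pos \<rho>_pos[of k] k(3) in \<open>auto simp: field_simps\<close>)
        also have "\<dots> \<le> ennreal \<eta>"
        proof (rule ennreal_leI)
          have "real (card F) * (2 * (C * \<rho> k)) powr s \<le> B * (h ^ j * R k / R K1) * (2 * (C * \<rho> k)) powr s"
            by (rule mult_right_mono[OF F(3)]) simp
          also have "\<dots> = B' * \<eta> * h ^ k * (A * R k) * \<rho> k powr s"
            using const_pos h R_pos[of K1] \<rho>_pos[of k] \<eta>
            by (simp add: B'_def kj power_add powr_mult field_simps)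
          also have "\<dots> \<le> B' * \<eta> * h ^ k * \<rho> k powr (- t) * \<rho> k powr s"
            using B' \<eta> h AR by (intro mult_right_mono mult_left_mono) auto
          also have "\<dots> = \<eta> * (B' * h ^ k * \<rho> k powr (s - t))"
            by (simp add: powr_diff powr_minus field_simps)
          also have "\<dots> \<le> \<eta> * 1" using k(2) \<eta> by (intro mult_left_mono) auto
          finally show "real (card F) * (2 * (C * \<rho> k)) powr s \<le> \<eta>" by simp
        qed
        finally show ?thesis .
      qed
      thus ?thesis by (auto simp: hausdorff_measure_eq_0_iff intro: hausdorff_pre_eq_0I)
    qed
    hence "hausdorff_measure s (\<Union>K. EK K) = 0" by (rule hausdorff_measure_UN_null)
    moreover have "E \<subseteq> (\<Union>K. EK K)"
    proof
      fix y assume y: "y \<in> E"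
      then obtain K where "\<And>k. k \<ge> K \<Longrightarrow> \<exists>x\<in>P k. \<bar>y - x\<bar> \<le> C * \<rho> k"
        using near[OF y] by (auto simp: eventually_sequentially)
      hence "y \<in> EK K" using y by (simp add: EK_def)
      thus "y \<in> (\<Union>K. EK K)" by blast
    qed
    ultimately show ?thesis using hausdorff_measure_mono[of E "\<Union>K. EK K" s] by simp
  qed
  have "hausdorff_dim E = L"
  proof (rule antisym)
    show "L \<le> hausdorff_dim E"
      unfolding hausdorff_dim_def by (rule Inf_greatest) (use lower in auto)
    show "hausdorff_dim E \<le> L"
    proof (rule ccontr)
      assume "\<not> hausdorff_dim E \<le> L"
      then obtain s where s: "L < ereal s" "ereal s < hausdorff_dim E"
        unfolding not_le using ereal_dense2 by blast
      have "s > 0" using s(1) L_nonneg by (metis ereal_less(2) le_less_trans)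
      hence "hausdorff_dim E \<le> ereal s"
        unfolding hausdorff_dim_def by (intro Inf_lower) (use upper[OF s(1)] in auto)
      thus False using s by simp
    qed
  qed
  thus ?thesis by (simp add: L_def a_def R_def)
qed

section \<open>Continued fractions\<close>

lemma dint_le: "dint t \<le> \<bar>t - of_int i\<bar>"
  unfolding dint_def by (rule round_diff_minimal)

lemma dint_le_half: "dint t \<le> 1 / 2"
  unfolding dint_def using of_int_round_abs_le[of t] by (simp add: abs_minus_commute)

lemma dint_less_iff: "dint t < x \<longleftrightarrow> (\<exists>i::int. \<bar>t - of_int i\<bar> < x)"
  using dint_le le_less_trans by (metis dint_def)

lemma dint_nonneg: "dint t \<ge> 0"
  by (simp add: dint_def)

lemma dint_diff_less:
  assumes "dint (x - y) < \<delta>" "dint (x' - y) < \<delta>"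
  shows "dint (x - x') < 2 * \<delta>"
proof -
  obtain i j :: int where "\<bar>x - y - of_int i\<bar> < \<delta>" "\<bar>x' - y - of_int j\<bar> < \<delta>"
    using assms unfolding dint_less_iff by blast
  hence "\<bar>(x - x') - of_int (i - j)\<bar> < 2 * \<delta>" by simp
  thus ?thesis unfolding dint_less_iff by blast
qed

fun cf_p :: "real \<Rightarrow> nat \<Rightarrow> int" where
  "cf_p x 0 = 0"
| "cf_p x (Suc 0) = 1"
| "cf_p x (Suc (Suc k)) = int (cf_a x (Suc (Suc k))) * cf_p x (Suc k) + cf_p x k"

text \<open>The product of the Gauss map iterates equals |q_k x - p_k| (see
  \<open>convergent_error\<close>); in this form positivity and monotonicity are immediate.\<close>

definition cf_err :: "real \<Rightarrow> nat \<Rightarrow> real" where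
  "cf_err x k = (\<Prod>i\<le>k. cf_rem x i)"

locale irrational_unit =
  fixes \<theta> :: real
  assumes \<theta>_pos: "0 < \<theta>" and \<theta>_less_1: "\<theta> < 1" and irrational: "\<theta> \<notin> \<rat>"
begin

abbreviation "q \<equiv> cf_q \<theta>"
abbreviation "p \<equiv> cf_p \<theta>"
abbreviation "D \<equiv> cf_err \<theta>"

lemma cf_rem_bounds: "0 < cf_rem \<theta> k \<and> cf_rem \<theta> k < 1 \<and> cf_rem \<theta> k \<notin> \<rat>"
proof (induction k)
  case 0
  then show ?case using \<theta>_pos \<theta>_less_1 irrational by simp
next
  case (Suc k)
  let ?y = "1 / cf_rem \<theta> k"
  have irr: "?y \<notin> \<rat>"
  proof
    assume "?y \<in> \<rat>"
    hence "inverse ?y \<in> \<rat>" by (rule Rats_inverse)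
    thus False using Suc by simp
  qed
  have "frac ?y \<notin> \<rat>"
  proof
    assume "frac ?y \<in> \<rat>"
    hence "frac ?y + of_int \<lfloor>?y\<rfloor> \<in> \<rat>" by (intro Rats_add) auto
    thus False using irr by (simp add: frac_def)
  qed
  moreover from this have "frac ?y \<noteq> 0" by (metis Rats_0)
  ultimately show ?case using frac_ge_0[of ?y] frac_lt_1[of ?y] by (auto simp: less_le)
qed

lemma cf_a_rem: "1 / cf_rem \<theta> k = real (cf_a \<theta> (Suc k)) + cf_rem \<theta> (Suc k)"
proof -
  have "1 / cf_rem \<theta> k > 0" using cf_rem_bounds[of k] by simp
  hence "\<lfloor>1 / cf_rem \<theta> k\<rfloor> \<ge> 0" by simp
  thus ?thesis by (simp add: cf_a_def frac_def)
qed

lemma cf_a_ge_1: "cf_a \<theta> (Suc k) \<ge> 1"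
proof -
  have "1 / cf_rem \<theta> k > 1" using cf_rem_bounds[of k] by simp
  hence "\<lfloor>1 / cf_rem \<theta> k\<rfloor> \<ge> 1" by linarith
  thus ?thesis unfolding cf_a_def diff_Suc_1 by linarith
qed

lemma D_pos: "D k > 0"
  unfolding cf_err_def by (rule prod_pos) (use cf_rem_bounds in blast)

lemma D_Suc: "D (Suc k) = D k * cf_rem \<theta> (Suc k)"
  by (simp add: cf_err_def)

declare cf_rem.simps(2) [simp del]

lemma D_Suc_less: "D (Suc k) < D k"
  using D_pos[of k] cf_rem_bounds[of "Suc k"] by (simp add: D_Suc)

lemma D_recurrence: "D k = real (cf_a \<theta> (Suc (Suc k))) * D (Suc k) + D (Suc (Suc k))"
proof -
  have "D k = D k * (cf_rem \<theta> (Suc k) * (real (cf_a \<theta> (Suc (Suc k))) + cf_rem \<theta> (Suc (Suc k))))"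
    unfolding cf_a_rem[of "Suc k", symmetric] using cf_rem_bounds[of "Suc k"] by simp
  thus ?thesis by (simp add: D_Suc algebra_simps)
qed

text \<open>Both sides obey the recurrence of the partial quotients, the right one by
  \<open>D_recurrence\<close>; so consecutive errors alternate in sign.\<close>

lemma convergent_error: "real (q k) * \<theta> - of_int (p k) = (-1) ^ k * D k"
proof (induction k rule: cf_p.induct[of "\<lambda>_ k. real (q k) * \<theta> - of_int (p k) = (-1) ^ k * D k" for \<theta>, of \<theta>])
  case (1 x)
  then show ?case by (simp add: cf_err_def)
next
  case (2 x)
  then show ?case using cf_a_rem[of 0] \<theta>_pos by (simp add: cf_err_def field_simps)
next
  case (3 x k)
  have "real (q (Suc (Suc k))) * \<theta> - of_int (p (Suc (Suc k)))
      = real (cf_a \<theta> (Suc (Suc k))) * (real (q (Suc k)) * \<theta> - of_int (p (Suc k)))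
        + (real (q k) * \<theta> - of_int (p k))"
    by (simp add: algebra_simps)
  also have "\<dots> = (-1) ^ Suc (Suc k) * D (Suc (Suc k))"
    unfolding 3 using D_recurrence[of k] by (simp add: algebra_simps)
  finally show ?case .
qed

lemma convergent_det: "p (Suc k) * int (q k) - p k * int (q (Suc k)) = (-1) ^ k"
  by (induction k) (auto simp: algebra_simps)

text \<open>The left side is invariant under the recurrences of \<open>q\<close> and
  \<open>D\<close>. It confines \<open>D k\<close> between 1 / (2 * q (k+1)) and 1 / q
  (k+1).\<close>

lemma q_D_identity: "real (q (Suc k)) * D k + real (q k) * D (Suc k) = 1"
proof (induction k)
  case 0
  then show ?case using cf_a_rem[of 0] \<theta>_pos by (simp add: cf_err_def field_simps)
next
  case (Suc k)
  then show ?case using D_recurrence[of k] by (simp add: algebra_simps)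
qed

lemma q_pos: "q k > 0"
  by (induction k rule: induct_nat_012) (use cf_a_ge_1[of 0] in auto)

lemma q_mono_Suc: "q k \<le> q (Suc k)"
proof (cases k)
  case (Suc j)
  have "q (Suc j) \<le> cf_a \<theta> (Suc (Suc j)) * q (Suc j)"
    using cf_a_ge_1[of "Suc j"] by simp
  thus ?thesis unfolding Suc cf_q.simps by linarith
qed (use cf_a_ge_1[of 0] in simp)

text \<open>Index 0 is excluded because \<theta> > 1/2 has first partial quotient 1, so that q 0 = q
  1 = 1.\<close>

lemma q_strict_Suc: "k \<ge> 1 \<Longrightarrow> q k < q (Suc k)"
proof (cases k)
  case (Suc j)
  have "q (Suc j) \<le> cf_a \<theta> (Suc (Suc j)) * q (Suc j)"
    using cf_a_ge_1[of "Suc j"] by simp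
  thus ?thesis unfolding Suc cf_q.simps using q_pos[of j] by linarith
qed simp

lemma q_mono: "i \<le> j \<Longrightarrow> q i \<le> q j"
  by (rule lift_Suc_mono_le[of q]) (use q_mono_Suc in auto)

lemma q_ge: "k \<le> q k"
proof (induction k)
  case (Suc k)
  then show ?case using q_strict_Suc[of k] q_pos[of "Suc k"] by (cases "k = 0") auto
qed simp

lemma D_less: "D k < 1 / real (q (Suc k))"
proof -
  have "real (q (Suc k)) * D k < 1"
    using q_D_identity[of k] mult_pos_pos[of "real (q k)" "D (Suc k)"] q_pos[of k] D_pos[of "Suc k"] by linarith
  thus ?thesis using q_pos[of "Suc k"] by (simp add: field_simps)
qed

lemma D_ge: "D k \<ge> 1 / (2 * real (q (Suc k)))"
proof -
  have "real (q k) * D (Suc k) \<le> real (q (Suc k)) * D k"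
    using q_mono_Suc[of k] D_Suc_less[of k] D_pos[of "Suc k"] by (intro mult_mono) auto
  hence "1 \<le> 2 * real (q (Suc k)) * D k" using q_D_identity[of k] by linarith
  thus ?thesis using q_pos[of "Suc k"] by (simp add: field_simps)
qed

text \<open>By the determinant, (q k, p k) and (q (k+1), p (k+1)) form a basis of the integer
  lattice; u, v are the coordinates of j and its nearest integer. The bounds on j leave only u
  nonzero with v zero or of opposite sign, and then the two contributions add up since consecutive
  errors alternate.\<close>

lemma best_approximation:
  assumes j: "1 \<le> j" "j < q (Suc k)"
  shows "D k \<le> dint (real j * \<theta>)"
proof -
  define i where "i = round (real j * \<theta>)"
  define \<sigma> :: int where "\<sigma> = (-1) ^ k"
  have \<sigma>2: "\<sigma> * \<sigma> = 1" by (simp add: \<sigma>_def flip: power_mult_distrib)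
  define u where "u = \<sigma> * (p (Suc k) * int j - int (q (Suc k)) * i)"
  define v where "v = \<sigma> * (int (q k) * i - p k * int j)"
  have det: "p (Suc k) * int (q k) - p k * int (q (Suc k)) = \<sigma>"
    using convergent_det by (simp add: \<sigma>_def)
  have ju: "u * int (q k) + v * int (q (Suc k)) = int j"
  proof -
    have "u * int (q k) + v * int (q (Suc k))
        = \<sigma> * (p (Suc k) * int (q k) - p k * int (q (Suc k))) * int j"
      by (simp add: u_def v_def algebra_simps)
    thus ?thesis by (simp add: det \<sigma>2)
  qed
  have iu: "u * p k + v * p (Suc k) = i"
  proof -
    have "u * p k + v * p (Suc k) = \<sigma> * (p (Suc k) * int (q k) - p k * int (q (Suc k))) * i"
      by (simp add: u_def v_def algebra_simps)
    thus ?thesis by (simp add: det \<sigma>2)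
  qed
  have "real j * \<theta> - of_int i = of_int u * (real (q k) * \<theta> - of_int (p k))
      + of_int v * (real (q (Suc k)) * \<theta> - of_int (p (Suc k)))"
  proof -
    have "real j = of_int u * real (q k) + of_int v * real (q (Suc k))"
      using arg_cong[OF ju, of real_of_int] by simp
    moreover have "real_of_int i = of_int u * of_int (p k) + of_int v * of_int (p (Suc k))"
      using arg_cong[OF iu, of real_of_int] by simp
    ultimately show ?thesis by (simp add: algebra_simps)
  qed
  also have "\<dots> = (-1) ^ k * (of_int u * D k - of_int v * D (Suc k))"
    unfolding convergent_error by (simp add: algebra_simps)
  finally have eq: "\<bar>real j * \<theta> - of_int i\<bar> = \<bar>of_int u * D k - of_int v * D (Suc k)\<bar>"
    by (simp add: abs_mult power_abs)
  have "D k \<le> \<bar>of_int u * D k - of_int v * D (Suc k)\<bar>"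
  proof -
    have q1: "int (q k) \<ge> 1" "int (q (Suc k)) \<ge> 1" using q_pos[of k] q_pos[of "Suc k"] by linarith+
    have *: "D k \<le> of_int x * D k" if "x \<ge> 1" for x :: int
      using D_pos[of k] that mult_right_mono[of 1 "real_of_int x" "D k"] by simp
    have **: "0 \<le> of_int x * D (Suc k)" if "x \<ge> 0" for x :: int
      using D_pos[of "Suc k"] that by simp
    consider "u \<ge> 1" "v \<le> 0" | "u \<le> -1" "v \<ge> 0" | "u \<ge> 0" "v \<ge> 1" | "u \<le> 0" "v \<le> 0"
      by linarith
    thus ?thesis
    proof cases
      case 1
      thus ?thesis using *[of u] **[of "-v"] by simp
    next
      case 2
      thus ?thesis using *[of "-u"] **[of v] by simp
    next
      case 3
      have "0 * int (q k) \<le> u * int (q k)" "1 * int (q (Suc k)) \<le> v * int (q (Suc k))"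
        using 3 q1 by (intro mult_right_mono; simp)+
      thus ?thesis using ju j by simp
    next
      case 4
      have "u * int (q k) \<le> 0" "v * int (q (Suc k)) \<le> 0"
        using 4 q1 by (auto intro: mult_nonpos_nonneg)
      thus ?thesis using ju j by simp
    qed
  qed
  thus ?thesis unfolding eq[symmetric] i_def dint_def .
qed

lemma dint_q_le: "dint (real (q k) * \<theta>) \<le> D k"
proof -
  have "dint (real (q k) * \<theta>) \<le> \<bar>real (q k) * \<theta> - of_int (p k)\<bar>" by (rule dint_le)
  thus ?thesis unfolding convergent_error using D_pos[of k] by (simp add: abs_mult power_abs)
qed

text \<open>It fails for k = 0 if \<theta> > 1/2: the distance is then 1 - \<theta>, while
  \<open>D 0\<close> is \<theta>.\<close>

lemma dint_q: "k \<ge> 1 \<Longrightarrow> dint (real (q k) * \<theta>) = D k"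
  using dint_q_le[of k] best_approximation[of "q k" k] q_strict_Suc[of k] q_pos[of k]
  by (simp add: Suc_le_eq)

lemma dint_pos: "j \<ge> 1 \<Longrightarrow> dint (real j * \<theta>) > 0"
proof -
  assume j: "j \<ge> 1"
  have "j < q (Suc j)" using q_ge[of "Suc j"] by linarith
  thus ?thesis using best_approximation[OF j] D_pos[of j] by fastforce
qed

lemma q_bracket:
  fixes Q :: real
  assumes "1 \<le> Q"
  obtains m where "real (q m) \<le> Q" "Q < real (q (Suc m))"
proof -
  define m where "m = (LEAST m. Q < real (q (Suc m)))"
  obtain N where "Q < real N" using reals_Archimedean2 by blast
  hence "Q < real (q (Suc N))" using q_ge[of "Suc N"] by linarith
  hence m: "Q < real (q (Suc m))" unfolding m_def by (rule LeastI)
  have "real (q m) \<le> Q"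
  proof (cases m)
    case (Suc j)
    hence "\<not> Q < real (q (Suc j))" using not_less_Least[of j "\<lambda>m. Q < real (q (Suc m))"]
      unfolding m_def by simp
    thus ?thesis using Suc by simp
  qed (use assms in simp)
  thus ?thesis using that m by blast
qed

lemma q_less_imp: "q i < q (Suc j) \<Longrightarrow> i \<le> j"
  using q_mono[of "Suc j" i] by (meson not_less not_less_eq_eq)

text \<open>Rounding \<open>y\<close> to a multiple of \<open>1 / q m\<close> on the side opposite to the sign of
  the error of the convergent keeps the total error below \<open>1 / q m\<close>.\<close>
lemma orbit_dense:
  "\<exists>a i. 1 \<le> a \<and> a \<le> q m \<and> \<bar>real a * \<theta> + of_int i - y\<bar> < 1 / real (q m)"
proof -
  define c where "c = (if even m then \<lfloor>real (q m) * y\<rfloor> else \<lceil>real (q m) * y\<rceil>)"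
  \<comment> \<open>By the determinant, - (-1) ^ m * q (m+1) inverts p m modulo q m, so n0 solves n
    * p m = c modulo q m. The shift by 1 around \<open>mod\<close> then picks the representative in
    1..q m, since orbit indices start at 1.\<close>
  define n0 where "n0 = - ((-1) ^ m * c * int (q (Suc m)))"
  define n where "n = (n0 - 1) mod int (q m) + 1"
  have q: "int (q m) > 0" "real (q m) > 0" using q_pos[of m] by auto
  have n: "1 \<le> n" "n \<le> int (q m)"
    unfolding n_def using q pos_mod_bound[of "int (q m)" "n0 - 1"] pos_mod_sign[of "int (q m)" "n0 - 1"] by linarith+
  have "n0 * p m = c * ((-1) ^ m * (- (p m * int (q (Suc m)))))" by (simp add: n0_def algebra_simps)
  also have "- (p m * int (q (Suc m))) = (-1) ^ m - p (Suc m) * int (q m)"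
    using convergent_det[of m] by linarith
  also have "c * ((-1) ^ m * ((-1) ^ m - p (Suc m) * int (q m))) = c - (-1) ^ m * c * p (Suc m) * int (q m)"
    by (simp add: algebra_simps flip: power_mult_distrib)
  finally have n0: "n0 * p m = c - (-1) ^ m * c * p (Suc m) * int (q m)" .
  have "n = n0 - int (q m) * ((n0 - 1) div int (q m))"
    unfolding n_def using minus_mult_div_eq_mod[of "n0 - 1" "int (q m)"] by linarith
  hence "n * p m = n0 * p m - int (q m) * ((n0 - 1) div int (q m)) * p m"
    by (metis left_diff_distrib)
  hence "n * p m = c - int (q m) * ((-1) ^ m * c * p (Suc m) + ((n0 - 1) div int (q m)) * p m)"
    unfolding n0 by (simp add: algebra_simps)
  then obtain i where i: "n * p m + i * int (q m) = c"
    by (metis add_diff_cancel_left' add_diff_inverse diff_add_cancel mult.commute)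
  define a where "a = nat n"
  have a: "real a = of_int n" "1 \<le> a" "a \<le> q m" using n by (auto simp: a_def)
  have ci: "of_int c = real a * of_int (p m) + of_int i * real (q m)"
    using arg_cong[OF i, of real_of_int] by (simp add: a)
  have "real (q m) * (real a * \<theta> + of_int i - y)
      = real a * (real (q m) * \<theta> - of_int (p m)) + (of_int c - real (q m) * y)"
    unfolding ci by (simp add: algebra_simps)
  also have "\<dots> = real a * ((-1) ^ m * D m) + (of_int c - real (q m) * y)"
    unfolding convergent_error ..
  finally have eq: "real (q m) * (real a * \<theta> + of_int i - y)
      = real a * ((-1) ^ m * D m) + (of_int c - real (q m) * y)" .
  have "real a * D m \<le> real (q (Suc m)) * D m"
    using a D_pos[of m] q_mono_Suc[of m] by (intro mult_right_mono) auto
  also have "\<dots> < 1" using D_less[of m] q_pos[of "Suc m"] by (simp add: field_simps)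
  finally have aD: "real a * D m < 1" .
  have aD0: "real a * D m > 0" using a D_pos[of m] by simp
  have "\<bar>real a * ((-1) ^ m * D m) + (of_int c - real (q m) * y)\<bar> < 1"
  proof (cases "even m")
    case True
    then show ?thesis using aD aD0 unfolding c_def by (simp; linarith)
  next
    case False
    then show ?thesis using aD aD0 unfolding c_def by (simp; linarith)
  qed
  hence "\<bar>real (q m) * (real a * \<theta> + of_int i - y)\<bar> < 1" by (simp add: eq)
  hence "real (q m) * \<bar>real a * \<theta> + of_int i - y\<bar> < 1" using q by (simp add: abs_mult)
  hence "\<bar>real a * \<theta> + of_int i - y\<bar> < 1 / real (q m)" using q by (simp add: field_simps)
  thus ?thesis using a by blast
qed

text \<open>Replacing j by the denominator with q m \<le> j < q (m+1) can only decrease both factors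
  of j powr s * dint (j * \<theta>).\<close>

lemma frequently_well_approximable:
  assumes t: "t > 0" and w: "ereal t < irr_exp \<theta>"
  shows "\<exists>m\<ge>M. real (q m) powr t * D m < 1"
proof -
  obtain s where s: "t < s" and lim: "Liminf sequentially (\<lambda>j. ereal (real j powr s * dint (real j * \<theta>))) = 0"
    using w unfolding irr_exp_def less_Sup_iff by auto
  have "\<not> eventually (\<lambda>j. ereal 1 \<le> ereal (real j powr s * dint (real j * \<theta>))) sequentially"
  proof
    assume "eventually (\<lambda>j. ereal 1 \<le> ereal (real j powr s * dint (real j * \<theta>))) sequentially"
    hence "ereal 1 \<le> Liminf sequentially (\<lambda>j. ereal (real j powr s * dint (real j * \<theta>)))"
      by (rule Liminf_bounded)
    thus False by (simp add: lim)
  qed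
  then obtain j where j: "j \<ge> q M" "real j powr s * dint (real j * \<theta>) < 1"
    by (auto simp: eventually_sequentially not_le)
  have j1: "1 \<le> real j" using j(1) q_pos[of M] by linarith
  obtain m where m: "real (q m) \<le> real j" "real j < real (q (Suc m))" using q_bracket[OF j1] .
  have "M \<le> m" using j(1) m(2) by (intro q_less_imp) linarith
  moreover have "real (q m) powr t * D m \<le> real j powr s * dint (real j * \<theta>)"
  proof (rule mult_mono)
    have "real (q m) powr t \<le> real j powr t" using m t by (intro powr_mono2) auto
    also have "\<dots> \<le> real j powr s" using j1 s by (intro powr_mono) auto
    finally show "real (q m) powr t \<le> real j powr s" .
    show "D m \<le> dint (real j * \<theta>)" by (rule best_approximation) (use m j1 in auto)
  qed (use D_pos[of m] in auto)
  ultimately show ?thesis using j by (intro exI[of _ m]) auto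
qed

text \<open>Above the supremum the liminf is positive, which settles all large j; the finitely many
  j < J are at distance at least \<open>D J\<close>.\<close>

lemma badly_approximable:
  assumes s: "s > 0" and w: "irr_exp \<theta> < ereal s"
  shows "\<exists>c>0. \<forall>j\<ge>1. dint (real j * \<theta>) \<ge> c * real j powr (- s)"
proof -
  let ?f = "\<lambda>j. ereal (real j powr s * dint (real j * \<theta>))"
  have "Liminf sequentially ?f \<noteq> 0"
  proof
    assume "Liminf sequentially ?f = 0"
    hence "ereal s \<le> irr_exp \<theta>" unfolding irr_exp_def using s by (intro Sup_upper) auto
    thus False using w by simp
  qed
  moreover have "Liminf sequentially ?f \<ge> 0"
    by (rule Liminf_bounded) (auto simp: dint_nonneg)
  ultimately have "0 < Liminf sequentially ?f" by simp
  then obtain c0 where c0: "0 < ereal c0" "ereal c0 < Liminf sequentially ?f"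
    using ereal_dense2[of 0 "Liminf sequentially ?f"] by auto
  have "eventually (\<lambda>j. ereal c0 < ?f j) sequentially"
    using c0(2) by (rule less_LiminfD)
  then obtain J where J: "\<And>j. j \<ge> J \<Longrightarrow> c0 < real j powr s * dint (real j * \<theta>)"
    by (auto simp: eventually_sequentially)
  define c where "c = min c0 (D J)"
  have "c > 0" using c0 D_pos[of J] by (simp add: c_def)
  moreover have "dint (real j * \<theta>) \<ge> c * real j powr (- s)" if j: "j \<ge> 1" for j
  proof (cases "j \<ge> J")
    case True
    have "c \<le> real j powr s * dint (real j * \<theta>)" using J[OF True] by (simp add: c_def)
    thus ?thesis using j by (simp add: powr_minus field_simps)
  next
    case False
    have "c * real j powr (- s) \<le> D J * 1"
      using j s \<open>c > 0\<close> by (intro mult_mono) (auto simp: c_def powr_minus ge_one_powr_ge_zero field_simps)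
    also have "\<dots> \<le> dint (real j * \<theta>)"
      using best_approximation[of j J] False j q_ge[of "Suc J"] by simp
    finally show ?thesis .
  qed
  ultimately show ?thesis by blast
qed

end

section \<open>Sparse sequences of denominators\<close>

definition crit_radius :: "real \<Rightarrow> real \<Rightarrow> real \<Rightarrow> real" where
  "crit_radius \<tau> n e = (e / n) powr (\<tau> / (1 + \<tau>))"

definition crit_time :: "real \<Rightarrow> real \<Rightarrow> real \<Rightarrow> real" where
  "crit_time \<tau> n e = (n / e) powr (1 / (1 + \<tau>))"

lemma crit_radius_pos: "n > 0 \<Longrightarrow> e > 0 \<Longrightarrow> crit_radius \<tau> n e > 0"
  by (simp add: crit_radius_def)

lemma crit_time_pos: "n > 0 \<Longrightarrow> e > 0 \<Longrightarrow> crit_time \<tau> n e > 0"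
  by (simp add: crit_time_def)

lemma crit_radius_altdef:
  assumes "n > 0" "e > 0"
  shows "crit_radius \<tau> n e = (n / e) powr (- (\<tau> / (1 + \<tau>)))"
  using assms by (simp add: crit_radius_def powr_divide powr_minus)

lemma crit_time_powr:
  assumes "n > 0" "e > 0"
  shows "crit_time \<tau> n e powr (- \<tau>) = crit_radius \<tau> n e"
  using assms by (simp add: crit_time_def crit_radius_altdef powr_powr)

lemma crit_time_eq:
  assumes "n > 0" "e > 0" "\<tau> > 0"
  shows "crit_time \<tau> n e = crit_radius \<tau> n e powr (- (1 / \<tau>))"
proof -
  have "- (\<tau> / (1 + \<tau>)) * (- (1 / \<tau>)) = 1 / (1 + \<tau>)" using assms by (simp add: field_simps)
  thus ?thesis using assms by (simp add: crit_time_def crit_radius_altdef powr_powr)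
qed

text \<open>The equation X * e / n = X powr (- \<tau>) that defines the critical time X, in the form
  used to compare drift and radius.\<close>

lemma crit_time_mult:
  assumes "n > 0" "e > 0" "\<tau> > 0"
  shows "crit_time \<tau> n e * e = crit_radius \<tau> n e * n"
proof -
  have "1 / (1 + \<tau>) = - (\<tau> / (1 + \<tau>)) + 1" using assms by (simp add: field_simps)
  hence "crit_time \<tau> n e = crit_radius \<tau> n e * (n / e)"
    unfolding crit_time_def crit_radius_altdef[OF assms(1,2)] by (simp only: powr_add) (use assms in simp)
  thus ?thesis using assms by simp
qed

lemma crit_radius_split:
  assumes "n > 0" "e > 0"
  shows "crit_radius \<tau> n e = e powr (\<tau> / (1 + \<tau>)) * n powr (- (\<tau> / (1 + \<tau>)))"
  using assms by (simp add: crit_radius_def powr_divide powr_minus field_simps)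

text \<open>Step of a cluster relative to the radius. For \<tau> < 1 it vanishes by
  \<open>e_n_lim\<close>; for \<tau> > 1 it is a power of the tested quantity n powr \<tau> * e and
  so stays bounded.\<close>

lemma quotient_crit_radius:
  assumes "n > 0" "e > 0" "\<tau> > 0"
  shows "e / crit_radius \<tau> n e = e powr (1 / (1 + \<tau>)) * n powr (\<tau> / (1 + \<tau>))"
proof -
  have "1 / (1 + \<tau>) = 1 - \<tau> / (1 + \<tau>)" using assms by (simp add: field_simps)
  hence "e powr (1 / (1 + \<tau>)) = e / e powr (\<tau> / (1 + \<tau>))"
    using assms by (simp only: powr_diff) simp
  thus ?thesis using assms unfolding crit_radius_split[OF assms(1,2)] by (simp add: powr_minus field_simps)
qed

lemma tendsto_0_powr:
  fixes f :: "nat \<Rightarrow> real"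
  assumes "f \<longlonglongrightarrow> 0" "\<And>k. f k \<ge> 0" "c > 0"
  shows "(\<lambda>k. f k powr c) \<longlonglongrightarrow> 0"
  using tendsto_powr'[OF assms(1) tendsto_const[of c]] assms by simp

context irrational_unit
begin

text \<open>At the critical time the forward drift along multiples of \<open>n\<close> is no larger than the
  radius of approximation itself.\<close>
lemma U_set_near_orbit:
  assumes y: "y \<in> U_set \<tau> \<theta>" and \<tau>: "\<tau> > 0"
  shows "\<exists>Q0. \<forall>n::nat. n \<ge> 1 \<longrightarrow> crit_time \<tau> (real n) (dint (real n * \<theta>)) \<ge> Q0 \<longrightarrow>
    (\<exists>(a::nat) (j::int). 1 \<le> a \<and> a \<le> n \<and>
      \<bar>y - (real a * \<theta> + of_int j)\<bar> \<le> 2 * crit_radius \<tau> (real n) (dint (real n * \<theta>)))"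
proof -
  obtain Q0 where Q0: "\<And>Q. Q \<ge> Q0 \<Longrightarrow> \<exists>n::nat. 1 \<le> n \<and> real n \<le> Q \<and> dint (real n * \<theta> - y) < Q powr (- \<tau>)"
    using y by (auto simp: U_set_def)
  show ?thesis
  proof (intro exI[of _ Q0] allI impI)
    fix n :: nat assume n: "n \<ge> 1"
    define e where "e = dint (real n * \<theta>)"
    define r where "r = crit_radius \<tau> (real n) e"
    define Q where "Q = crit_time \<tau> (real n) e"
    assume "crit_time \<tau> (real n) (dint (real n * \<theta>)) \<ge> Q0"
    then obtain N where N: "1 \<le> N" "real N \<le> Q" "dint (real N * \<theta> - y) < Q powr (- \<tau>)"
      using Q0 unfolding Q_def e_def by blast
    have e: "e > 0" using dint_pos[OF n] by (simp add: e_def)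
    obtain l :: int where l: "\<bar>real N * \<theta> - y - of_int l\<bar> < r"
      using N(3) crit_time_powr[of "real n" e \<tau>] n e by (auto simp: dint_less_iff Q_def r_def)
    define c where "c = round (real n * \<theta>)"
    \<comment> \<open>Dividing N - 1 instead of N puts a into 1..n. The drift i * e is at most Q * e
      / n = r.\<close>
    define i where "i = (N - 1) div n"
    define a where "a = (N - 1) mod n + 1"
    have Neq: "N = a + i * n" using N(1) by (simp add: a_def i_def)
    have a: "1 \<le> a" "a \<le> n" using n by (auto simp: a_def Suc_le_eq)
    have "real i * e \<le> r"
    proof -
      have "real i * real n \<le> Q" using N(2) Neq by simp
      hence "real i * real n * e \<le> Q * e" using e by (intro mult_right_mono) auto
      also have "\<dots> = r * real n" using crit_time_mult[of "real n" e \<tau>] n e \<tau> by (simp add: Q_def r_def)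
      finally show ?thesis using n by (simp add: mult_ac)
    qed
    moreover have "\<bar>real i * (real n * \<theta> - of_int c)\<bar> = real i * e"
      by (simp add: abs_mult e_def dint_def c_def)
    moreover have "y - (real a * \<theta> + of_int (int i * c - l))
        = real i * (real n * \<theta> - of_int c) - (real N * \<theta> - y - of_int l)"
      unfolding Neq by (simp add: algebra_simps)
    ultimately have "\<bar>y - (real a * \<theta> + of_int (int i * c - l))\<bar> \<le> 2 * r" using l by linarith
    thus "\<exists>(a::nat) (j::int). 1 \<le> a \<and> a \<le> n \<and>
      \<bar>y - (real a * \<theta> + of_int j)\<bar> \<le> 2 * crit_radius \<tau> (real n) (dint (real n * \<theta>))"
      using a unfolding r_def e_def by blast
  qed
qed

text \<open>Distinct indices differ by less than q (m+1), so best approximation applies; equal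
  indices leave a nonzero integer, whence the assumption d \<le> 1.\<close>

lemma orbit_separated:
  assumes "a \<le> N" "b \<le> N" "1 \<le> a" "1 \<le> b" and N: "N \<le> q (Suc m)" and d: "d \<le> D m" "d \<le> 1"
    and ne: "real a * \<theta> + of_int i \<noteq> real b * \<theta> + of_int j"
  shows "d \<le> \<bar>(real a * \<theta> + of_int i) - (real b * \<theta> + of_int j)\<bar>"
proof -
  have *: "d \<le> \<bar>(real a * \<theta> + of_int i) - (real b * \<theta> + of_int j)\<bar>"
    if "b < a" "a \<le> N" "1 \<le> b" for a b i j
  proof -
    have "D m \<le> dint (real (a - b) * \<theta>)"
      by (rule best_approximation) (use that N in auto)
    also have "\<dots> \<le> \<bar>real (a - b) * \<theta> - of_int (j - i)\<bar>" by (rule dint_le)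
    finally show ?thesis using that d by (simp add: of_nat_diff algebra_simps)
  qed
  consider "a = b" | "b < a" | "a < b" by linarith
  thus ?thesis
  proof cases
    case 1
    hence "i \<noteq> j" using ne by auto
    hence "\<bar>real_of_int i - real_of_int j\<bar> \<ge> 1" by linarith
    thus ?thesis using 1 d by simp
  next
    case 2
    thus ?thesis using * assms by blast
  next
    case 3
    hence "d \<le> \<bar>(real b * \<theta> + of_int j) - (real a * \<theta> + of_int i)\<bar>" using * assms by blast
    thus ?thesis by linarith
  qed
qed

end

text \<open>Common frame of both ranges: \<alpha> = 1 / \<tau>, \<beta> = 1 for \<tau> < 1 and
  \<alpha> = \<tau>, \<beta> = 2 for \<tau> > 1. The shared asymptotics rest on \<alpha> > 1 and
  \<beta> \<le> 2.\<close>

locale approx_seq = irrational_unit +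
  fixes \<tau> \<alpha> \<beta> :: real and S :: "nat set"
  assumes \<tau>_pos: "\<tau> > 0" and \<alpha>: "\<alpha> > 1" and \<beta>: "0 < \<beta>" "\<beta> \<le> 2"
    and S_eq: "S = {cf_q \<theta> m | m. real (cf_q \<theta> m) powr \<alpha> * dint (real (cf_q \<theta> m) * \<theta>) < \<beta>}"
    and S_infinite: "infinite S"
begin

definition n :: "nat \<Rightarrow> nat" where "n k = enumerate S k"
definition e :: "nat \<Rightarrow> real" where "e k = dint (real (n k) * \<theta>)"
text \<open>m \<ge> 1 avoids the ambiguity q 0 = q 1 and makes \<open>dint_q\<close> applicable. For
  k = 0 such an index need not exist, hence the assumptions k \<ge> 1 below.\<close>

definition idx :: "nat \<Rightarrow> nat" where "idx k = (SOME m. 1 \<le> m \<and> n k = q m)"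
definition r :: "nat \<Rightarrow> real" where "r k = crit_radius \<tau> (real (n k)) (e k)"
definition Q :: "nat \<Rightarrow> real" where "Q k = crit_time \<tau> (real (n k)) (e k)"

lemma in_S_iff: "s \<in> S \<longleftrightarrow> (\<exists>m. s = q m \<and> real s powr \<alpha> * dint (real s * \<theta>) < \<beta>)"
  by (subst S_eq) blast

lemma n_in_S: "n k \<in> S"
  unfolding n_def using S_infinite by (rule enumerate_in_set)

lemma n_pos: "n k \<ge> 1"
  using n_in_S[of k] q_pos by (auto simp: in_S_iff Suc_le_eq)

lemma n_strict_mono: "strict_mono n"
  unfolding n_def using S_infinite by (simp add: strict_mono_enumerate)

lemma n_ge: "n k \<ge> k"
  using n_strict_mono by (rule strict_mono_imp_increasing)

lemma e_pos: "e k > 0"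
  unfolding e_def using dint_pos n_pos by blast

lemma e_le_half: "e k \<le> 1 / 2"
  unfolding e_def by (rule dint_le_half)

lemma n_e_less: "real (n k) powr \<alpha> * e k < \<beta>"
  using n_in_S[of k] unfolding in_S_iff e_def by blast

lemma idx: assumes "k \<ge> 1" shows "1 \<le> idx k" "n k = q (idx k)"
proof -
  obtain m where m: "n k = q m" using n_in_S[of k] unfolding in_S_iff by blast
  have "n 0 < n k" using n_strict_mono assms by (simp add: strict_mono_def)
  hence "n k > 1" using n_pos[of 0] by linarith
  hence "m \<noteq> 0" using m by (intro notI) simp
  hence "\<exists>m. 1 \<le> m \<and> n k = q m" using m by (intro exI[of _ m]) simp
  hence "1 \<le> idx k \<and> n k = q (idx k)" unfolding idx_def by (rule someI_ex)
  thus "1 \<le> idx k" "n k = q (idx k)" by auto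
qed

lemma e_eq: "k \<ge> 1 \<Longrightarrow> e k = D (idx k)"
  using idx[of k] dint_q[of "idx k"] by (simp add: e_def)

lemma next_q_le: assumes "k \<ge> 1" shows "q (Suc (idx k)) \<le> n (Suc k)"
proof -
  have "n k < n (Suc k)" using n_strict_mono by (simp add: strict_mono_Suc_iff)
  hence "q (idx k) < q (idx (Suc k))" using idx(2)[OF assms] idx(2)[of "Suc k"] by simp
  hence "idx k < idx (Suc k)" using q_mono[of "idx (Suc k)" "idx k"] by (meson not_less)
  thus ?thesis using idx[of "Suc k"] q_mono[of "Suc (idx k)" "idx (Suc k)"] by simp
qed

lemma S_gap: assumes "s \<in> S" "n k < s" shows "n (Suc k) \<le> s"
proof -
  obtain j where j: "s = n j" using enumerate_Ex[OF S_infinite assms(1)] unfolding n_def by auto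
  hence "k < j" using assms(2) n_strict_mono by (simp add: strict_mono_less)
  thus ?thesis unfolding j using n_strict_mono by (simp add: strict_mono_less_eq Suc_le_eq)
qed

lemma e_ge: "k \<ge> 1 \<Longrightarrow> e k \<ge> 1 / (2 * real (q (Suc (idx k))))"
  using D_ge e_eq by simp

lemma inverse_n_Suc_le: assumes "k \<ge> 1" shows "1 / real (n (Suc k)) \<le> 2 * e k"
proof -
  have "1 / real (n (Suc k)) \<le> 1 / real (q (Suc (idx k)))"
    using next_q_le[OF assms] q_pos[of "Suc (idx k)"] by (intro divide_left_mono) auto
  thus ?thesis using e_ge[OF assms] by simp
qed

lemma r_pos: "r k > 0"
  unfolding r_def using n_pos[of k] e_pos by (intro crit_radius_pos) auto

lemma Q_pos: "Q k > 0"
  unfolding Q_def using n_pos[of k] e_pos by (intro crit_time_pos) auto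

section \<open>Asymptotics of the selected denominators, radii and critical times\<close>

lemma n_le: "real (n k) \<le> 2 * e k powr (- (1 / \<alpha>))"
proof -
  have n0: "real (n k) > 0" using n_pos[of k] by simp
  have "real (n k) powr \<alpha> \<le> 2 / e k"
    using n_e_less[of k] \<beta> e_pos[of k] by (simp add: field_simps)
  hence "(real (n k) powr \<alpha>) powr (1 / \<alpha>) \<le> (2 / e k) powr (1 / \<alpha>)"
    using \<alpha> by (intro powr_mono2) auto
  hence "real (n k) \<le> (2 / e k) powr (1 / \<alpha>)" using \<alpha> n0 by (simp add: powr_powr)
  also have "\<dots> = 2 powr (1 / \<alpha>) * e k powr (- (1 / \<alpha>))"
    using e_pos[of k] by (simp add: powr_divide powr_minus field_simps)
  also have "\<dots> \<le> 2 powr 1 * e k powr (- (1 / \<alpha>))"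
    using \<alpha> by (intro mult_right_mono powr_mono) auto
  finally show ?thesis by simp
qed

lemma n_at_top: "filterlim (\<lambda>k. real (n k)) at_top sequentially"
  by (rule filterlim_at_top_mono[OF filterlim_real_sequentially]) (use n_ge in auto)

lemma e_lim: "e \<longlonglongrightarrow> 0"
proof (rule tendsto_sandwich[of "\<lambda>_. 0" _ _ "\<lambda>k. 2 / real (n k)"])
  have "e k \<le> 2 / real (n k)" for k
  proof -
    have "real (n k) powr 1 \<le> real (n k) powr \<alpha>" using n_pos[of k] \<alpha> by (intro powr_mono) auto
    hence "real (n k) * e k \<le> real (n k) powr \<alpha> * e k"
      using n_pos[of k] e_pos[of k] by (intro mult_right_mono) auto
    hence "real (n k) * e k \<le> 2" using n_e_less[of k] \<beta> by linarith
    thus ?thesis using n_pos[of k] by (simp add: field_simps)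
  qed
  thus "eventually (\<lambda>k. e k \<le> 2 / real (n k)) sequentially" by simp
  show "(\<lambda>k. 2 / real (n k)) \<longlonglongrightarrow> 0"
    by (rule real_tendsto_divide_at_top[OF tendsto_const n_at_top])
qed (use e_pos in \<open>auto simp: less_imp_le\<close>)

text \<open>\<open>n_le\<close> bounds n by a power of e, leaving a positive power of e. Limits of
  mixed powers thus reduce to comparing x with y / \<alpha>.\<close>

lemma e_n_lim:
  assumes "y \<ge> 0" "x > y / \<alpha>"
  shows "(\<lambda>k. e k powr x * real (n k) powr y) \<longlonglongrightarrow> 0"
proof (rule tendsto_sandwich[of "\<lambda>_. 0" _ _ "\<lambda>k. 2 powr y * e k powr (x - y / \<alpha>)"])
  have "e k powr x * real (n k) powr y \<le> 2 powr y * e k powr (x - y / \<alpha>)" for k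
  proof -
    have "real (n k) powr y \<le> (2 * e k powr (- (1 / \<alpha>))) powr y"
      using n_le[of k] assms by (intro powr_mono2) auto
    also have "\<dots> = 2 powr y * e k powr (- (y / \<alpha>))"
      using e_pos[of k] by (simp add: powr_mult powr_powr)
    finally have "e k powr x * real (n k) powr y \<le> e k powr x * (2 powr y * e k powr (- (y / \<alpha>)))"
      by (intro mult_left_mono) auto
    also have "\<dots> = 2 powr y * e k powr (x - y / \<alpha>)"
      by (simp add: powr_diff powr_minus field_simps)
    finally show ?thesis .
  qed
  thus "eventually (\<lambda>k. e k powr x * real (n k) powr y \<le> 2 powr y * e k powr (x - y / \<alpha>)) sequentially"
    by simp
  show "(\<lambda>k. 2 powr y * e k powr (x - y / \<alpha>)) \<longlonglongrightarrow> 0"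
    by (intro tendsto_mult_right_zero tendsto_0_powr e_lim) (use assms e_pos in \<open>auto simp: less_imp_le\<close>)
qed auto

text \<open>n (k+1) is at least 1 / (2 * e k), and e (k+1) at most 2 * n (k+1) powr (-
  \<alpha>).\<close>

lemma quotient_Suc_le:
  assumes k: "k \<ge> 1"
  shows "e (Suc k) / real (n (Suc k)) \<le> 2 * (2 * e k) powr (1 + \<alpha>)"
proof -
  let ?N = "real (n (Suc k))"
  have N: "?N > 0" using n_pos[of "Suc k"] by simp
  have "e (Suc k) \<le> 2 * ?N powr (- \<alpha>)"
    using n_e_less[of "Suc k"] \<beta> N by (simp add: powr_minus field_simps)
  hence "e (Suc k) / ?N \<le> 2 * ?N powr (- \<alpha>) / ?N" using N by (intro divide_right_mono) auto
  also have "\<dots> = 2 * (1 / ?N) powr (1 + \<alpha>)"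
    using N by (simp add: powr_divide powr_minus powr_add field_simps)
  also have "\<dots> \<le> 2 * (2 * e k) powr (1 + \<alpha>)"
    using inverse_n_Suc_le[OF k] \<alpha> N by (intro mult_left_mono powr_mono2) auto
  finally show ?thesis .
qed

lemma r_ratio_lim: "(\<lambda>k. r (Suc k) / r k) \<longlonglongrightarrow> 0"
proof -
  define u where "u k = e k / real (n k)" for k
  have u_pos: "u k > 0" for k using e_pos[of k] n_pos[of k] by (simp add: u_def)
  \<comment> \<open>The bound vanishes because \<alpha> > 1 / \<alpha>.\<close>
  have lim: "(\<lambda>k. 2 * 2 powr (1 + \<alpha>) * (e k powr \<alpha> * real (n k) powr 1)) \<longlonglongrightarrow> 0"
    by (intro tendsto_mult_right_zero e_n_lim) (use \<alpha> less_1_mult[OF \<alpha> \<alpha>] in \<open>auto simp: divide_less_eq\<close>)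
  have "(\<lambda>k. u (Suc k) / u k) \<longlonglongrightarrow> 0"
  proof (rule tendsto_sandwich[OF _ _ tendsto_const lim])
    show "eventually (\<lambda>k. u (Suc k) / u k \<le> 2 * 2 powr (1 + \<alpha>) * (e k powr \<alpha> * real (n k) powr 1)) sequentially"
      using eventually_ge_at_top[of 1]
    proof eventually_elim
      case (elim k)
      have "u (Suc k) / u k \<le> 2 * (2 * e k) powr (1 + \<alpha>) / u k"
        using quotient_Suc_le[OF elim] u_pos[of k] by (intro divide_right_mono) (auto simp: u_def less_imp_le)
      also have "\<dots> = 2 * 2 powr (1 + \<alpha>) * (e k powr \<alpha> * real (n k) powr 1)"
        using e_pos[of k] n_pos[of k] by (simp add: u_def powr_mult powr_add field_simps)
      finally show ?case .
    qed
  qed (use u_pos in \<open>auto simp: less_imp_le\<close>)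
  hence "(\<lambda>k. (u (Suc k) / u k) powr (\<tau> / (1 + \<tau>))) \<longlonglongrightarrow> 0"
    by (rule tendsto_0_powr) (use u_pos \<tau>_pos in \<open>auto simp: less_imp_le\<close>)
  moreover have "(u (Suc k) / u k) powr (\<tau> / (1 + \<tau>)) = r (Suc k) / r k" for k
    unfolding r_def crit_radius_def u_def[symmetric]
    using u_pos[of k] u_pos[of "Suc k"] by (simp add: powr_divide)
  ultimately show ?thesis by simp
qed

lemma r_halves: "eventually (\<lambda>k. 2 * r (Suc k) \<le> r k) sequentially"
proof -
  have "eventually (\<lambda>k. r (Suc k) / r k < 1 / 2) sequentially"
    by (rule order_tendstoD(2)[OF r_ratio_lim]) simp
  thus ?thesis by eventually_elim (use r_pos in \<open>simp add: field_simps\<close>)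
qed

lemma ln_inverse_r: "ln (1 / r k) = \<tau> / (1 + \<tau>) * ln (real (n k) / e k)"
proof -
  have "real (n k) > 0" "e k > 0" using n_pos[of k] e_pos[of k] by auto
  thus ?thesis by (simp add: r_def crit_radius_def ln_div ln_powr right_diff_distrib)
qed

text \<open>From n (k+1) \<ge> n k powr \<alpha> / 4, ln n is multiplied by \<alpha> up to an
  additive constant; the smaller factor (1 + \<alpha>) / 2 > 1 absorbs the constant. So ln (1 / r k)
  grows geometrically and outruns k. The summand 1 in \<open>x\<close> keeps it positive when n is
  1.\<close>

lemma r_slow: "(\<lambda>k. real k / ln (1 / r k)) \<longlonglongrightarrow> 0"
proof -
  define x where "x k = ln (real (n k)) + 1" for k
  have x1: "x k \<ge> 1" for k using n_pos[of k] by (simp add: x_def)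
  define h where "h = 2 / (1 + \<alpha>)"
  have h: "0 < h" "h < 1" using \<alpha> by (auto simp: h_def)
  have "filterlim x at_top sequentially"
    unfolding x_def using filterlim_compose[OF ln_at_top n_at_top]
    by (rule filterlim_tendsto_add_at_top[OF tendsto_const, of _ _ 1, simplified add.commute[of 1]])
  hence "eventually (\<lambda>k. x k \<ge> 2 * (\<alpha> + ln 4) / (\<alpha> - 1)) sequentially"
    unfolding filterlim_at_top by (rule spec)
  hence "eventually (\<lambda>k. 1 / x (Suc k) \<le> h * (1 / x k)) sequentially"
    using eventually_ge_at_top[of 1]
  proof eventually_elim
    case (elim k)
    have "real (n k) powr \<alpha> \<le> 4 * real (n (Suc k))"
    proof -
      have "real (n k) powr \<alpha> * (1 / real (n (Suc k))) \<le> real (n k) powr \<alpha> * (2 * e k)"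
        using inverse_n_Suc_le[OF elim(2)] by (intro mult_left_mono) auto
      also have "\<dots> \<le> 4" using n_e_less[of k] \<beta> by linarith
      finally show ?thesis using n_pos[of "Suc k"] by (simp add: field_simps)
    qed
    hence "ln (real (n k) powr \<alpha>) \<le> ln (4 * real (n (Suc k)))"
      using n_pos[of k] n_pos[of "Suc k"] by (subst ln_le_cancel_iff) auto
    hence "\<alpha> * ln (real (n k)) \<le> ln 4 + ln (real (n (Suc k)))"
      using n_pos[of k] n_pos[of "Suc k"] by (simp add: ln_powr ln_mult)
    hence "\<alpha> * (x k - 1) - ln 4 \<le> x (Suc k)" by (simp add: x_def)
    moreover have "2 * (\<alpha> + ln 4) \<le> x k * (\<alpha> - 1)" using elim(1) \<alpha> by (simp add: field_simps)
    ultimately have "(1 + \<alpha>) * x k \<le> 2 * x (Suc k)" by (simp add: algebra_simps)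
    hence "2 / (2 * x (Suc k)) \<le> 2 / ((1 + \<alpha>) * x k)"
      using x1[of k] x1[of "Suc k"] \<alpha> by (intro divide_left_mono) auto
    thus ?case by (simp add: h_def)
  qed
  then obtain B where B: "B > 0" "eventually (\<lambda>k. 1 / x k \<le> B * h ^ k) sequentially"
    using eventually_le_geometric[of "\<lambda>k. 1 / x k" h] h x1 by (metis less_le_trans zero_less_divide_1_iff zero_less_one)
  define c where "c = \<tau> / (1 + \<tau>) * ln 2"
  have c: "c > 0" using \<tau>_pos by (simp add: c_def)
  have ln_r: "c * x k \<le> ln (1 / r k)" for k
  proof -
    have n0: "real (n k) > 0" "real (n k) \<ge> 1" using n_pos[of k] by auto
    have "ln 2 * x k \<le> ln (2 * real (n k))"
    proof -
      have "ln 2 * ln (real (n k)) \<le> 1 * ln (real (n k))"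
        using n0 ln_2_less_1 by (intro mult_right_mono) auto
      thus ?thesis using n0 by (simp add: x_def ln_mult algebra_simps)
    qed
    also have "\<dots> \<le> ln (real (n k) / e k)"
      using n0 e_pos[of k] e_le_half[of k] by (subst ln_le_cancel_iff) (auto simp: field_simps)
    finally have "\<tau> / (1 + \<tau>) * (ln 2 * x k) \<le> \<tau> / (1 + \<tau>) * ln (real (n k) / e k)"
      using \<tau>_pos by (intro mult_left_mono) auto
    thus ?thesis by (simp add: ln_inverse_r c_def)
  qed
  have "(\<lambda>k. real k * h ^ k) \<longlonglongrightarrow> 0"
    using powser_times_n_limit_0[of h] h by simp
  hence lim: "(\<lambda>k. B / c * (real k * h ^ k)) \<longlonglongrightarrow> 0" by (rule tendsto_mult_right_zero)
  show ?thesis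
  proof (rule tendsto_sandwich[OF _ _ tendsto_const lim])
    show "eventually (\<lambda>k. real k / ln (1 / r k) \<le> B / c * (real k * h ^ k)) sequentially"
      using B(2)
    proof eventually_elim
      case (elim k)
      have cx: "c * x k > 0" using c x1[of k] by simp
      have "real k / ln (1 / r k) \<le> real k / (c * x k)"
        using ln_r[of k] cx by (intro divide_left_mono) auto
      also have "\<dots> = real k / c * (1 / x k)" by simp
      also have "\<dots> \<le> real k / c * (B * h ^ k)" using elim c by (intro mult_left_mono) auto
      finally show ?case by (simp add: mult_ac)
    qed
    have "0 \<le> real k / ln (1 / r k)" for k
    proof -
      have "0 < c * x k" using c x1[of k] by simp
      thus ?thesis using ln_r[of k] by (intro divide_nonneg_nonneg) auto
    qed
    thus "eventually (\<lambda>k. 0 \<le> real k / ln (1 / r k)) sequentially" by simp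
  qed
qed

lemma r_lim: "r \<longlonglongrightarrow> 0"
proof -
  have "(\<lambda>k. e k powr (\<tau> / (1 + \<tau>))) \<longlonglongrightarrow> 0"
    by (rule tendsto_0_powr[OF e_lim]) (use e_pos \<tau>_pos in \<open>auto simp: less_imp_le\<close>)
  moreover have "r k \<le> e k powr (\<tau> / (1 + \<tau>))" for k
    unfolding r_def crit_radius_def using n_pos[of k] e_pos[of k] \<tau>_pos
    by (intro powr_mono2) (auto simp: field_simps)
  ultimately show ?thesis
    by (intro tendsto_sandwich[of "\<lambda>_. 0" r sequentially "\<lambda>k. e k powr (\<tau> / (1 + \<tau>))" 0])
      (use r_pos in \<open>auto simp: less_imp_le\<close>)
qed

lemma Q_powr: "Q k powr (- \<tau>) = r k"
  unfolding Q_def r_def using n_pos[of k] e_pos[of k] by (intro crit_time_powr) auto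

lemma Q_mult: "Q k * e k = r k * real (n k)"
  unfolding Q_def r_def using n_pos[of k] e_pos[of k] \<tau>_pos by (intro crit_time_mult) auto

lemma Q_at_top: "filterlim Q at_top sequentially"
proof -
  have "eventually (\<lambda>k. Z \<le> Q k) sequentially" for Z
  proof -
    have "eventually (\<lambda>k. r k < max 1 Z powr (- \<tau>)) sequentially"
      by (rule order_tendstoD(2)[OF r_lim]) simp
    thus ?thesis
    proof eventually_elim
      case (elim k)
      show ?case
      proof (rule ccontr)
        assume "\<not> Z \<le> Q k"
        hence "max 1 Z powr (- \<tau>) < Q k powr (- \<tau>)"
          using Q_pos[of k] \<tau>_pos by (intro powr_less_mono2_neg) auto
        thus False using elim by (simp add: Q_powr)
      qed
    qed
  qed
  thus ?thesis by (simp add: filterlim_at_top)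
qed

lemma Q_ratio_lim: "(\<lambda>k. Q k / Q (Suc k)) \<longlonglongrightarrow> 0"
proof -
  have "(\<lambda>k. (r (Suc k) / r k) powr (1 / \<tau>)) \<longlonglongrightarrow> 0"
    by (rule tendsto_0_powr[OF r_ratio_lim]) (use r_pos \<tau>_pos in \<open>auto simp: less_imp_le\<close>)
  moreover have "Q k = r k powr (- (1 / \<tau>))" for k
    unfolding Q_def r_def using n_pos[of k] e_pos[of k] \<tau>_pos by (intro crit_time_eq) auto
  ultimately show ?thesis using r_pos by (simp add: powr_divide powr_minus field_simps)
qed

lemma signed_error:
  obtains \<sigma> :: "nat \<Rightarrow> real" and c :: "nat \<Rightarrow> int"
  where "\<And>k. \<sigma> k = 1 \<or> \<sigma> k = -1" "\<And>k. real (n k) * \<theta> - of_int (c k) = \<sigma> k * e k"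
proof
  fix k
  define x where "x = real (n k) * \<theta> - of_int (round (real (n k) * \<theta>))"
  show "(if x \<ge> 0 then 1 else - 1) = 1 \<or> (if x \<ge> 0 then 1 else - 1) = (- 1 :: real)" by simp
  show "real (n k) * \<theta> - of_int (round (real (n k) * \<theta>)) = (if x \<ge> 0 then 1 else - 1) * e k"
    by (simp add: e_def dint_def x_def)
qed

lemma short_orbit_separated:
  assumes k: "k \<ge> 1" and "1 \<le> a" "a \<le> n k" "1 \<le> b" "b \<le> n k"
    and "real a * \<theta> + of_int i \<noteq> real b * \<theta> + of_int j"
  shows "1 / (2 * real (n k)) \<le> \<bar>(real a * \<theta> + of_int i) - (real b * \<theta> + of_int j)\<bar>"
proof -
  obtain m where m: "idx k = Suc m" using idx(1)[OF k] by (cases "idx k") auto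
  have nk: "n k = q (Suc m)" using idx(2)[OF k] m by simp
  show ?thesis
  proof (rule orbit_separated)
    show "n k \<le> q (Suc m)" by (simp add: nk)
    show "1 / (2 * real (n k)) \<le> D m" unfolding nk by (rule D_ge)
    show "1 / (2 * real (n k)) \<le> 1" using n_pos[of k] by (simp add: field_simps)
  qed (use assms in auto)
qed

lemma U_set_near:
  assumes "y \<in> U_set \<tau> \<theta>"
  shows "eventually (\<lambda>k. \<exists>(a::nat) (j::int). 1 \<le> a \<and> a \<le> n k \<and>
    \<bar>y - (real a * \<theta> + of_int j)\<bar> \<le> 2 * r k) sequentially"
proof -
  obtain Q0 where Q0: "\<forall>n::nat. n \<ge> 1 \<longrightarrow> crit_time \<tau> (real n) (dint (real n * \<theta>)) \<ge> Q0 \<longrightarrow>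
    (\<exists>(a::nat) (j::int). 1 \<le> a \<and> a \<le> n \<and>
      \<bar>y - (real a * \<theta> + of_int j)\<bar> \<le> 2 * crit_radius \<tau> (real n) (dint (real n * \<theta>)))"
    using U_set_near_orbit[OF assms \<tau>_pos] by blast
  have "eventually (\<lambda>k. Q k \<ge> Q0) sequentially"
    using Q_at_top unfolding filterlim_at_top by (rule spec)
  thus ?thesis
  proof eventually_elim
    case (elim k)
    thus ?case using Q0[rule_format, of "n k"] n_pos[of k] by (simp add: Q_def r_def e_def)
  qed
qed

end

section \<open>Exponents below one\<close>

text \<open>Targets spaced 2 / N have disjoint neighbourhoods of radius 1 / N, so density yields a
  separate point for each of them.\<close>

lemma dense_many_points:
  fixes A :: "real set"
  assumes dense: "\<And>y. \<exists>p\<in>A. \<bar>p - y\<bar> < 1 / N" and N: "N > 0"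
  shows "\<exists>F\<subseteq>A. finite F \<and> card F = nat \<lfloor>h * N\<rfloor> \<and> (\<forall>p\<in>F. \<bar>p - c\<bar> \<le> h)"
proof -
  define L where "L = nat \<lfloor>h * N\<rfloor>"
  obtain p where p: "\<And>y. p y \<in> A" "\<And>y. \<bar>p y - y\<bar> < 1 / N" using dense by metis
  define f where "f i = p (c - h + (2 * real i + 1) / N)" for i
  have f: "\<bar>f i - (c - h + (2 * real i + 1) / N)\<bar> < 1 / N" for i unfolding f_def by (rule p)
  have less: "f i < f j" if "i < j" for i j
  proof -
    have "(2 * real i + 1) / N + 2 / N \<le> (2 * real j + 1) / N"
      using that N by (simp add: add_divide_distrib[symmetric] divide_right_mono)
    moreover have "2 / N = 1 / N + 1 / N" by simp
    ultimately show ?thesis using f[of i] f[of j] by linarith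
  qed
  have "inj f" by (rule linorder_injI) (use less less_imp_neq in blast)
  hence "card (f ` {..<L}) = L" by (simp add: card_image inj_on_subset)
  moreover have "\<bar>f i - c\<bar> \<le> h" if "i < L" for i
  proof -
    have "real i + 1 \<le> real L" using that by linarith
    also have "\<dots> \<le> h * N" using that unfolding L_def by linarith
    finally have "(2 * real i + 2) / N \<le> 2 * h" using N by (simp add: field_simps)
    moreover have "(2 * real i + 2) / N = (2 * real i + 1) / N + 1 / N" by (simp add: add_divide_distrib)
    moreover have "1 / N \<le> (2 * real i + 1) / N" using N by (intro divide_right_mono) auto
    ultimately show ?thesis using f[of i] by linarith
  qed
  ultimately show ?thesis
    by (intro exI[of _ "f ` {..<L}"]) (auto simp: L_def f_def p)
qed

text \<open>The orbit up to q m is 1 / q m-dense, and 1 / q m \<le> D m powr \<tau> < X powr (-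
  \<tau>) because D m < 1 / q (m+1) < 1 / X.\<close>

lemma (in irrational_unit) dense_cover:
  assumes \<tau>: "\<tau> > 0" and X: "real (q m) \<le> X" "X < real (q (Suc m))" and D: "1 \<le> real (q m) * D m powr \<tau>"
  shows "\<exists>a::nat. 1 \<le> a \<and> real a \<le> X \<and> dint (real a * \<theta> - y) < X powr (- \<tau>)"
proof -
  have X0: "X > 0" using X(1) q_pos[of m] by linarith
  obtain a i where a: "1 \<le> a" "a \<le> q m" "\<bar>real a * \<theta> + of_int i - y\<bar> < 1 / real (q m)"
    using orbit_dense[of m y] by blast
  have "D m < 1 / X"
  proof -
    have "D m < 1 / real (q (Suc m))" by (rule D_less)
    also have "\<dots> < 1 / X" using X X0 by (intro divide_strict_left_mono) auto
    finally show ?thesis .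
  qed
  hence "D m powr \<tau> < (1 / X) powr \<tau>" using D_pos[of m] \<tau> by (intro powr_less_mono2) auto
  moreover have "1 / real (q m) \<le> D m powr \<tau>" using D q_pos[of m] by (simp add: field_simps)
  ultimately have "1 / real (q m) < X powr (- \<tau>)" using X0 by (simp add: powr_divide powr_minus_divide)
  moreover have "dint (real a * \<theta> - y) \<le> \<bar>real a * \<theta> - y - of_int (- i)\<bar>" by (rule dint_le)
  ultimately have "dint (real a * \<theta> - y) < X powr (- \<tau>)" using a(3) by (simp add: algebra_simps)
  thus ?thesis using a X by (intro exI[of _ a]) auto
qed

lemma (in irrational_unit) q_inj: "i \<ge> 1 \<Longrightarrow> j \<ge> 1 \<Longrightarrow> q i = q j \<Longrightarrow> i = j"
proof -
  have *: "q i < q j" if "1 \<le> i" "i < j" for i j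
    using q_strict_Suc[of i] q_mono[of "Suc i" j] that by linarith
  assume "i \<ge> 1" "j \<ge> 1" "q i = q j"
  thus "i = j" using *[of i j] *[of j i] by (cases i j rule: linorder_cases) auto
qed

theorem (in approx_seq) hausdorff_dim_U_set_less_1:
  assumes \<tau>1: "\<tau> < 1" and \<alpha>_eq: "\<alpha> = 1 / \<tau>" and \<beta>_eq: "\<beta> = 1"
  shows "hausdorff_dim (U_set \<tau> \<theta>) = Liminf sequentially (\<lambda>k. ereal
    (ln (real (n k) powr (1 / \<tau> + 1) * (\<Prod>j<k. real (n j) powr (1 / \<tau>) * e j)) / ln (real (n k) / e k)))"
proof -
  define t where "t = \<tau> / (1 + \<tau>)"
  have t: "0 < t" "t / \<tau> = 1 - t" "t * (1 / \<tau> + 1) = 1"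
  proof -
    have "\<tau> + \<tau> * \<tau> > 0" using \<tau>_pos by (simp add: add_pos_pos)
    thus "0 < t" "t / \<tau> = 1 - t" "t * (1 / \<tau> + 1) = 1"
      using \<tau>_pos by (auto simp: t_def field_simps)
  qed
  have n0: "real (n k) > 0" for k using n_pos[of k] by simp
  \<comment> \<open>By \<open>e_n_lim\<close> this amounts to \<tau> * \<tau> < 1. Clusters are so
    dense at scale r that they act as intervals.\<close>
  have er_lim: "(\<lambda>k. e k / r k) \<longlonglongrightarrow> 0"
  proof -
    have "\<tau> * \<tau> < 1 * 1" using \<tau>1 \<tau>_pos by (intro mult_strict_mono) auto
    hence "\<tau> * \<tau> / (1 + \<tau>) < 1 / (1 + \<tau>)" using \<tau>_pos by (intro divide_strict_right_mono) auto
    hence "\<tau> / (1 + \<tau>) / \<alpha> < 1 / (1 + \<tau>)" by (simp add: \<alpha>_eq mult.commute)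
    hence "(\<lambda>k. e k powr (1 / (1 + \<tau>)) * real (n k) powr (\<tau> / (1 + \<tau>))) \<longlonglongrightarrow> 0"
      using \<tau>_pos by (intro e_n_lim) auto
    thus ?thesis unfolding r_def using quotient_crit_radius[OF n0 e_pos \<tau>_pos] by simp
  qed
  have er_small: "eventually (\<lambda>k. e k \<le> c * r k) sequentially" if "c > 0" for c
  proof -
    have "eventually (\<lambda>k. e k / r k < c) sequentially"
      by (rule order_tendstoD(2)[OF er_lim that])
    thus ?thesis by eventually_elim (use r_pos in \<open>simp add: field_simps\<close>)
  qed
  have small: "eventually (\<lambda>k. e k \<le> 1 / 2 * r k) sequentially" "eventually (\<lambda>k. e k \<le> 1 / 64 * r k) sequentially"
    "eventually (\<lambda>k. e k \<le> 3 / 4 * r k) sequentially"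
    by (rule er_small, simp)+
  \<comment> \<open>The test for S raised to the power t is exactly this bound; it makes balls of
    radius r / 8 about points 1 / (2 * n) apart disjoint.\<close>
  have rn: "r k * real (n k) < 1" for k
  proof -
    have "r k * real (n k) = (real (n k) powr \<alpha> * e k) powr t"
    proof -
      have "r k * real (n k) = e k powr t * (real (n k) powr (- t) * real (n k) powr 1)"
        unfolding r_def crit_radius_split[OF n0 e_pos] t_def using n0 by simp
      also have "real (n k) powr (- t) * real (n k) powr 1 = real (n k) powr (\<alpha> * t)"
        unfolding powr_add[symmetric] using t by (simp add: \<alpha>_eq)
      finally show ?thesis using e_pos[of k] n0[of k] by (simp add: powr_mult powr_powr)
    qed
    also have "\<dots> < 1 powr t"
      using n_e_less[of k] n0[of k] e_pos[of k] t by (intro powr_less_mono2) (auto simp: \<beta>_eq)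
    finally show ?thesis by simp
  qed
  obtain \<sigma> c where \<sigma>: "\<And>k. \<sigma> k = 1 \<or> \<sigma> k = -1" "\<And>k. real (n k) * \<theta> - of_int (c k) = \<sigma> k * e k"
    using signed_error by blast
  define P where "P k = {real a * \<theta> + of_int j | (a::nat) (j::int). 1 \<le> a \<and> a \<le> n k}" for k
  \<comment> \<open>The ball of radius r / 8 about a shifted point consists of the points at
    distance 0 to r / 4 from the orbit point, in the direction \<sigma> of the growing
    cluster.\<close>
  define P' where "P' k = (\<lambda>x. x + \<sigma> k * (r k / 8)) ` P k" for k
  have sep: "1 / 2 * (1 / real (n k)) \<le> \<bar>x - y\<bar>" if "k \<ge> 1" "x \<in> P k" "y \<in> P k" "x \<noteq> y" for k x y
    using that short_orbit_separated[OF that(1)] by (auto simp: P_def)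
  have dense: "\<exists>p\<in>P' k. \<bar>p - y\<bar> < 1 / real (n k)" if k: "k \<ge> 1" for k y
  proof -
    obtain a i where a: "1 \<le> a" "a \<le> q (idx k)"
      "\<bar>real a * \<theta> + of_int i - (y - \<sigma> k * (r k / 8))\<bar> < 1 / real (q (idx k))"
      using orbit_dense[of "idx k" "y - \<sigma> k * (r k / 8)"] by blast
    have "real a * \<theta> + of_int i + \<sigma> k * (r k / 8) \<in> P' k"
      using a idx(2)[OF k] by (auto simp: P'_def P_def)
    thus ?thesis using a(3) idx(2)[OF k] by (intro bexI) (simp_all add: algebra_simps)
  qed
  \<comment> \<open>The free constant A of the Cantor theorem is taken as n 0, so that the quotient
    agrees with the claimed one for every k.\<close>
  have "hausdorff_dim (U_set \<tau> \<theta>) = Liminf sequentially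
    (\<lambda>k. ereal (ln (real (n 0) * (\<Prod>i<k. r i / (1 / real (n (Suc i))))) / ln (1 / r k)))"
  proof (rule hausdorff_dim_cantor[where P = P and P' = P' and ?c0.0 = "1 / 2" and ?c1.0 = 1 and C = 2
        and \<kappa> = "1 / 8" and b = "1 / 32"])
    show "r k > 0" for k by (rule r_pos)
    show "1 / real (n k) > 0" for k using n0 by simp
    show "r \<longlonglongrightarrow> 0" by (rule r_lim)
    show "(\<lambda>k. real k / ln (1 / r k)) \<longlonglongrightarrow> 0" by (rule r_slow)
    show "eventually (\<lambda>k. 2 * r (Suc k) \<le> r k) sequentially" by (rule r_halves)
    show "real (n 0) > 0" by (rule n0)
    show "eventually (\<lambda>k. 1 * (1 / real (n (Suc k))) \<le> r k) sequentially"
      using small(1) eventually_ge_at_top[of 1]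
    proof eventually_elim
      case (elim k)
      thus ?case using inverse_n_Suc_le[of k] by simp
    qed
    show "eventually (\<lambda>k. 2 * (1 / 8) * r k < 1 / 2 * (1 / real (n k))) sequentially"
    proof (rule always_eventually, rule allI)
      fix k
      show "2 * (1 / 8) * r k < 1 / 2 * (1 / real (n k))"
        using rn[of k] n0[of k] r_pos[of k] by (simp add: field_simps)
    qed
    show "U_set \<tau> \<theta> \<subseteq> {0..<1}" by (auto simp: U_set_def)
    show "eventually (\<lambda>k. \<forall>x\<in>P k. \<forall>y\<in>P k. x \<noteq> y \<longrightarrow> 1 / 2 * (1 / real (n k)) \<le> \<bar>x - y\<bar>) sequentially"
      using eventually_ge_at_top[of 1] by eventually_elim (use sep in blast)
    show "eventually (\<lambda>k. \<forall>x\<in>P' k. \<forall>y\<in>P' k. x \<noteq> y \<longrightarrow> 1 / 2 * (1 / real (n k)) \<le> \<bar>x - y\<bar>) sequentially"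
      using eventually_ge_at_top[of 1]
    proof eventually_elim
      case (elim k)
      thus ?case using sep[OF elim] unfolding P'_def by auto
    qed
    show "eventually (\<lambda>k. \<exists>x\<in>P k. \<bar>y - x\<bar> \<le> 2 * r k) sequentially" if "y \<in> U_set \<tau> \<theta>" for y
      using U_set_near[OF that]
    proof eventually_elim
      case (elim k)
      then obtain a :: nat and j :: int where "1 \<le> a" "a \<le> n k"
        "\<bar>y - (real a * \<theta> + of_int j)\<bar> \<le> 2 * r k" by blast
      moreover from this have "real a * \<theta> + of_int j \<in> P k" by (auto simp: P_def)
      ultimately show ?case by blast
    qed
    show "eventually (\<lambda>k. \<forall>z\<in>P' k. \<exists>F\<subseteq>P' (Suc k). finite F \<and>
        1 / 32 * r k / (1 / real (n (Suc k))) \<le> real (card F) \<and>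
        (\<forall>c'\<in>F. \<bar>c' - z\<bar> \<le> 1 / 8 * (r k - r (Suc k)))) sequentially"
      using small(2) r_halves eventually_ge_at_top[of 1]
    proof eventually_elim
      case (elim k)
      \<comment> \<open>Halving radii give h \<ge> r / 16, and since r / 16 * N \<ge> 2, rounding
        down costs at most another factor 2; hence b = 1/32.\<close>
      define h where "h = 1 / 8 * (r k - r (Suc k))"
      define N where "N = real (n (Suc k))"
      have N: "N > 0" using n0 by (simp add: N_def)
      have "h \<ge> r k / 16" using elim(2) by (simp add: h_def)
      hence hN: "h * N \<ge> r k / 16 * N" using N by (intro mult_right_mono) auto
      have "1 / N \<le> r k / 32" using inverse_n_Suc_le[OF elim(3)] elim(1) by (simp add: N_def)
      hence "r k / 16 * N \<ge> 2" using N by (simp add: field_simps)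
      hence "real (nat \<lfloor>h * N\<rfloor>) \<ge> r k / 32 * N" using hN by linarith
      moreover have "\<exists>p\<in>P' (Suc k). \<bar>p - y\<bar> < 1 / N" for y
        using dense[of "Suc k" y] by (simp add: N_def)
      ultimately show ?case
        using dense_many_points[of "P' (Suc k)" N h] N unfolding h_def[symmetric] N_def[symmetric]
        by (metis (no_types, lifting) divide_divide_eq_right div_by_1 mult.commute mult_1 times_divide_eq_left)
    qed
    \<comment> \<open>Of the available time Q k, at most 3/4 goes to the first index of a cluster
      and 1/4 to moving along it.\<close>
    have nQ: "eventually (\<lambda>k. real (n k) \<le> 3 / 4 * Q k) sequentially"
      using small(3)
    proof eventually_elim
      case (elim k)
      have "e k * real (n k) \<le> 3 / 4 * r k * real (n k)" using elim n0[of k] by (intro mult_right_mono) auto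
      also have "\<dots> = 3 / 4 * Q k * e k" using Q_mult[of k] by simp
      finally show ?case using e_pos[of k] by (simp add: mult.commute)
    qed
    show "eventually (\<lambda>K. \<forall>y\<in>{0..<1}. (\<forall>k\<ge>K. \<exists>c\<in>P' k. \<bar>y - c\<bar> \<le> 1 / 8 * r k) \<longrightarrow> y \<in> U_set \<tau> \<theta>) sequentially"
      using eventually_all_ge_at_top[OF nQ] eventually_ge_at_top[of 1]
    proof eventually_elim
      case (elim K)
      show ?case
      proof (intro ballI impI)
        fix y :: real
        assume y: "y \<in> {0..<1}" and near: "\<forall>k\<ge>K. \<exists>c\<in>P' k. \<bar>y - c\<bar> \<le> 1 / 8 * r k"
        have "\<exists>N::nat. 1 \<le> N \<and> real N \<le> X \<and> dint (real N * \<theta> - y) < X powr (- \<tau>)" if X: "X \<ge> real (n K)" for X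
        proof -
          have X1: "X \<ge> 1" using X n_pos[of K] by linarith
          obtain m where m: "real (q m) \<le> X" "X < real (q (Suc m))" using q_bracket[OF X1] .
          have "q (idx K) < q (Suc m)" using X m(2) idx(2)[OF elim(2)] by simp
          hence Km: "idx K \<le> m" by (rule q_less_imp)
          hence m1: "m \<ge> 1" using idx(1)[OF elim(2)] by linarith
          show ?thesis
          proof (cases "q m \<in> S")
            case False
            hence "1 \<le> real (q m) powr (1 / \<tau>) * D m"
              using dint_q[OF m1] by (auto simp: in_S_iff \<alpha>_eq \<beta>_eq not_less)
            hence "1 powr \<tau> \<le> (real (q m) powr (1 / \<tau>) * D m) powr \<tau>"
              using \<tau>_pos by (intro powr_mono2) auto
            hence "1 \<le> real (q m) * D m powr \<tau>"
              using \<tau>_pos D_pos[of m] q_pos[of m] by (simp add: powr_mult powr_powr)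
            thus ?thesis by (rule dense_cover[OF \<tau>_pos m])
          next
            case True
            then obtain k where k: "q m = n k" using enumerate_Ex[OF S_infinite] unfolding n_def by metis
            have "n K \<le> n k" using q_mono[OF Km] k idx(2)[OF elim(2)] by simp
            hence kK: "K \<le> k" using n_strict_mono by (simp add: strict_mono_less_eq)
            hence k1: "k \<ge> 1" using elim(2) by linarith
            have "idx k = m" using q_inj[of "idx k" m] idx[OF k1] m1 k by simp
            hence eD: "e k = D m" using e_eq[OF k1] by simp
            obtain z where z: "z \<in> P' k" "\<bar>y - z\<bar> \<le> 1 / 8 * r k" using near kK by blast
            then obtain a :: nat and j :: int where a: "1 \<le> a" "a \<le> n k"
              "z = real a * \<theta> + of_int j + \<sigma> k * (r k / 8)" by (auto simp: P'_def P_def)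
            define x where "x = \<sigma> k * (y - real a * \<theta> - of_int j)"
            have \<sigma>\<sigma>: "\<sigma> k * (\<sigma> k * w) = w" for w using \<sigma>(1)[of k] by auto
            have yx: "y = real a * \<theta> + of_int j + \<sigma> k * x" by (simp add: x_def \<sigma>\<sigma>)
            have z': "y - z \<le> r k / 8" "z - y \<le> r k / 8" using z(2) by linarith+
            have x: "0 \<le> x" "x \<le> r k / 4"
              using \<sigma>(1)[of k] z' by (auto simp: a(3) x_def)
            \<comment> \<open>Before the critical time the index a itself serves. Afterwards some
              cluster point of index at most Q k lies within e k < 1 / q (m+1) < 1 / X of y, and 1 /
              X \<le> X powr (- \<tau>) because \<tau> < 1.\<close>
            show ?thesis
            proof (cases "X < Q k")
              case True
              have "dint (real a * \<theta> - y) \<le> \<bar>real a * \<theta> - y - of_int (- j)\<bar>" by (rule dint_le)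
              also have "\<dots> = x" using x \<sigma>(1)[of k] by (auto simp: yx)
              also have "\<dots> < r k" using x r_pos[of k] by linarith
              also have "\<dots> = Q k powr (- \<tau>)" by (rule Q_powr[symmetric])
              also have "\<dots> \<le> X powr (- \<tau>)" using True X1 \<tau>_pos by (intro powr_mono2') auto
              finally show ?thesis using a m(1) k by (intro exI[of _ a]) auto
            next
              case False
              define i where "i = nat \<lfloor>x / e k\<rfloor>"
              have xe: "x / e k \<ge> 0" using x e_pos[of k] by simp
              hence i: "real i \<le> x / e k" "x / e k < real i + 1" unfolding i_def by linarith+
              hence ix: "real i * e k \<le> x" "x < real i * e k + e k"
                using e_pos[of k] by (simp_all add: field_simps)
              define N where "N = a + i * n k"
              have "dint (real N * \<theta> - y) \<le> \<bar>real N * \<theta> - y - of_int (int i * c k - j)\<bar>" by (rule dint_le)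
              also have "real N * \<theta> - y - of_int (int i * c k - j)
                  = real i * (real (n k) * \<theta> - of_int (c k)) - \<sigma> k * x"
                by (simp add: N_def yx algebra_simps)
              also have "\<dots> = \<sigma> k * (real i * e k - x)" unfolding \<sigma>(2) by (simp add: algebra_simps)
              also have "\<bar>\<dots>\<bar> = \<bar>real i * e k - x\<bar>" using \<sigma>(1)[of k] by auto
              also have "\<dots> < e k" using ix e_pos[of k] by linarith
              also have "\<dots> < 1 / real (q (Suc m))" unfolding eD by (rule D_less)
              also have "\<dots> \<le> 1 / X" using m X1 by (intro divide_left_mono) auto
              also have "\<dots> = X powr (- 1)" using X1 by (simp add: powr_minus_divide)
              also have "\<dots> \<le> X powr (- \<tau>)" using X1 \<tau>1 by (intro powr_mono) auto
              finally have d: "dint (real N * \<theta> - y) < X powr (- \<tau>)" .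
              have "real i * e k * real (n k) \<le> r k / 4 * real (n k)"
                using ix x n0[of k] by (intro mult_right_mono) auto
              also have "\<dots> = Q k / 4 * e k" using Q_mult[of k] by simp
              finally have "real i * real (n k) \<le> Q k / 4" using e_pos[of k] by (simp add: mult_ac)
              moreover have "real (n k) \<le> 3 / 4 * Q k" using elim(1) kK by blast
              ultimately have "real N \<le> Q k" using a(2) by (simp add: N_def)
              thus ?thesis using d a(1) False by (intro exI[of _ N]) (auto simp: N_def)
            qed
          qed
        qed
        thus "y \<in> U_set \<tau> \<theta>" using y unfolding U_set_def by blast
      qed
    qed
    \<comment> \<open>The construction starts from the orbit point \<theta>, which keeps away from 0
      and 1.\<close>
    have "eventually (\<lambda>k. r k < min \<theta> (1 - \<theta>)) sequentially"
      by (rule order_tendstoD(2)[OF r_lim]) (use \<theta>_pos \<theta>_less_1 in simp)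
    thus "eventually (\<lambda>K. \<exists>c\<in>P' K. {c - 1 / 8 * r K..c + 1 / 8 * r K} \<subseteq> {0..<1}) sequentially"
    proof eventually_elim
      case (elim K)
      have "real 1 * \<theta> + of_int 0 \<in> P K" unfolding P_def using n_pos[of K] by blast
      hence "\<theta> + \<sigma> K * (r K / 8) \<in> P' K" by (simp add: P'_def)
      moreover have "{\<theta> + \<sigma> K * (r K / 8) - 1 / 8 * r K..\<theta> + \<sigma> K * (r K / 8) + 1 / 8 * r K} \<subseteq> {0..<1}"
        using elim r_pos[of K] \<sigma>(1)[of K] by auto
      ultimately show ?case by blast
    qed
  qed auto
  also have "(\<lambda>k. ereal (ln (real (n 0) * (\<Prod>i<k. r i / (1 / real (n (Suc i))))) / ln (1 / r k)))
    = (\<lambda>k. ereal (ln (real (n k) powr (1 / \<tau> + 1) * (\<Prod>j<k. real (n j) powr (1 / \<tau>) * e j)) / ln (real (n k) / e k)))"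
  proof
    fix k
    \<comment> \<open>Since t * (1 / \<tau> + 1) = 1, \<open>X k powr t\<close> is the product of
      the Cantor formula; the factor t cancels against the one in ln (1 / r k).\<close>
    define X where "X k = real (n k) powr (1 / \<tau> + 1) * (\<Prod>j<k. real (n j) powr (1 / \<tau>) * e j)" for k
    have X_pos: "X k > 0" for k
      unfolding X_def using n0 e_pos by (intro mult_pos_pos prod_pos) (auto simp: mult_pos_pos)
    have "real (n 0) * (\<Prod>i<k. r i / (1 / real (n (Suc i)))) = X k powr t"
    proof (induction k)
      case 0
      show ?case using t n0[of 0] by (simp add: X_def powr_powr mult.commute[of "1 / \<tau> + 1"])
    next
      case (Suc k)
      have "X (Suc k) = X k * (real (n (Suc k)) powr (1 / \<tau> + 1) * (e k / real (n k)))"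
        using n0[of k] by (simp add: X_def powr_add)
      hence "X (Suc k) powr t = X k powr t * (real (n (Suc k)) powr (1 / \<tau> + 1)) powr t * (e k / real (n k)) powr t"
        by (simp only: powr_mult mult.assoc)
      also have "(real (n (Suc k)) powr (1 / \<tau> + 1)) powr t = real (n (Suc k))"
        using t n0[of "Suc k"] by (simp add: powr_powr mult.commute[of "1 / \<tau> + 1"])
      also have "(e k / real (n k)) powr t = r k" by (simp add: r_def crit_radius_def t_def)
      finally show ?case using Suc by simp
    qed
    hence "ln (real (n 0) * (\<Prod>i<k. r i / (1 / real (n (Suc i))))) = t * ln (X k)"
      using X_pos[of k] by (simp add: ln_powr)
    moreover have "ln (1 / r k) = t * ln (real (n k) / e k)" unfolding t_def by (rule ln_inverse_r)
    ultimately have "ln (real (n 0) * (\<Prod>i<k. r i / (1 / real (n (Suc i))))) / ln (1 / r k)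
        = ln (X k) / ln (real (n k) / e k)" using t by simp
    thus "ereal (ln (real (n 0) * (\<Prod>i<k. r i / (1 / real (n (Suc i))))) / ln (1 / r k))
      = ereal (ln (real (n k) powr (1 / \<tau> + 1) * (\<Prod>j<k. real (n j) powr (1 / \<tau>) * e j)) / ln (real (n k) / e k))"
      by (simp add: X_def)
  qed
  finally show ?thesis .
qed

section \<open>Exponents above one\<close>

text \<open>Once the covering balls are shorter than half the spacing of the orbit, the index \<open>N\<close>
  approximating \<open>y\<close> can only change at a time \<open>X\<close> in the range of some \<open>q m \<in> S\<close>. Hence it is
  frozen between the successor of \<open>n k\<close> and \<open>n (Suc k)\<close>.\<close>
lemma (in approx_seq) frozen_index:
  assumes \<alpha>_eq: "\<alpha> = \<tau>" and \<beta>_eq: "\<beta> = 2" and k: "k \<ge> 1" and Q0: "Q0 \<le> real (q (Suc (idx k)))"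
    and cover: "\<And>X::real. X \<ge> Q0 \<Longrightarrow> \<exists>N::nat. 1 \<le> N \<and> real N \<le> X \<and> dint (real N * \<theta> - y) < X powr (- \<tau>)"
  shows "\<exists>N::nat. 1 \<le> N \<and> N \<le> q (Suc (idx k)) \<and> dint (real N * \<theta> - y) < real (n (Suc k)) powr (- \<tau>)"
proof -
  define q' where "q' = q (Suc (idx k))"
  have q': "q' \<ge> 1" using q_pos[of "Suc (idx k)"] by (simp add: q'_def)
  \<comment> \<open>Induction over integer times: the index serving at one time also serves at the
    next, up to n (k+1).\<close>
  have "\<exists>N::nat. 1 \<le> N \<and> N \<le> q' \<and> dint (real N * \<theta> - y) < real (q' + i) powr (- \<tau>)"
    if "q' + i \<le> n (Suc k)" for i
    using that
  proof (induction i)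
    case 0
    thus ?case using cover[of "real q'"] Q0 by (auto simp: q'_def)
  next
    case (Suc i)
    define X where "X = q' + i"
    have X: "q' \<le> X" "X < n (Suc k)" "X \<ge> 1" using Suc.prems q' by (auto simp: X_def)
    obtain N where N: "1 \<le> N" "N \<le> q'" "dint (real N * \<theta> - y) < real X powr (- \<tau>)"
      using Suc by (auto simp: X_def)
    have "Q0 \<le> real (Suc X)" using Q0 X(1) by (simp add: q'_def)
    then obtain N' where N': "1 \<le> N'" "real N' \<le> real (Suc X)"
      "dint (real N' * \<theta> - y) < real (Suc X) powr (- \<tau>)" using cover by blast
    \<comment> \<open>A change would give d \<le> X with dint (d * \<theta>) < 2 * X powr (-
      \<tau>), hence q m powr \<tau> * D m < 2. Then q m would be an element of S strictly between n
      k and n (k+1).\<close>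
    have "N' = N"
    proof (rule ccontr)
      assume ne: "N' \<noteq> N"
      define d where "d = (if N' < N then N - N' else N' - N)"
      have d: "1 \<le> d" "d \<le> X" using ne N N' X by (auto simp: d_def)
      have "real (Suc X) powr (- \<tau>) \<le> real X powr (- \<tau>)"
        using X(3) \<tau>_pos by (intro powr_mono2') auto
      hence "dint (real N' * \<theta> - y) < real X powr (- \<tau>)" using N'(3) by linarith
      hence dd: "dint (real d * \<theta>) < 2 * real X powr (- \<tau>)"
        using dint_diff_less[OF N(3)] dint_diff_less[OF _ N(3)]
        by (auto simp: d_def of_nat_diff left_diff_distrib)
      obtain m where m: "real (q m) \<le> real X" "real X < real (q (Suc m))"
        using q_bracket[of "real X"] X(3) by auto
      have "q (Suc (idx k)) < q (Suc m)" using X(1) m(2) by (simp add: q'_def)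
      hence im: "Suc (idx k) \<le> m" by (rule q_less_imp)
      have "D m \<le> dint (real d * \<theta>)" by (rule best_approximation) (use d m in auto)
      hence Dm: "D m < 2 * real X powr (- \<tau>)" using dd by linarith
      have "real (q m) powr \<tau> * D m \<le> real X powr \<tau> * D m"
        using m D_pos[of m] \<tau>_pos by (intro mult_right_mono powr_mono2) auto
      also have "\<dots> < 2" using Dm X(3) by (simp add: powr_minus field_simps)
      finally have "real (q m) powr \<alpha> * dint (real (q m) * \<theta>) < \<beta>"
        using dint_q[of m] im by (simp add: \<alpha>_eq \<beta>_eq)
      hence "q m \<in> S" unfolding in_S_iff by blast
      moreover have "n k < q m"
        using q_strict_Suc[OF idx(1)[OF k]] idx(2)[OF k] q_mono[OF im] by simp
      ultimately have "n (Suc k) \<le> q m" by (rule S_gap)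
      thus False using m X by simp
    qed
    thus ?case using N N' by (intro exI[of _ N]) (auto simp: X_def)
  qed
  from this[of "n (Suc k) - q'"] show ?thesis
    using next_q_le[OF k] by (simp add: q'_def)
qed

theorem (in approx_seq) hausdorff_dim_U_set_greater_1:
  assumes \<alpha>_eq: "\<alpha> = \<tau>" and \<beta>_eq: "\<beta> = 2"
  shows "hausdorff_dim (U_set \<tau> \<theta>) = Liminf sequentially (\<lambda>k. ereal
    (- ln (\<Prod>j<k. real (n j) * e j powr (1 / \<tau>)) / ln (real (n k) / e k)))"
proof -
  have \<tau>1: "\<tau> > 1" using \<alpha> by (simp add: \<alpha>_eq)
  define t where "t = \<tau> / (1 + \<tau>)"
  have t: "0 < t" "1 / \<tau> * t = 1 / (1 + \<tau>)" "(1 + \<tau>) * t = \<tau>"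
    using \<tau>1 by (auto simp: t_def)
  have n0: "real (n k) > 0" for k using n_pos[of k] by simp
  \<comment> \<open>Unlike for \<tau> < 1, the step e may be comparable with r, so a ball may
    contain only a few points of a cluster.\<close>
  have er: "e k \<le> 2 * r k" for k
  proof -
    have "e k / r k = (real (n k) powr \<tau> * e k) powr (1 / (1 + \<tau>))"
      unfolding r_def quotient_crit_radius[OF n0 e_pos \<tau>_pos] by (simp add: powr_mult powr_powr)
    also have "\<dots> \<le> 2 powr (1 / (1 + \<tau>))"
      using n_e_less[of k] e_pos[of k] \<tau>_pos by (intro powr_mono2) (auto simp: \<alpha>_eq \<beta>_eq)
    also have "\<dots> \<le> 2 powr 1" using \<tau>_pos by (intro powr_mono) auto
    finally show ?thesis using r_pos[of k] by (simp add: field_simps)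
  qed
  \<comment> \<open>As 1 / e k is comparable with the denominator following n k, the critical time
    comes long before that denominator.\<close>
  have Qe_lim: "(\<lambda>k. Q k * e k) \<longlonglongrightarrow> 0"
  proof -
    have "1 * 1 < \<tau> * \<tau>" using \<tau>1 by (intro mult_strict_mono) auto
    hence "1 / (1 + \<tau>) < \<tau> * \<tau> / (1 + \<tau>)" using \<tau>1 by (intro divide_strict_right_mono) auto
    hence "1 / (1 + \<tau>) / \<alpha> < t" using \<tau>1 by (simp add: \<alpha>_eq t_def divide_less_eq mult.commute)
    hence "(\<lambda>k. e k powr t * real (n k) powr (1 / (1 + \<tau>))) \<longlonglongrightarrow> 0"
      using \<tau>1 by (intro e_n_lim) auto
    moreover have "Q k * e k = e k powr t * real (n k) powr (1 / (1 + \<tau>))" for k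
    proof -
      have "1 / (1 + \<tau>) = - t + 1" using \<tau>1 by (simp add: t_def field_simps)
      hence "real (n k) powr (1 / (1 + \<tau>)) = real (n k) powr (- t) * real (n k)"
        using n0[of k] by (simp only: powr_add powr_one)
      thus ?thesis unfolding Q_mult r_def crit_radius_split[OF n0 e_pos] t_def by simp
    qed
    ultimately show ?thesis by simp
  qed
  \<comment> \<open>The next radius is negligible against the present spacing: the ratio is at most
    a multiple of e k powr (\<tau> - 1).\<close>
  have re_lim: "(\<lambda>k. r (Suc k) / e k) \<longlonglongrightarrow> 0"
  proof -
    have lim: "(\<lambda>k. 2 powr t * 2 powr \<tau> * e k powr (\<tau> - 1)) \<longlonglongrightarrow> 0"
      by (intro tendsto_mult_right_zero tendsto_0_powr e_lim) (use \<tau>1 e_pos in \<open>auto simp: less_imp_le\<close>)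
    show ?thesis
    proof (rule tendsto_sandwich[OF _ _ tendsto_const lim])
      show "eventually (\<lambda>k. r (Suc k) / e k \<le> 2 powr t * 2 powr \<tau> * e k powr (\<tau> - 1)) sequentially"
        using eventually_ge_at_top[of 1]
      proof eventually_elim
        case (elim k)
        have "r (Suc k) \<le> (2 * (2 * e k) powr (1 + \<tau>)) powr t"
          unfolding r_def crit_radius_def t_def[symmetric]
          using quotient_Suc_le[OF elim] n0[of "Suc k"] e_pos[of "Suc k"] t
          by (intro powr_mono2) (auto simp: \<alpha>_eq)
        also have "\<dots> = 2 powr t * 2 powr \<tau> * e k powr \<tau>"
          using t(3) by (simp add: powr_mult powr_powr)
        finally have "r (Suc k) / e k \<le> 2 powr t * 2 powr \<tau> * e k powr \<tau> / e k"
          using e_pos[of k] by (intro divide_right_mono) auto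
        thus ?case using e_pos[of k] by (simp add: powr_diff)
      qed
    qed (use r_pos e_pos in \<open>auto simp: less_imp_le\<close>)
  qed
  obtain \<sigma> c where \<sigma>: "\<And>k. \<sigma> k = 1 \<or> \<sigma> k = -1" "\<And>k. real (n k) * \<theta> - of_int (c k) = \<sigma> k * e k"
    using signed_error by blast
  \<comment> \<open>Thus \<kappa> * r (k+1) = (2 * Q (k+1)) powr (- \<tau>), the radius required up
    to time 2 * Q (k+1).\<close>
  define \<kappa> where "\<kappa> = 2 powr (- \<tau>)"
  have \<kappa>: "0 < \<kappa>" "\<kappa> \<le> 1"
    using \<tau>1 powr_mono[of "- \<tau>" 0 "2::real"] by (auto simp: \<kappa>_def)
  \<comment> \<open>\<open>P k\<close> contains every index that \<open>frozen_index\<close> can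
    return and is e k-separated. \<open>P' k\<close> stops at 2 * Q k, the time from which its
    points have to serve.\<close>
  define P where "P k = {real a * \<theta> + of_int j | (a::nat) (j::int). 1 \<le> a \<and> a \<le> q (Suc (idx k))}" for k
  define P' where "P' k = {real a * \<theta> + of_int j | (a::nat) (j::int). 1 \<le> a \<and> real a \<le> 2 * Q k}" for k
  have sep: "1 * e k \<le> \<bar>x - y\<bar>" if k: "k \<ge> 1" and xy: "x \<in> P k" "y \<in> P k" "x \<noteq> y" for k x y
  proof -
    obtain a b :: nat and i j :: int where x: "x = real a * \<theta> + of_int i" "1 \<le> a" "a \<le> q (Suc (idx k))"
      and y: "y = real b * \<theta> + of_int j" "1 \<le> b" "b \<le> q (Suc (idx k))"
      using xy unfolding P_def by blast
    have "e k \<le> 1" using e_le_half[of k] by linarith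
    thus ?thesis
      using orbit_separated[OF x(3) y(3) x(2) y(2) order_refl, of "e k" i j] e_eq[OF k] xy(3) x(1) y(1) by simp
  qed
  have P'_sub: "eventually (\<lambda>k. P' k \<subseteq> P k) sequentially"
  proof -
    have "eventually (\<lambda>k. Q k * e k < 1 / 4) sequentially"
      by (rule order_tendstoD(2)[OF Qe_lim]) simp
    thus ?thesis using eventually_ge_at_top[of 1]
    proof eventually_elim
      case (elim k)
      let ?q = "real (q (Suc (idx k)))"
      have "Q k * (1 / (2 * ?q)) \<le> Q k * e k" using e_ge[OF elim(2)] Q_pos[of k] by (intro mult_left_mono) auto
      hence "Q k * (1 / (2 * ?q)) < 1 / 4" using elim(1) by linarith
      hence "2 * Q k < ?q" using q_pos[of "Suc (idx k)"] by (simp add: field_simps)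
      thus ?case by (auto simp: P_def P'_def)
    qed
  qed
  have sep_ev: "eventually (\<lambda>k. \<forall>x\<in>P k. \<forall>y\<in>P k. x \<noteq> y \<longrightarrow> 1 * e k \<le> \<bar>x - y\<bar>) sequentially"
    using eventually_ge_at_top[of 1] by eventually_elim (use sep in blast)
  \<comment> \<open>The constant r 0 / e 0 restores the factor of index 0 that is lost by pairing r
    (k+1) with e k.\<close>
  have "hausdorff_dim (U_set \<tau> \<theta>) = Liminf sequentially
    (\<lambda>k. ereal (ln (r 0 / e 0 * (\<Prod>i<k. r (Suc i) / e (Suc i))) / ln (1 / r (Suc k))))"
  proof (rule hausdorff_dim_cantor[where P = P and P' = P' and ?c0.0 = 1 and ?c1.0 = "1 / 2" and C = 2
        and \<kappa> = \<kappa> and b = "\<kappa> / 2"])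
    show "r (Suc k) > 0" for k by (rule r_pos)
    show "e k > 0" for k by (rule e_pos)
    show "(\<lambda>k. r (Suc k)) \<longlonglongrightarrow> 0" using r_lim by (rule LIMSEQ_Suc)
    have "(\<lambda>k. real k / real (Suc k) * (real (Suc k) / ln (1 / r (Suc k)))) \<longlonglongrightarrow> 1 * 0"
      by (intro tendsto_mult LIMSEQ_n_over_Suc_n LIMSEQ_Suc[OF r_slow])
    moreover have "real k / real (Suc k) * (real (Suc k) / ln (1 / r (Suc k))) = real k / ln (1 / r (Suc k))" for k
      by simp
    ultimately show "(\<lambda>k. real k / ln (1 / r (Suc k))) \<longlonglongrightarrow> 0" by (simp only: mult_1)
    show halves: "eventually (\<lambda>k. 2 * r (Suc (Suc k)) \<le> r (Suc k)) sequentially"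
      using r_halves by (rule eventually_sequentially_Suc[THEN iffD2])
    show "0 < \<kappa>" "0 < \<kappa> / 2" using \<kappa> by auto
    show "r 0 / e 0 > 0" using r_pos e_pos by simp
    show "eventually (\<lambda>k. 1 / 2 * e (Suc k) \<le> r (Suc k)) sequentially"
      by (rule always_eventually) (use er in \<open>simp add: field_simps\<close>)
    have "eventually (\<lambda>k. r (Suc k) / e k < 1 / 2) sequentially"
      by (rule order_tendstoD(2)[OF re_lim]) simp
    thus "eventually (\<lambda>k. 2 * \<kappa> * r (Suc k) < 1 * e k) sequentially"
    proof eventually_elim
      case (elim k)
      have "\<kappa> * r (Suc k) \<le> 1 * r (Suc k)" using \<kappa> r_pos[of "Suc k"] by (intro mult_right_mono) auto
      moreover have "2 * r (Suc k) < e k" using elim e_pos[of k] by (simp add: field_simps)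
      ultimately show ?case by linarith
    qed
    show "U_set \<tau> \<theta> \<subseteq> {0..<1}" by (auto simp: U_set_def)
    show "eventually (\<lambda>k. \<forall>x\<in>P k. \<forall>y\<in>P k. x \<noteq> y \<longrightarrow> 1 * e k \<le> \<bar>x - y\<bar>) sequentially" by (rule sep_ev)
    show "eventually (\<lambda>k. \<forall>x\<in>P' k. \<forall>y\<in>P' k. x \<noteq> y \<longrightarrow> 1 * e k \<le> \<bar>x - y\<bar>) sequentially"
      using sep_ev P'_sub by eventually_elim blast
    show "eventually (\<lambda>k. \<exists>x\<in>P k. \<bar>y - x\<bar> \<le> 2 * r (Suc k)) sequentially" if y: "y \<in> U_set \<tau> \<theta>" for y
    proof -
      obtain Q0 where Q0: "\<And>X::real. X \<ge> Q0 \<Longrightarrow> \<exists>N::nat. 1 \<le> N \<and> real N \<le> X \<and> dint (real N * \<theta> - y) < X powr (- \<tau>)"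
        using y unfolding U_set_def by blast
      have ev1: "eventually (\<lambda>k. Q0 \<le> real (n k)) sequentially"
        using n_at_top unfolding filterlim_at_top by (rule spec)
      have ev2: "eventually (\<lambda>k. \<exists>(a::nat) (j::int). 1 \<le> a \<and> a \<le> n (Suc k) \<and>
          \<bar>y - (real a * \<theta> + of_int j)\<bar> \<le> 2 * r (Suc k)) sequentially"
        using U_set_near[OF y] by (rule eventually_sequentially_Suc[THEN iffD2])
      have "(\<lambda>k. real (n k) powr (- (\<tau> - 1)) + 2 * (Q k * e k)) \<longlonglongrightarrow> 0 + 2 * 0"
        by (intro tendsto_add tendsto_mult tendsto_const Qe_lim tendsto_neg_powr[OF _ n_at_top]) (use \<tau>1 in simp)
      hence "eventually (\<lambda>k. real (n k) powr (- (\<tau> - 1)) + 2 * (Q k * e k) < 1 / 2) sequentially"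
        by (rule order_tendstoD(2)) simp
      hence "eventually (\<lambda>k. real (n (Suc k)) powr (- (\<tau> - 1)) + 2 * (Q (Suc k) * e (Suc k)) < 1 / 2) sequentially"
        by (rule eventually_sequentially_Suc[THEN iffD2])
      thus ?thesis using ev1 ev2 eventually_ge_at_top[of 1]
      proof eventually_elim
        case (elim k)
        let ?N = "real (n (Suc k))"
        have "Q0 \<le> real (q (Suc (idx k)))"
          using elim(2) idx(2)[OF elim(4)] q_mono_Suc[of "idx k"] by simp
        then obtain N where N: "1 \<le> N" "N \<le> q (Suc (idx k))" "dint (real N * \<theta> - y) < ?N powr (- \<tau>)"
          using frozen_index[OF \<alpha>_eq \<beta>_eq elim(4) _ Q0] by blast
        obtain l :: int where l: "\<bar>real N * \<theta> - y - of_int l\<bar> < ?N powr (- \<tau>)"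
          using N(3) unfolding dint_less_iff by blast
        obtain a :: nat and j :: int where a: "1 \<le> a" "a \<le> n (Suc k)"
          "\<bar>y - (real a * \<theta> + of_int j)\<bar> \<le> 2 * r (Suc k)" using elim(3) by blast
        \<comment> \<open>The critical time yields a small ball but an index up to n (k+1), freezing
          a smaller index range but the radius n (k+1) powr (- \<tau>). Both points belong to an
          orbit with spacing at least 1 / (2 * n (k+1)), which exceeds the sum of the radii, so they
          coincide.\<close>
        have "real a * \<theta> + of_int j = real N * \<theta> + of_int (- l)"
        proof (rule ccontr)
          assume "real a * \<theta> + of_int j \<noteq> real N * \<theta> + of_int (- l)"
          hence "1 / (2 * ?N) \<le> \<bar>(real a * \<theta> + of_int j) - (real N * \<theta> + of_int (- l))\<bar>"
            using a N next_q_le[OF elim(4)] by (intro short_orbit_separated) auto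
          also have "\<dots> < 2 * r (Suc k) + ?N powr (- \<tau>)" using l a(3) by simp
          finally have "1 / (2 * ?N) * ?N < (2 * r (Suc k) + ?N powr (- \<tau>)) * ?N"
            using n0[of "Suc k"] by (intro mult_strict_right_mono) auto
          hence "1 / 2 < 2 * (r (Suc k) * ?N) + ?N powr (- \<tau>) * ?N"
            using n0[of "Suc k"] by (simp add: algebra_simps)
          also have "r (Suc k) * ?N = Q (Suc k) * e (Suc k)" by (rule Q_mult[symmetric])
          also have "?N powr (- \<tau>) * ?N = ?N powr (- (\<tau> - 1))"
            using n0[of "Suc k"] powr_add[of ?N "- \<tau>" 1] by simp
          finally show False using elim(1) by linarith
        qed
        moreover have "real N * \<theta> + of_int (- l) \<in> P k" unfolding P_def using N by blast
        ultimately show ?case using a(3) by (intro bexI[of _ "real N * \<theta> + of_int (- l)"]) auto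
      qed
    qed
    have "eventually (\<lambda>k. Q k / Q (Suc k) < 1 / 2) sequentially"
      by (rule order_tendstoD(2)[OF Q_ratio_lim]) simp
    thus "eventually (\<lambda>k. \<forall>z\<in>P' k. \<exists>F\<subseteq>P' (Suc k). finite F \<and>
        \<kappa> / 2 * r (Suc k) / e (Suc k) \<le> real (card F) \<and>
        (\<forall>c'\<in>F. \<bar>c' - z\<bar> \<le> \<kappa> * (r (Suc k) - r (Suc (Suc k))))) sequentially"
      using halves
    proof eventually_elim
      case (elim k)
      show ?case
      proof
        fix z assume "z \<in> P' k"
        then obtain a :: nat and j :: int where a: "1 \<le> a" "real a \<le> 2 * Q k" "z = real a * \<theta> + of_int j"
          unfolding P'_def by blast
        define h where "h = \<kappa> * (r (Suc k) - r (Suc (Suc k)))"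
        define E N where "E = e (Suc k)" and "N = n (Suc k)"
        have E: "E > 0" unfolding E_def by (rule e_pos)
        \<comment> \<open>The children number L + 1 because z itself is one of them; this matters
          when h < E.\<close>
        define L where "L = nat \<lfloor>h / E\<rfloor>"
        have "\<kappa> * (r (Suc k) / 2) \<le> h" unfolding h_def using elim(2) \<kappa> by (intro mult_left_mono) auto
        hence h: "\<kappa> / 2 * r (Suc k) \<le> h" by simp
        have h0: "h \<ge> 0" using h \<kappa> r_pos[of "Suc k"] by (smt (verit) mult_nonneg_nonneg half_gt_zero)
        have hE: "h / E \<ge> 0" using h0 E by simp
        have L: "real L \<le> h / E" "h / E \<le> real (L + 1)" using hE unfolding L_def by linarith+
        define f where "f i = z + real i * (\<sigma> (Suc k) * E)" for i
        have f_diff: "\<bar>f i - z\<bar> = real i * E" for i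
          using \<sigma>(1)[of "Suc k"] E by (auto simp: f_def abs_mult)
        have "inj f"
        proof (rule injI)
          fix i j assume "f i = f j"
          hence "\<bar>f i - z\<bar> = \<bar>f j - z\<bar>" by simp
          thus "i = j" unfolding f_diff using E by simp
        qed
        hence "card (f ` {..L}) = L + 1" by (simp add: card_image inj_on_subset)
        moreover have "f i \<in> P' (Suc k) \<and> \<bar>f i - z\<bar> \<le> h" if "i \<le> L" for i
        proof
          have "real i * E \<le> real L * E" using that E by (intro mult_right_mono) auto
          also have "\<dots> \<le> h" using L(1) E by (simp add: field_simps)
          finally have iE: "real i * E \<le> h" .
          thus "\<bar>f i - z\<bar> \<le> h" by (simp add: f_diff)
          have "h \<le> 1 * r (Suc k)"
            unfolding h_def using \<kappa> r_pos[of "Suc (Suc k)"] elim(2) by (intro mult_mono) auto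
          hence "real i * E * real N \<le> r (Suc k) * real N" using iE by (intro mult_right_mono) auto
          also have "\<dots> = Q (Suc k) * E" unfolding E_def N_def by (rule Q_mult[symmetric])
          finally have "real i * real N \<le> Q (Suc k)" using E by (simp add: mult_ac)
          \<comment> \<open>New indices are at most 2 * Q k + Q (k+1) \<le> 2 * Q (k+1), which
            explains the factor 2 in \<open>P'\<close>.\<close>
          moreover have "2 * Q k \<le> Q (Suc k)" using elim(1) Q_pos[of "Suc k"] by (simp add: field_simps)
          ultimately have "real (a + i * N) \<le> 2 * Q (Suc k)" using a(2) by simp
          moreover have "f i = real (a + i * N) * \<theta> + of_int (j - int i * c (Suc k))"
            unfolding f_def E_def \<sigma>(2)[symmetric] a(3) N_def by (simp add: algebra_simps)
          moreover have "1 \<le> a + i * N" using a(1) by simp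
          ultimately show "f i \<in> P' (Suc k)" unfolding P'_def by blast
        qed
        moreover have "\<kappa> / 2 * r (Suc k) / E \<le> real (L + 1)"
          using L(2) divide_right_mono[OF h, of E] E by linarith
        ultimately show "\<exists>F\<subseteq>P' (Suc k). finite F \<and> \<kappa> / 2 * r (Suc k) / e (Suc k) \<le> real (card F) \<and>
            (\<forall>c'\<in>F. \<bar>c' - z\<bar> \<le> \<kappa> * (r (Suc k) - r (Suc (Suc k))))"
          unfolding h_def[symmetric] E_def[symmetric] by (intro exI[of _ "f ` {..L}"]) auto
      qed
    qed
    show "eventually (\<lambda>K. \<forall>y\<in>{0..<1}. (\<forall>k\<ge>K. \<exists>c\<in>P' k. \<bar>y - c\<bar> \<le> \<kappa> * r (Suc k)) \<longrightarrow> y \<in> U_set \<tau> \<theta>) sequentially"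
    proof (intro always_eventually allI ballI impI)
      fix K and y :: real
      assume y: "y \<in> {0..<1}" and near: "\<forall>k\<ge>K. \<exists>c\<in>P' k. \<bar>y - c\<bar> \<le> \<kappa> * r (Suc k)"
      \<comment> \<open>The intervals from 2 * Q k to 2 * Q (k+1) exhaust all late times, and on
        each of them the centre of level k serves.\<close>
      have "\<exists>N::nat. 1 \<le> N \<and> real N \<le> X \<and> dint (real N * \<theta> - y) < X powr (- \<tau>)" if X: "X \<ge> 2 * Q K" for X
      proof -
        have "eventually (\<lambda>k. X \<le> Q k) sequentially" using Q_at_top unfolding filterlim_at_top by (rule spec)
        then obtain k0 where "\<And>k. k \<ge> k0 \<Longrightarrow> X \<le> Q k" unfolding eventually_sequentially by blast
        hence "X \<le> Q (K + k0)" by simp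
        hence "X < 2 * Q (K + k0)" using Q_pos[of "K + k0"] by linarith
        hence ex: "\<exists>i. X < 2 * Q (K + i)" by blast
        define i where "i = (LEAST i. X < 2 * Q (K + i))"
        have i: "X < 2 * Q (K + i)" unfolding i_def using ex by (rule LeastI_ex)
        then obtain i' where i': "i = Suc i'" using X by (cases i) auto
        have "\<not> X < 2 * Q (K + i')"
          using not_less_Least[of i' "\<lambda>i. X < 2 * Q (K + i)"] i' unfolding i_def by simp
        then obtain k where k: "k \<ge> K" "2 * Q k \<le> X" "X < 2 * Q (Suc k)"
          using i i' by (intro that[of "K + i'"]) auto
        obtain z where z: "z \<in> P' k" "\<bar>y - z\<bar> \<le> \<kappa> * r (Suc k)" using near k(1) by blast
        then obtain a :: nat and j :: int where a: "1 \<le> a" "real a \<le> 2 * Q k" "z = real a * \<theta> + of_int j"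
          unfolding P'_def by blast
        have X0: "X > 0" using k(2) Q_pos[of k] by linarith
        have "dint (real a * \<theta> - y) \<le> \<bar>real a * \<theta> - y - of_int (- j)\<bar>" by (rule dint_le)
        also have "\<dots> = \<bar>y - z\<bar>" by (simp add: a(3) abs_minus_commute algebra_simps)
        also have "\<dots> \<le> \<kappa> * r (Suc k)" by (rule z(2))
        also have "\<dots> = (2 * Q (Suc k)) powr (- \<tau>)"
          unfolding \<kappa>_def Q_powr[symmetric] by (rule powr_mult[symmetric])
        also have "\<dots> < X powr (- \<tau>)" using k(3) X0 \<tau>_pos by (intro powr_less_mono2_neg) auto
        finally show ?thesis using a k(2) by (intro exI[of _ a]) auto
      qed
      thus "y \<in> U_set \<tau> \<theta>" using y unfolding U_set_def by blast
    qed
    have "eventually (\<lambda>k. r (Suc k) < min \<theta> (1 - \<theta>)) sequentially"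
      by (rule order_tendstoD(2)[OF LIMSEQ_Suc[OF r_lim]]) (use \<theta>_pos \<theta>_less_1 in simp)
    moreover have "eventually (\<lambda>k. 1 \<le> Q k) sequentially"
      using Q_at_top unfolding filterlim_at_top by (rule spec)
    ultimately show "eventually (\<lambda>K. \<exists>c\<in>P' K. {c - \<kappa> * r (Suc K)..c + \<kappa> * r (Suc K)} \<subseteq> {0..<1}) sequentially"
    proof eventually_elim
      case (elim K)
      have "1 \<le> (1::nat) \<and> real 1 \<le> 2 * Q K" using elim(2) by simp
      hence "real 1 * \<theta> + of_int 0 \<in> P' K" unfolding P'_def by blast
      hence "\<theta> \<in> P' K" by simp
      moreover have "\<kappa> * r (Suc K) \<le> 1 * r (Suc K)" using \<kappa> r_pos[of "Suc K"] by (intro mult_right_mono) auto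
      hence "{\<theta> - \<kappa> * r (Suc K)..\<theta> + \<kappa> * r (Suc K)} \<subseteq> {0..<1}" using elim(1) by auto
      ultimately show ?case by blast
    qed
  qed auto
  also have "(\<lambda>k. ereal (ln (r 0 / e 0 * (\<Prod>i<k. r (Suc i) / e (Suc i))) / ln (1 / r (Suc k))))
    = (\<lambda>k. ereal (- ln (\<Prod>j<Suc k. real (n j) * e j powr (1 / \<tau>)) / ln (real (n (Suc k)) / e (Suc k))))"
  proof
    fix k
    define Y where "Y = (\<Prod>j<Suc k. real (n j) * e j powr (1 / \<tau>))"
    have "e j powr (1 / \<tau>) > 0" for j using e_pos[of j] by simp
    hence Y_pos: "Y > 0" unfolding Y_def by (intro prod_pos ballI mult_pos_pos n0)
    have re: "r j / e j = (real (n j) * e j powr (1 / \<tau>)) powr (- t)" for j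
    proof -
      have "e j / r j = (real (n j) * e j powr (1 / \<tau>)) powr t"
        unfolding r_def quotient_crit_radius[OF n0 e_pos \<tau>_pos] powr_mult powr_powr t(2) t_def[symmetric] by simp
      moreover have "r j / e j = inverse (e j / r j)" by simp
      ultimately show ?thesis by (simp only: powr_minus)
    qed
    have "r 0 / e 0 * (\<Prod>i<k. r (Suc i) / e (Suc i)) = (\<Prod>j<Suc k. r j / e j)"
      by (simp only: prod.lessThan_Suc_shift o_def)
    also have "\<dots> = Y powr (- t)" unfolding re Y_def using n0 e_pos
      by (induction k) (simp_all add: powr_mult)
    finally have "ln (r 0 / e 0 * (\<Prod>i<k. r (Suc i) / e (Suc i))) = t * (- ln Y)"
      using Y_pos by (simp add: ln_powr)
    moreover have "ln (1 / r (Suc k)) = t * ln (real (n (Suc k)) / e (Suc k))"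
      unfolding t_def by (rule ln_inverse_r)
    ultimately have "ln (r 0 / e 0 * (\<Prod>i<k. r (Suc i) / e (Suc i))) / ln (1 / r (Suc k))
        = - ln Y / ln (real (n (Suc k)) / e (Suc k))" using t(1) by simp
    thus "ereal (ln (r 0 / e 0 * (\<Prod>i<k. r (Suc i) / e (Suc i))) / ln (1 / r (Suc k)))
      = ereal (- ln (\<Prod>j<Suc k. real (n j) * e j powr (1 / \<tau>)) / ln (real (n (Suc k)) / e (Suc k)))"
      by (simp only: Y_def)
  qed
  also have "Liminf sequentially \<dots> = Liminf sequentially (\<lambda>k. ereal
    (- ln (\<Prod>j<k. real (n j) * e j powr (1 / \<tau>)) / ln (real (n k) / e k)))"
    unfolding Suc_eq_plus1 by (rule liminf_shift)
  finally show ?thesis .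
qed

section \<open>Exponents outside the critical range\<close>

context irrational_unit
begin

text \<open>D m \<ge> c * q m powr (- s) makes q m * D m powr \<tau> at least c powr \<tau> * q m
  powr (1 - s * \<tau>), eventually at least 1; so \<open>dense_cover\<close> applies at all late
  times.\<close>

lemma U_set_full:
  assumes \<tau>: "\<tau> > 0" and s: "s > 0" "s * \<tau> < 1" and w: "irr_exp \<theta> < ereal s"
  shows "U_set \<tau> \<theta> = {0..<1}"
proof -
  obtain c where c: "c > 0" "\<And>j. j \<ge> 1 \<Longrightarrow> dint (real j * \<theta>) \<ge> c * real j powr (- s)"
    using badly_approximable[OF s(1) w] by blast
  define v where "v = 1 - s * \<tau>"
  have v: "v > 0" using s by (simp add: v_def)
  define Z where "Z = c powr (- \<tau> / v)"
  define M where "M = nat \<lceil>Z\<rceil> + 1"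
  have D: "1 \<le> real (q m) * D m powr \<tau>" if m: "m \<ge> M" for m
  proof -
    have q0: "real (q m) > 0" using q_pos[of m] by simp
    have "c * real (q m) powr (- s) \<le> D m"
      using c(2)[of "q m"] q_pos[of m] dint_q_le[of m] by fastforce
    hence "(c * real (q m) powr (- s)) powr \<tau> \<le> D m powr \<tau>"
      using c(1) \<tau> by (intro powr_mono2) auto
    hence "real (q m) * (c powr \<tau> * real (q m) powr (- (s * \<tau>))) \<le> real (q m) * D m powr \<tau>"
      by (intro mult_left_mono) (simp_all add: powr_mult powr_powr)
    moreover have "real (q m) * (c powr \<tau> * real (q m) powr (- (s * \<tau>))) = c powr \<tau> * real (q m) powr v"
      using q0 by (simp add: v_def powr_diff powr_minus field_simps)
    moreover have "c powr \<tau> * Z powr v \<le> c powr \<tau> * real (q m) powr v"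
    proof -
      have "Z \<le> real (q m)" using m q_ge[of m] unfolding M_def by linarith
      thus ?thesis using v by (intro mult_left_mono powr_mono2) (auto simp: Z_def)
    qed
    moreover have "c powr \<tau> * Z powr v = 1"
    proof -
      have "Z powr v = c powr (- \<tau>)" using v by (simp add: Z_def powr_powr)
      thus ?thesis using c(1) by (simp flip: powr_add)
    qed
    ultimately show ?thesis by linarith
  qed
  have "y \<in> U_set \<tau> \<theta>" if y: "y \<in> {0..<1}" for y
  proof -
    have "\<exists>n::nat. 1 \<le> n \<and> real n \<le> X \<and> dint (real n * \<theta> - y) < X powr (- \<tau>)" if X: "X \<ge> real (q M)" for X
    proof -
      have "X \<ge> 1" using X q_pos[of M] by linarith
      then obtain m where m: "real (q m) \<le> X" "X < real (q (Suc m))" using q_bracket by blast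
      have "q M < q (Suc m)" using X m(2) by linarith
      hence "M \<le> m" by (rule q_less_imp)
      thus ?thesis using dense_cover[OF \<tau> m] D by blast
    qed
    thus ?thesis using y unfolding U_set_def by blast
  qed
  thus ?thesis by (auto simp: U_set_def)
qed

lemma orbit_subset_U_set: "{frac (real i * \<theta>) | i. i \<ge> (1::nat)} \<subseteq> U_set \<tau> \<theta>"
proof
  fix y assume "y \<in> {frac (real i * \<theta>) | i. i \<ge> (1::nat)}"
  then obtain i :: nat where i: "y = frac (real i * \<theta>)" "i \<ge> 1" by blast
  have "dint (real i * \<theta> - y) < X powr (- \<tau>)" if "X \<ge> real i" for X
    unfolding dint_less_iff using that i(2)
    by (intro exI[of _ "\<lfloor>real i * \<theta>\<rfloor>"]) (simp add: i(1) frac_def)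
  thus "y \<in> U_set \<tau> \<theta>"
    unfolding U_set_def using i by (auto simp: frac_lt_1 intro!: exI[of _ "real i"] exI[of _ i])
qed

text \<open>Since s < \<tau>, a change of the approximating index at a late time X would give some d
  \<le> X with dint (d * \<theta>) < c * d powr (- s). Hence the index is eventually constant, and
  its distance to y is 0.\<close>

lemma U_set_orbit:
  assumes s: "0 < s" "s < \<tau>" and w: "irr_exp \<theta> < ereal s"
  shows "U_set \<tau> \<theta> = {frac (real i * \<theta>) | i. i \<ge> (1::nat)}"
proof (intro antisym orbit_subset_U_set subsetI)
  fix y assume y: "y \<in> U_set \<tau> \<theta>"
  obtain c where c: "c > 0" "\<And>j. j \<ge> 1 \<Longrightarrow> dint (real j * \<theta>) \<ge> c * real j powr (- s)"
    using badly_approximable[OF s(1) w] by blast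
  obtain Q0 where Q0: "\<And>X::real. X \<ge> Q0 \<Longrightarrow> \<exists>N::nat. 1 \<le> N \<and> real N \<le> X \<and> dint (real N * \<theta> - y) < X powr (- \<tau>)"
    using y unfolding U_set_def by blast
  define Z where "Z = (2 / c) powr (1 / (\<tau> - s))"
  define X0 where "X0 = nat \<lceil>max Z Q0\<rceil> + 1"
  have X0: "real X0 \<ge> Z" "real X0 \<ge> Q0" "X0 \<ge> 1" unfolding X0_def by linarith+
  have far: "2 * real X powr (- \<tau>) \<le> c * real X powr (- s)" if X: "X \<ge> X0" for X
  proof -
    have "2 / c = Z powr (\<tau> - s)" using c(1) s by (simp add: Z_def powr_powr)
    also have "\<dots> \<le> real X powr (\<tau> - s)"
      using X X0 s by (intro powr_mono2) (auto simp: Z_def)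
    finally have "2 \<le> c * real X powr (\<tau> - s)" using c(1) by (simp add: field_simps)
    hence "2 * real X powr (- \<tau>) \<le> c * real X powr (\<tau> - s) * real X powr (- \<tau>)"
      by (intro mult_right_mono) auto
    thus ?thesis by (simp add: mult.assoc flip: powr_add)
  qed
  obtain N where N: "1 \<le> N" "real N \<le> real X0" "dint (real N * \<theta> - y) < real X0 powr (- \<tau>)"
    using Q0[OF X0(2)] by blast
  have "dint (real N * \<theta> - y) < real X powr (- \<tau>)" if "X \<ge> X0" for X
    using that
  proof (induction rule: dec_induct)
    case (step X)
    have "real (Suc X) \<ge> Q0" using step.hyps X0(2) by simp
    then obtain N' where N': "1 \<le> N'" "real N' \<le> real (Suc X)"
      "dint (real N' * \<theta> - y) < real (Suc X) powr (- \<tau>)" using Q0 by blast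
    have "N' = N"
    proof (rule ccontr)
      assume ne: "N' \<noteq> N"
      define d where "d = (if N' < N then N - N' else N' - N)"
      have d: "1 \<le> d" "d \<le> X" using ne N N' step.hyps by (auto simp: d_def)
      have "real (Suc X) powr (- \<tau>) \<le> real X powr (- \<tau>)"
        using step.hyps X0(3) s by (intro powr_mono2') auto
      hence "dint (real N' * \<theta> - y) < real X powr (- \<tau>)" using N'(3) by linarith
      hence "dint (real d * \<theta>) < 2 * real X powr (- \<tau>)"
        using dint_diff_less[OF step.IH] dint_diff_less[OF _ step.IH]
        by (auto simp: d_def of_nat_diff left_diff_distrib)
      also have "\<dots> \<le> c * real X powr (- s)" using step.hyps by (intro far) auto
      also have "\<dots> \<le> c * real d powr (- s)"
        using d s c(1) by (intro mult_left_mono powr_mono2') auto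
      also have "\<dots> \<le> dint (real d * \<theta>)" using d(1) by (rule c(2))
      finally show False by simp
    qed
    thus ?case using N' by simp
  qed (rule N(3))
  moreover have "(\<lambda>X. real X powr (- \<tau>)) \<longlonglongrightarrow> 0"
    using s by (intro tendsto_neg_powr filterlim_real_sequentially) auto
  ultimately have "dint (real N * \<theta> - y) \<le> 0"
    by (intro tendsto_lowerbound) (auto simp: eventually_sequentially intro!: exI[of _ X0] less_imp_le)
  hence "real N * \<theta> - y = of_int (round (real N * \<theta> - y))" by (simp add: dint_def)
  hence "real N * \<theta> - y \<in> \<int>" by (metis Ints_of_int)
  moreover have "0 \<le> y" "y < 1" using y by (auto simp: U_set_def)
  ultimately have "frac (real N * \<theta>) = y" by (simp add: frac_unique_iff)
  thus "y \<in> {frac (real i * \<theta>) | i. i \<ge> (1::nat)}" using N(1) by blast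
qed

lemma infinite_approximating_denominators:
  assumes t: "t > 0" and w: "ereal t < irr_exp \<theta>" and \<beta>: "\<beta> \<ge> 1"
  shows "infinite {q m | m. real (q m) powr t * dint (real (q m) * \<theta>) < \<beta>}"
  unfolding infinite_nat_iff_unbounded_le
proof
  fix M
  obtain m where m: "m \<ge> M" "real (q m) powr t * D m < 1"
    using frequently_well_approximable[OF t w] by blast
  have "real (q m) powr t * dint (real (q m) * \<theta>) \<le> real (q m) powr t * D m"
    by (intro mult_left_mono dint_q_le) auto
  hence "real (q m) powr t * dint (real (q m) * \<theta>) < \<beta>" using m(2) \<beta> by linarith
  moreover have "M \<le> q m" using m(1) q_ge[of m] by linarith
  ultimately show "\<exists>n\<ge>M. n \<in> {q m | m. real (q m) powr t * dint (real (q m) * \<theta>) < \<beta>}" by blast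
qed

end

theorem theorem1:
  fixes \<theta> :: real
  assumes "0 < \<theta>" "\<theta> < 1" "\<theta> \<notin> \<rat>" "irr_exp \<theta> > 1"
  shows "(\<forall>\<tau>. 0 < \<tau> \<and> ereal \<tau> < 1 / irr_exp \<theta> \<longrightarrow> U_set \<tau> \<theta> = {0..<1})
    \<and> (\<forall>\<tau>. ereal \<tau> > irr_exp \<theta> \<longrightarrow> U_set \<tau> \<theta> = {frac (real i * \<theta>) | i. i \<ge> (1::nat)})
    \<and> (\<forall>\<tau>. 1 / irr_exp \<theta> < ereal \<tau> \<and> \<tau> < 1 \<longrightarrow>
         (let S = {cf_q \<theta> m | m. real (cf_q \<theta> m) * dint (real (cf_q \<theta> m) * \<theta>) powr \<tau> < 1};
              n = (\<lambda>k. real (enumerate S k)) in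
          hausdorff_dim (U_set \<tau> \<theta>) =
            Liminf sequentially (\<lambda>k. ereal (
              ln (n k powr (1 / \<tau> + 1) * (\<Prod>j<k. n j powr (1 / \<tau>) * dint (n j * \<theta>)))
              / ln (n k / dint (n k * \<theta>))))))
    \<and> (\<forall>\<tau>. 1 < \<tau> \<and> ereal \<tau> < irr_exp \<theta> \<longrightarrow>
         (let S = {cf_q \<theta> m | m. real (cf_q \<theta> m) powr \<tau> * dint (real (cf_q \<theta> m) * \<theta>) < 2};
              n = (\<lambda>k. real (enumerate S k)) in
          hausdorff_dim (U_set \<tau> \<theta>) =
            Liminf sequentially (\<lambda>k. ereal (
              - ln (\<Prod>j<k. n j * dint (n j * \<theta>) powr (1 / \<tau>))
              / ln (n k / dint (n k * \<theta>))))))"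
proof (intro conjI allI impI)
  interpret irrational_unit \<theta> by unfold_locales (use assms in auto)
  have w1: "irr_exp \<theta> > 1" by fact
  {
    fix \<tau> :: real assume \<tau>: "0 < \<tau> \<and> ereal \<tau> < 1 / irr_exp \<theta>"
    \<comment> \<open>An infinite exponent would make the upper bound on \<tau> equal to 0.\<close>
    obtain w where w: "irr_exp \<theta> = ereal w" "w > 1"
      using \<tau> w1 by (cases "irr_exp \<theta>") auto
    have "w < 1 / \<tau>" using \<tau> w by (simp add: one_ereal_def field_simps)
    then obtain s where s: "w < s" "s < 1 / \<tau>" using dense by blast
    show "U_set \<tau> \<theta> = {0..<1}"
      by (rule U_set_full[of _ s]) (use \<tau> w s in \<open>auto simp: field_simps\<close>)
  next
    fix \<tau> :: real assume \<tau>: "irr_exp \<theta> < ereal \<tau>"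
    obtain w where w: "irr_exp \<theta> = ereal w" "w > 1"
      using \<tau> w1 by (cases "irr_exp \<theta>") auto
    then obtain s where s: "w < s" "s < \<tau>" using dense[of w \<tau>] \<tau> by auto
    show "U_set \<tau> \<theta> = {frac (real i * \<theta>) | i. i \<ge> (1::nat)}"
      by (rule U_set_orbit[of s]) (use w s in auto)
  next
    fix \<tau> :: real assume \<tau>: "1 / irr_exp \<theta> < ereal \<tau> \<and> \<tau> < 1"
    have \<tau>0: "\<tau> > 0" and \<tau>w: "ereal (1 / \<tau>) < irr_exp \<theta>"
    proof -
      \<comment> \<open>The infinite exponent is a case of its own: the lower bound on \<tau> is
        then just 0.\<close>
      have "\<tau> > 0 \<and> ereal (1 / \<tau>) < irr_exp \<theta>"
      proof (cases "irr_exp \<theta>")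
        case (real w)
        have "1 / w < \<tau>" "w > 1" using \<tau> w1 real by (auto simp: one_ereal_def)
        moreover from this have "\<tau> > 0" by (meson less_trans zero_less_divide_1_iff zero_less_one)
        ultimately show ?thesis using real by (simp add: field_simps)
      qed (use \<tau> w1 in auto)
      thus "\<tau> > 0" "ereal (1 / \<tau>) < irr_exp \<theta>" by auto
    qed
    define S where "S = {cf_q \<theta> m | m. real (cf_q \<theta> m) * dint (real (cf_q \<theta> m) * \<theta>) powr \<tau> < 1}"
    \<comment> \<open>Raising to the power \<tau> turns the second test, which has the shape
      required by \<open>approx_seq\<close>, into the first.\<close>
    have "real (q m) * dint (real (q m) * \<theta>) powr \<tau> < 1 \<longleftrightarrow>
      real (q m) powr (1 / \<tau>) * dint (real (q m) * \<theta>) < 1" for m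
    proof -
      let ?x = "real (q m) powr (1 / \<tau>) * dint (real (q m) * \<theta>)"
      have x0: "?x \<ge> 0" by (simp add: dint_nonneg)
      have "?x powr \<tau> = real (q m) * dint (real (q m) * \<theta>) powr \<tau>"
        using \<tau>0 by (simp add: powr_mult powr_powr)
      moreover have "?x powr \<tau> < 1 \<longleftrightarrow> ?x < 1"
        using powr_less_mono2[of \<tau> ?x 1] powr_mono2[of \<tau> 1 ?x] \<tau>0 x0 by fastforce
      ultimately show ?thesis by simp
    qed
    hence S_eq: "S = {cf_q \<theta> m | m. real (cf_q \<theta> m) powr (1 / \<tau>) * dint (real (cf_q \<theta> m) * \<theta>) < 1}"
      unfolding S_def by simp
    interpret A: approx_seq \<theta> \<tau> "1 / \<tau>" 1 S
    proof
      show "infinite S" unfolding S_eq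
        by (rule infinite_approximating_denominators) (use \<tau>0 \<tau>w in auto)
    qed (use \<tau> \<tau>0 S_eq in \<open>auto simp: field_simps\<close>)
    show "let S = {cf_q \<theta> m | m. real (cf_q \<theta> m) * dint (real (cf_q \<theta> m) * \<theta>) powr \<tau> < 1};
              n = (\<lambda>k. real (enumerate S k)) in
          hausdorff_dim (U_set \<tau> \<theta>) =
            Liminf sequentially (\<lambda>k. ereal (
              ln (n k powr (1 / \<tau> + 1) * (\<Prod>j<k. n j powr (1 / \<tau>) * dint (n j * \<theta>)))
              / ln (n k / dint (n k * \<theta>))))"
      unfolding Let_def S_def[symmetric]
      using A.hausdorff_dim_U_set_less_1 \<tau> unfolding A.n_def A.e_def by blast
  next
    fix \<tau> :: real assume \<tau>: "1 < \<tau> \<and> ereal \<tau> < irr_exp \<theta>"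
    define S where "S = {cf_q \<theta> m | m. real (cf_q \<theta> m) powr \<tau> * dint (real (cf_q \<theta> m) * \<theta>) < 2}"
    interpret A: approx_seq \<theta> \<tau> \<tau> 2 S
    proof
      show "infinite S" unfolding S_def
        by (rule infinite_approximating_denominators) (use \<tau> in auto)
    qed (use \<tau> S_def in auto)
    show "let S = {cf_q \<theta> m | m. real (cf_q \<theta> m) powr \<tau> * dint (real (cf_q \<theta> m) * \<theta>) < 2};
              n = (\<lambda>k. real (enumerate S k)) in
          hausdorff_dim (U_set \<tau> \<theta>) =
            Liminf sequentially (\<lambda>k. ereal (
              - ln (\<Prod>j<k. n j * dint (n j * \<theta>) powr (1 / \<tau>))
              / ln (n k / dint (n k * \<theta>))))"
      unfolding Let_def S_def[symmetric]
      using A.hausdorff_dim_U_set_greater_1 unfolding A.n_def A.e_def by blast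
  }
qed

end
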